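(* Let $(S,g,\xi_i,\eta_i,\Phi_i)$ be a regular or quasi-regular $3$-Sasakian orbifold of dimension $7$, and let $Z$ be the quotient of $S$ by the foliation generated by $\xi_3$. Consider the $2$-forms $\alpha_i$ $(i=1,2,3)$ on $S$ defined by $2\alpha_i:=d\eta_i-\epsilon_{ijk}\,\eta_j\wedge\eta_k$ (sum over $j,k$), and set $\alpha:=\alpha_1+i\alpha_2$, $\eta:=\eta_1+i\eta_2$. For $a,b\in\mathbb{R}$ and $c\in\mathbb{C}$ put $$\omega_{a,b}:=a\,\alpha_3-\frac{i}{2}b^2\,\eta\wedge\bar\eta,\qquad \Omega_c:=c\,\alpha\wedge\bar\eta .$$ These two forms are basic with respect to $\xi_3$, and they define an $SU(3)$-structure on $Z$ if and only if $$a>0,\qquad c\neq 0,\qquad b^2=\frac{|c|^2}{a^2}.$$ In that case, the $SU(3)$-structure is LT and the non-vanishing torsion classes are given by $$W_1=\frac{4e^{i\gamma}(a+b^2)}{3ab},\qquad W_2=\frac{4e^{i\gamma}(2b^2-a)}{3ab}\Big(\omega_{a,b}+\frac{3ib^2}{2}\,\eta\wedge\bar\eta\Big),$$ where $c=ab\,e^{i\gamma}$ with $\gamma\in\mathbb{R}$.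
   Context: **3-Sasakian structures.** A Riemannian manifold $(S,g)$ is $3$-Sasakian if its cone $(C(S)=S\times\mathbb{R}_{>0},\ \bar g=dr^2+r^2g)$ is hyperkähler, with integrable complex structures $J_1,J_2,J_3$, each Kähler with respect to $\bar g$, satisfying $J_iJ_j=-\delta_{ij}+\epsilon_{ijk}J_k$, where $\epsilon_{ijk}$ is the Levi-Civita symbol. $S$ is identified with $\{r=1\}\subset C(S)$. The Reeb vector fields are $\xi_i=J_i(r\partial_r)$ (tangent to $S$), the dual contact forms are $\eta_i=\frac1{r^2}\bar g(\xi_i,\cdot)$ (restricted to $S$), and $\Phi_i=\nabla\xi_i$ with $\nabla$ the Levi-Civita connection of $g$. They satisfy $$\eta_i(\xi_j)=\delta_{ij},\quad \iota_{\xi_i}d\eta_i=0\ (\text{no sum}),\quad \Phi_i\xi_j=\epsilon_{ijk}\xi_k,\quad \Phi_i\Phi_j-\eta_j\otimes\xi_i=-\delta_{ij}+\epsilon_{ijk}\Phi_k,\quad [\xi_i,\xi_j]=-2\epsilon_{ijk}\xi_k,$$ and $\omega_i:=\bar g(J_i\cdot,\cdot)=\frac12 d(r^2\eta_i)$. A $3$-Sasakian orbifold is a Riemannian orbifold with three characteristic vector fields satisfying these relations and preserved by the local uniformizing groups. The foliation generated by a Reeb vector field $\xi_u=u_1\xi_1+u_2\xi_2+u_3\xi_3$, $u\in S^2$ (in particular by $\xi_3$), is quasi-regular if $\xi_u$ integrates to an almost-free, effective $S^1$-action, and regular if this action is free; $S$ is called (quasi-)regular accordingly. The quotient $Z$ of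 $S$ by the foliation generated by $\xi_3$ is then a $6$-dimensional orbifold, and forms and tensors on $Z$ are understood in the orbifold sense. A form $\beta$ on $S$ is basic with respect to $\xi_3$ if $\iota_{\xi_3}\beta=0$ and $\mathcal{L}_{\xi_3}\beta=0$; basic forms descend to $Z$ and are denoted by the same symbol. **$SU(3)$-structures.** An $SU(3)$-structure on a $6$-dimensional manifold or orbifold is an almost hermitian structure $(g,J,\omega)$ (that is, $J$ is an almost complex structure, $\omega$ is a real $2$-form with $\omega(J\cdot,J\cdot)=\omega$, and $g=\omega(\cdot,J\cdot)$ is a Riemannian metric) together with a nowhere vanishing $(3,0)$-form $\Omega$ such that $\omega\wedge\Omega=0$ and $\Omega\wedge\overline\Omega=-8i\,\frac{\omega^3}{3!}$. ($J$ and $g$ are determined by $\omega,\Omega$.) Its torsion classes $W_1,\dots,W_5$ are defined by $$d\omega=\tfrac32\,\mathrm{Im}(\overline{W_1}\,\Omega)+W_4\wedge\omega+W_3,\qquad d\Omega=W_1\,\omega^2+W_2\wedge\omega+\overline{W_5}\wedge\Omega,$$ where $W_1$ is a complex function, $W_2$ a primitive $(1,1)$-form, $W_3$ a real primitive $(2,1)+(1,2)$-form, $W_4$ a real $1$-form and $W_5$ a $(1,0)$-form; a $k$-form $\beta$ is primitive if $\beta\wedge\omega^{4-k}=0$. The structure is LT if $W_3=W_4=W_5=0$ with $W_1$ and $W_2$ both non-zero.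
   Formalization: The structure is claimed to be LT only for a ≠ 2b², because for a = 2b² the stated formula gives W_2 = 0, so it is not LT; the formulas for W_1 and W_2 and the vanishing of W_3, W_4, W_5 are kept in all cases. *)

theory Defs
  imports "HOL-Analysis.Analysis" "HOL-Algebra.Bij"
begin

section \<open>Calculus on open subsets of a Euclidean space\<close>

primrec Ck_on :: "nat \<Rightarrow> 'v::euclidean_space set \<Rightarrow> ('v \<Rightarrow> 'w::real_normed_vector) \<Rightarrow> bool" where
  "Ck_on 0 U f \<longleftrightarrow> continuous_on U f"
| "Ck_on (Suc k) U f \<longleftrightarrow> (\<forall>x\<in>U. f differentiable (at x)) \<and>
     (\<forall>v. Ck_on k U (\<lambda>x. frechet_derivative f (at x) v))"

text \<open>Only used for open \<open>U\<close>; finite dimension makes directional derivatives sufficient.\<close>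
definition smooth_on :: "'v::euclidean_space set \<Rightarrow> ('v \<Rightarrow> 'w::real_normed_vector) \<Rightarrow> bool" where
  "smooth_on U f \<longleftrightarrow> (\<forall>k. Ck_on k U f)"

definition lie_bracket :: "('v::euclidean_space \<Rightarrow> 'v) \<Rightarrow> ('v \<Rightarrow> 'v) \<Rightarrow> 'v \<Rightarrow> 'v" where
  "lie_bracket X Y x = frechet_derivative Y (at x) (X x) - frechet_derivative X (at x) (Y x)"

text \<open>A form at a point is a function of the list of its arguments. A \<open>k\<close>-form vanishes on lists
  of length other than \<open>k\<close>, so that equality of forms is equality of functions.
  All forms are complex valued; a form is real if its values are.\<close>
type_synonym 'v mform = "'v list \<Rightarrow> complex"
type_synonym 'v dform = "'v \<Rightarrow> 'v mform"

definition alternating_form :: "nat \<Rightarrow> 'v::euclidean_space mform \<Rightarrow> bool" where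
  "alternating_form k \<alpha> \<longleftrightarrow>
     (\<forall>vs. length vs \<noteq> k \<longrightarrow> \<alpha> vs = 0) \<and>
     (\<forall>vs i. length vs = k \<and> i < k \<longrightarrow> linear (\<lambda>v. \<alpha> (vs[i := v]))) \<and>
     (\<forall>vs i j. length vs = k \<and> i < j \<and> j < k \<and> vs ! i = vs ! j \<longrightarrow> \<alpha> vs = 0)"

definition form_on :: "'v::euclidean_space set \<Rightarrow> nat \<Rightarrow> 'v dform \<Rightarrow> bool" where
  "form_on U k \<beta> \<longleftrightarrow> (\<forall>x\<in>U. alternating_form k (\<beta> x)) \<and> (\<forall>vs. smooth_on U (\<lambda>x. \<beta> x vs))"

definition form1 :: "('v \<Rightarrow> real) \<Rightarrow> 'v mform" where
  "form1 f vs = (case vs of [u] \<Rightarrow> complex_of_real (f u) | _ \<Rightarrow> 0)"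

definition form2 :: "('v \<Rightarrow> 'v \<Rightarrow> real) \<Rightarrow> 'v mform" where
  "form2 f vs = (case vs of [u, v] \<Rightarrow> complex_of_real (f u v) | _ \<Rightarrow> 0)"

text \<open>The wedge product, by the rule that contraction with a vector is an antiderivation.
  Unfolding the recursion gives the signed sum over all shuffles, that is, the convention
  \<open>(\<alpha> \<and> \<beta>)(u, v) = \<alpha>(u) \<beta>(v) - \<alpha>(v) \<beta>(u)\<close> for 1-forms, without factorials.\<close>
fun wedge :: "'v mform \<Rightarrow> 'v mform \<Rightarrow> 'v mform" (infixr \<open>\<and>\<^sub>f\<close> 72) where
  "wedge \<alpha> \<beta> [] = \<alpha> [] * \<beta> []"
| "wedge \<alpha> \<beta> (v # vs) =
     wedge (\<lambda>us. \<alpha> (v # us)) \<beta> vs + wedge (\<lambda>us. (-1) ^ length us * \<alpha> us) (\<lambda>us. \<beta> (v # us)) vs"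

text \<open>The factor with exponent zero is the 0-form 1.\<close>
primrec wedge_power :: "'v mform \<Rightarrow> nat \<Rightarrow> 'v mform" where
  "wedge_power \<alpha> 0 = (\<lambda>vs. if vs = [] then 1 else 0)"
| "wedge_power \<alpha> (Suc n) = \<alpha> \<and>\<^sub>f wedge_power \<alpha> n"

definition cnj_form :: "'v mform \<Rightarrow> 'v mform" where
  "cnj_form \<alpha> vs = cnj (\<alpha> vs)"

definition real_form :: "'v mform \<Rightarrow> bool" where
  "real_form \<alpha> \<longleftrightarrow> (\<forall>vs. \<alpha> vs \<in> \<real>)"

text \<open>\<open>d\<beta>(X, Y) = X \<beta>(Y) - Y \<beta>(X) - \<beta>([X, Y])\<close> for a 1-form, and similarly in higher degree,
  evaluated on constant vector fields.\<close>
definition ext_d :: "'v::euclidean_space dform \<Rightarrow> 'v dform" where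
  "ext_d \<beta> x vs = (\<Sum>i<length vs. (-1) ^ i *
     frechet_derivative (\<lambda>y. \<beta> y (take i vs @ drop (Suc i) vs)) (at x) (vs ! i))"

definition contraction :: "('v \<Rightarrow> 'v) \<Rightarrow> 'v dform \<Rightarrow> 'v dform" where
  "contraction X \<beta> x vs = \<beta> x (X x # vs)"

text \<open>\<open>(L\<^sub>X \<beta>)(v\<^sub>1, \<dots>) = X (\<beta>(v\<^sub>1, \<dots>)) - \<Sum>\<^sub>i \<beta>(\<dots>, [X, v\<^sub>i], \<dots>)\<close> for constant \<open>v\<^sub>i\<close>,
  for which \<open>[X, v\<^sub>i] = - DX(v\<^sub>i)\<close>.\<close>
definition lie_derivative :: "('v::euclidean_space \<Rightarrow> 'v) \<Rightarrow> 'v dform \<Rightarrow> 'v dform" where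
  "lie_derivative X \<beta> x vs = frechet_derivative (\<lambda>y. \<beta> y vs) (at x) (X x) +
     (\<Sum>i<length vs. \<beta> x (vs[i := frechet_derivative X (at x) (vs ! i)]))"

definition pullback :: "('v::euclidean_space \<Rightarrow> 'w::euclidean_space) \<Rightarrow> 'w dform \<Rightarrow> 'v dform" where
  "pullback f \<beta> x vs = \<beta> (f x) (map (frechet_derivative f (at x)) vs)"

lemma wedge_form1: "(form1 f \<and>\<^sub>f form1 h) [u, v] = of_real (f u * h v - f v * h u)"
  by (simp add: form1_def)

lemma ext_d_one_form:
  "ext_d \<beta> x [u, v] =
     frechet_derivative (\<lambda>y. \<beta> y [v]) (at x) u - frechet_derivative (\<lambda>y. \<beta> y [u]) (at x) v"
  by (simp add: ext_d_def numeral_2_eq_2)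


section \<open>Riemannian, Kaehler and 3-Sasakian structures in a chart\<close>

type_synonym 'v metric = "'v \<Rightarrow> 'v \<Rightarrow> 'v \<Rightarrow> real"

definition riemannian_on :: "'v::euclidean_space set \<Rightarrow> 'v metric \<Rightarrow> bool" where
  "riemannian_on U g \<longleftrightarrow>
     (\<forall>x\<in>U. bilinear (g x) \<and> (\<forall>u v. g x u v = g x v u) \<and> (\<forall>u. u \<noteq> 0 \<longrightarrow> g x u u > 0)) \<and>
     (\<forall>u v. smooth_on U (\<lambda>x. g x u v))"

text \<open>\<open>\<Gamma>\<close> is the Christoffel tensor of the Levi-Civita connection
  \<open>\<nabla>\<^sub>u Y = DY(u) + \<Gamma>(u, Y)\<close>: it is symmetric (no torsion) and \<open>\<nabla>g = 0\<close>.\<close>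
definition levi_civita_on :: "'v::euclidean_space set \<Rightarrow> 'v metric \<Rightarrow> ('v \<Rightarrow> 'v \<Rightarrow> 'v \<Rightarrow> 'v) \<Rightarrow> bool" where
  "levi_civita_on U g \<Gamma> \<longleftrightarrow>
     (\<forall>x\<in>U. bilinear (\<Gamma> x) \<and> (\<forall>u v. \<Gamma> x u v = \<Gamma> x v u) \<and>
       (\<forall>u v w. frechet_derivative (\<lambda>y. g y v w) (at x) u = g x (\<Gamma> x u v) w + g x v (\<Gamma> x u w)))"

definition almost_complex_on :: "'v::euclidean_space set \<Rightarrow> ('v \<Rightarrow> 'v \<Rightarrow> 'v) \<Rightarrow> bool" where
  "almost_complex_on U J \<longleftrightarrow>
     (\<forall>x\<in>U. linear (J x) \<and> (\<forall>u. J x (J x u) = - u)) \<and> (\<forall>u. smooth_on U (\<lambda>x. J x u))"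

text \<open>\<open>N(u, v) = [Ju, Jv] - J[Ju, v] - J[u, Jv] - [u, v]\<close> for constant \<open>u\<close>, \<open>v\<close>.\<close>
definition nijenhuis :: "('v::euclidean_space \<Rightarrow> 'v \<Rightarrow> 'v) \<Rightarrow> 'v \<Rightarrow> 'v \<Rightarrow> 'v \<Rightarrow> 'v" where
  "nijenhuis J x u v = lie_bracket (\<lambda>y. J y u) (\<lambda>y. J y v) x
     - J x (lie_bracket (\<lambda>y. J y u) (\<lambda>_. v) x) - J x (lie_bracket (\<lambda>_. u) (\<lambda>y. J y v) x)"

definition fundamental_form :: "'v metric \<Rightarrow> ('v \<Rightarrow> 'v \<Rightarrow> 'v) \<Rightarrow> 'v dform" where
  "fundamental_form h J x = form2 (\<lambda>u v. h x (J x u) v)"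

definition kaehler_on :: "'v::euclidean_space set \<Rightarrow> 'v metric \<Rightarrow> ('v \<Rightarrow> 'v \<Rightarrow> 'v) \<Rightarrow> bool" where
  "kaehler_on U h J \<longleftrightarrow> riemannian_on U h \<and> almost_complex_on U J \<and>
     (\<forall>x\<in>U. (\<forall>u v. nijenhuis J x u v = 0) \<and> (\<forall>u v. h x (J x u) (J x v) = h x u v) \<and>
       (\<forall>vs. ext_d (fundamental_form h J) x vs = 0))"

definition delta :: "nat \<Rightarrow> nat \<Rightarrow> real" where
  "delta i j = (if i = j then 1 else 0)"

definition eps :: "nat \<Rightarrow> nat \<Rightarrow> nat \<Rightarrow> real" where
  "eps i j k = (if (i, j, k) \<in> {(1, 2, 3), (2, 3, 1), (3, 1, 2)} then 1
     else if (i, j, k) \<in> {(2, 1, 3), (3, 2, 1), (1, 3, 2)} then - 1 else 0)"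

definition hyperkaehler_on ::
    "'v::euclidean_space set \<Rightarrow> 'v metric \<Rightarrow> (nat \<Rightarrow> 'v \<Rightarrow> 'v \<Rightarrow> 'v) \<Rightarrow> bool" where
  "hyperkaehler_on U h J \<longleftrightarrow> (\<forall>i\<in>{1..3}. kaehler_on U h (J i)) \<and>
     (\<forall>x\<in>U. \<forall>i\<in>{1..3}. \<forall>j\<in>{1..3}. \<forall>u.
        J i x (J j x u) = - delta i j *\<^sub>R u + (\<Sum>k\<in>{1..3}. eps i j k *\<^sub>R J k x u))"

text \<open>The cone over \<open>U\<close> is \<open>U \<times> {0<..}\<close>, with the radius as second component, so that
  \<open>r\<partial>\<^sub>r\<close> at \<open>(x, r)\<close> is \<open>(0, r)\<close>.\<close>
definition cone_metric :: "'v metric \<Rightarrow> ('v \<times> real) metric" where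
  "cone_metric g p u v = snd u * snd v + (snd p)\<^sup>2 * g (fst p) (fst u) (fst v)"

text \<open>The cone of a chart is hyperkaehler, the Reeb fields are \<open>J\<^sub>i(r\<partial>\<^sub>r)\<close>, \<open>\<eta>\<^sub>i\<close> is dual to
  \<open>\<xi>\<^sub>i\<close> and \<open>\<Phi>\<^sub>i = \<nabla>\<xi>\<^sub>i\<close>. The remaining conjuncts are the structure equations; they follow from the
  hyperkaehler condition and are listed because 3-Sasakian orbifolds are introduced by means of
  them.\<close>
definition three_sasakian_on :: "'v::euclidean_space set \<Rightarrow> 'v metric \<Rightarrow> (nat \<Rightarrow> 'v \<Rightarrow> 'v) \<Rightarrow>
    (nat \<Rightarrow> 'v dform) \<Rightarrow> (nat \<Rightarrow> 'v \<Rightarrow> 'v \<Rightarrow> 'v) \<Rightarrow> bool" where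
  "three_sasakian_on U g \<xi> \<eta> \<Phi> \<longleftrightarrow>
     riemannian_on U g \<and> (\<forall>i\<in>{1..3}. smooth_on U (\<xi> i)) \<and>
     (\<forall>x\<in>U. \<forall>i\<in>{1..3}. \<eta> i x = form1 (\<lambda>u. g x (\<xi> i x) u)) \<and>
     (\<exists>\<Gamma>. levi_civita_on U g \<Gamma> \<and>
       (\<forall>x\<in>U. \<forall>i\<in>{1..3}. \<forall>u. \<Phi> i x u = frechet_derivative (\<xi> i) (at x) u + \<Gamma> x u (\<xi> i x))) \<and>
     (\<exists>J. hyperkaehler_on (U \<times> {0<..}) (cone_metric g) J \<and>
       (\<forall>x\<in>U. \<forall>r>0. \<forall>i\<in>{1..3}. J i (x, r) (0, r) = (\<xi> i x, 0)) \<and>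
       (\<forall>p\<in>U \<times> {0<..}. \<forall>i\<in>{1..3}. \<forall>vs. fundamental_form (cone_metric g) (J i) p vs =
          ext_d (\<lambda>q us. of_real ((snd q)\<^sup>2) * \<eta> i (fst q) (map fst us)) p vs / 2)) \<and>
     (\<forall>x\<in>U. \<forall>i\<in>{1..3}.
       (\<forall>vs. contraction (\<xi> i) (ext_d (\<eta> i)) x vs = 0) \<and>
       (\<forall>j\<in>{1..3}.
         \<eta> i x [\<xi> j x] = of_real (delta i j) \<and>
         \<Phi> i x (\<xi> j x) = (\<Sum>k\<in>{1..3}. eps i j k *\<^sub>R \<xi> k x) \<and>
         (\<forall>u. \<Phi> i x (\<Phi> j x u) - g x (\<xi> j x) u *\<^sub>R \<xi> i x =
            - delta i j *\<^sub>R u + (\<Sum>k\<in>{1..3}. eps i j k *\<^sub>R \<Phi> k x u)) \<and>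
         lie_bracket (\<xi> i) (\<xi> j) x = - 2 *\<^sub>R (\<Sum>k\<in>{1..3}. eps i j k *\<^sub>R \<xi> k x)))"


section \<open>Orbifolds\<close>

text \<open>A local uniformizing system: a domain, a finite group of diffeomorphisms of it, and the
  quotient projection onto an open subset of the underlying space. Group elements are extensional
  functions, so the action is effective.\<close>
record ('v, 'a) chart =
  chart_dom :: "'v set"
  chart_grp :: "('v \<Rightarrow> 'v) set"
  chart_map :: "'v \<Rightarrow> 'a"

record ('v, 'a) orbifold_data =
  orb_space :: "'a topology"
  orb_atlas :: "('v, 'a) chart set"

definition uniformizing_chart :: "'a topology \<Rightarrow> ('v::euclidean_space, 'a) chart \<Rightarrow> bool" where
  "uniformizing_chart X c \<longleftrightarrow>
     open (chart_dom c) \<and> connected (chart_dom c) \<and> chart_dom c \<noteq> {} \<and>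
     finite (chart_grp c) \<and> subgroup (chart_grp c) (BijGroup (chart_dom c)) \<and>
     (\<forall>\<gamma>\<in>chart_grp c. smooth_on (chart_dom c) \<gamma>) \<and>
     openin X (chart_map c ` chart_dom c) \<and>
     quotient_map (top_of_set (chart_dom c)) (subtopology X (chart_map c ` chart_dom c)) (chart_map c) \<and>
     (\<forall>x\<in>chart_dom c. \<forall>y\<in>chart_dom c. chart_map c x = chart_map c y \<longleftrightarrow> (\<exists>\<gamma>\<in>chart_grp c. y = \<gamma> x))"

text \<open>A local diffeomorphism \<open>W \<rightarrow> h ` W\<close> between chart domains over the identity of the underlying
  space. For \<open>c = d\<close> the elements of the local group are transitions.\<close>
definition transition :: "('v::euclidean_space, 'a) chart \<Rightarrow> ('v, 'a) chart \<Rightarrow> 'v set \<Rightarrow> ('v \<Rightarrow> 'v) \<Rightarrow> bool" where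
  "transition c d W h \<longleftrightarrow> open W \<and> W \<subseteq> chart_dom c \<and> open (h ` W) \<and> h ` W \<subseteq> chart_dom d \<and>
     inj_on h W \<and> smooth_on W h \<and> smooth_on (h ` W) (inv_into W h) \<and>
     (\<forall>x\<in>W. chart_map d (h x) = chart_map c x)"

definition orbifold :: "('v::euclidean_space, 'a) orbifold_data \<Rightarrow> bool" where
  "orbifold S \<longleftrightarrow>
     topspace (orb_space S) \<noteq> {} \<and> Hausdorff_space (orb_space S) \<and> second_countable (orb_space S) \<and>
     (\<forall>c\<in>orb_atlas S. uniformizing_chart (orb_space S) c) \<and>
     topspace (orb_space S) = (\<Union>c\<in>orb_atlas S. chart_map c ` chart_dom c) \<and>
     (\<forall>c\<in>orb_atlas S. \<forall>d\<in>orb_atlas S. \<forall>x\<in>chart_dom c. \<forall>y\<in>chart_dom d.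
        chart_map c x = chart_map d y \<longrightarrow> (\<exists>W h. transition c d W h \<and> x \<in> W \<and> h x = y))"

text \<open>Tensors on an orbifold are families of tensors on the chart domains that are preserved by all
  transitions, in particular by the local groups.\<close>

definition orbifold_function :: "('v::euclidean_space, 'a) orbifold_data \<Rightarrow>
    (('v, 'a) chart \<Rightarrow> 'v \<Rightarrow> complex) \<Rightarrow> bool" where
  "orbifold_function S f \<longleftrightarrow> (\<forall>c\<in>orb_atlas S. smooth_on (chart_dom c) (f c)) \<and>
     (\<forall>c\<in>orb_atlas S. \<forall>d\<in>orb_atlas S. \<forall>W h. transition c d W h \<longrightarrow> (\<forall>x\<in>W. f d (h x) = f c x))"

definition orbifold_vector_field :: "('v::euclidean_space, 'a) orbifold_data \<Rightarrow>
    (('v, 'a) chart \<Rightarrow> 'v \<Rightarrow> 'v) \<Rightarrow> bool" where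
  "orbifold_vector_field S X \<longleftrightarrow> (\<forall>c\<in>orb_atlas S. smooth_on (chart_dom c) (X c)) \<and>
     (\<forall>c\<in>orb_atlas S. \<forall>d\<in>orb_atlas S. \<forall>W h. transition c d W h \<longrightarrow>
        (\<forall>x\<in>W. frechet_derivative h (at x) (X c x) = X d (h x)))"

definition orbifold_metric :: "('v::euclidean_space, 'a) orbifold_data \<Rightarrow>
    (('v, 'a) chart \<Rightarrow> 'v metric) \<Rightarrow> bool" where
  "orbifold_metric S g \<longleftrightarrow> (\<forall>c\<in>orb_atlas S. riemannian_on (chart_dom c) (g c)) \<and>
     (\<forall>c\<in>orb_atlas S. \<forall>d\<in>orb_atlas S. \<forall>W h. transition c d W h \<longrightarrow>
        (\<forall>x\<in>W. \<forall>u v. g d (h x) (frechet_derivative h (at x) u) (frechet_derivative h (at x) v) = g c x u v))"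

definition orbifold_almost_complex :: "('v::euclidean_space, 'a) orbifold_data \<Rightarrow>
    (('v, 'a) chart \<Rightarrow> 'v \<Rightarrow> 'v \<Rightarrow> 'v) \<Rightarrow> bool" where
  "orbifold_almost_complex S J \<longleftrightarrow> (\<forall>c\<in>orb_atlas S. almost_complex_on (chart_dom c) (J c)) \<and>
     (\<forall>c\<in>orb_atlas S. \<forall>d\<in>orb_atlas S. \<forall>W h. transition c d W h \<longrightarrow>
        (\<forall>x\<in>W. \<forall>u. J d (h x) (frechet_derivative h (at x) u) = frechet_derivative h (at x) (J c x u)))"

type_synonym ('v, 'a) oform = "('v, 'a) chart \<Rightarrow> 'v dform"

definition orbifold_form :: "('v::euclidean_space, 'a) orbifold_data \<Rightarrow> nat \<Rightarrow> ('v, 'a) oform \<Rightarrow> bool" where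
  "orbifold_form S k \<beta> \<longleftrightarrow> (\<forall>c\<in>orb_atlas S. form_on (chart_dom c) k (\<beta> c)) \<and>
     (\<forall>c\<in>orb_atlas S. \<forall>d\<in>orb_atlas S. \<forall>W h. transition c d W h \<longrightarrow>
        (\<forall>x\<in>W. pullback h (\<beta> d) x = \<beta> c x))"

definition three_sasakian_orbifold :: "('v::euclidean_space, 'a) orbifold_data \<Rightarrow>
    (('v, 'a) chart \<Rightarrow> 'v metric) \<Rightarrow> (nat \<Rightarrow> ('v, 'a) chart \<Rightarrow> 'v \<Rightarrow> 'v) \<Rightarrow>
    (nat \<Rightarrow> ('v, 'a) oform) \<Rightarrow> (nat \<Rightarrow> ('v, 'a) chart \<Rightarrow> 'v \<Rightarrow> 'v \<Rightarrow> 'v) \<Rightarrow> bool" where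
  "three_sasakian_orbifold S g \<xi> \<eta> \<Phi> \<longleftrightarrow> orbifold S \<and> orbifold_metric S g \<and>
     (\<forall>i\<in>{1..3}. orbifold_vector_field S (\<xi> i)) \<and>
     (\<forall>c\<in>orb_atlas S.
        three_sasakian_on (chart_dom c) (g c) (\<lambda>i. \<xi> i c) (\<lambda>i. \<eta> i c) (\<lambda>i. \<Phi> i c))"


section \<open>Circle actions and the space of leaves\<close>

text \<open>\<open>\<rho>\<close> is an action of the circle \<open>\<real> / T\<int>\<close> on the underlying space that lifts locally to smooth
  families of maps between chart domains, with velocity \<open>X\<close>.\<close>
definition integrates_to_circle_action :: "('v::euclidean_space, 'a) orbifold_data \<Rightarrow>
    (('v, 'a) chart \<Rightarrow> 'v \<Rightarrow> 'v) \<Rightarrow> real \<Rightarrow> (real \<Rightarrow> 'a \<Rightarrow> 'a) \<Rightarrow> bool" where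
  "integrates_to_circle_action S X T \<rho> \<longleftrightarrow> T > 0 \<and>
     (\<forall>p\<in>topspace (orb_space S). (\<forall>t. \<rho> t p \<in> topspace (orb_space S)) \<and> \<rho> 0 p = p \<and> \<rho> T p = p \<and>
        (\<forall>s t. \<rho> (s + t) p = \<rho> s (\<rho> t p))) \<and>
     (\<forall>t\<^sub>0. \<forall>c\<in>orb_atlas S. \<forall>d\<in>orb_atlas S. \<forall>x\<in>chart_dom c. \<forall>y\<in>chart_dom d.
        \<rho> t\<^sub>0 (chart_map c x) = chart_map d y \<longrightarrow>
        (\<exists>\<epsilon>>0. \<exists>W F. open W \<and> x \<in> W \<and> W \<subseteq> chart_dom c \<and>
           smooth_on ({t\<^sub>0 - \<epsilon><..<t\<^sub>0 + \<epsilon>} \<times> W) (\<lambda>(t, z). F t z) \<and> F t\<^sub>0 x = y \<and>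
           (\<forall>t\<in>{t\<^sub>0 - \<epsilon><..<t\<^sub>0 + \<epsilon>}. \<forall>z\<in>W. F t z \<in> chart_dom d \<and>
              chart_map d (F t z) = \<rho> t (chart_map c z) \<and>
              ((\<lambda>s. F s z) has_vector_derivative X d (F t z)) (at t))))"

definition quasi_regular :: "('v::euclidean_space, 'a) orbifold_data \<Rightarrow>
    (('v, 'a) chart \<Rightarrow> 'v \<Rightarrow> 'v) \<Rightarrow> real \<Rightarrow> (real \<Rightarrow> 'a \<Rightarrow> 'a) \<Rightarrow> bool" where
  "quasi_regular S X T \<rho> \<longleftrightarrow> integrates_to_circle_action S X T \<rho> \<and>
     (\<forall>p\<in>topspace (orb_space S). finite {t \<in> {0..<T}. \<rho> t p = p}) \<and>
     (\<forall>t. (\<forall>p\<in>topspace (orb_space S). \<rho> t p = p) \<longrightarrow> (\<exists>n::int. t = of_int n * T))"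

definition regular :: "('v::euclidean_space, 'a) orbifold_data \<Rightarrow>
    (('v, 'a) chart \<Rightarrow> 'v \<Rightarrow> 'v) \<Rightarrow> real \<Rightarrow> (real \<Rightarrow> 'a \<Rightarrow> 'a) \<Rightarrow> bool" where
  "regular S X T \<rho> \<longleftrightarrow> integrates_to_circle_action S X T \<rho> \<and>
     (\<forall>p\<in>topspace (orb_space S). \<forall>t. \<rho> t p = p \<longrightarrow> (\<exists>n::int. t = of_int n * T))"

text \<open>A lift of \<open>q\<close> to chart domains which is a submersion whose fibres are tangent to \<open>X\<close>.\<close>
definition submersive_lift :: "(('v::euclidean_space, 'a) chart \<Rightarrow> 'v \<Rightarrow> 'v) \<Rightarrow> ('a \<Rightarrow> 'b) \<Rightarrow>
    ('v, 'a) chart \<Rightarrow> ('w::euclidean_space, 'b) chart \<Rightarrow> 'v set \<Rightarrow> ('v \<Rightarrow> 'w) \<Rightarrow> bool" where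
  "submersive_lift X q c d W f \<longleftrightarrow> open W \<and> W \<subseteq> chart_dom c \<and> f ` W \<subseteq> chart_dom d \<and> smooth_on W f \<and>
     (\<forall>x\<in>W. chart_map d (f x) = q (chart_map c x) \<and> surj (frechet_derivative f (at x)) \<and>
        {v. frechet_derivative f (at x) v = 0} = span {X c x})"

text \<open>\<open>Z\<close> is the quotient orbifold of \<open>S\<close> by the orbits of \<open>\<rho>\<close>, with projection \<open>q\<close>. The last
  condition determines the orbifold structure of \<open>Z\<close>: charts of \<open>Z\<close> are locally transversals
  of \<open>X\<close> in charts of \<open>S\<close>.\<close>
definition leaf_quotient :: "('v::euclidean_space, 'a) orbifold_data \<Rightarrow> (('v, 'a) chart \<Rightarrow> 'v \<Rightarrow> 'v) \<Rightarrow>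
    (real \<Rightarrow> 'a \<Rightarrow> 'a) \<Rightarrow> ('w::euclidean_space, 'b) orbifold_data \<Rightarrow> ('a \<Rightarrow> 'b) \<Rightarrow> bool" where
  "leaf_quotient S X \<rho> Z q \<longleftrightarrow> orbifold Z \<and> quotient_map (orb_space S) (orb_space Z) q \<and>
     (\<forall>p\<in>topspace (orb_space S). \<forall>p'\<in>topspace (orb_space S). q p = q p' \<longleftrightarrow> (\<exists>t. p' = \<rho> t p)) \<and>
     (\<forall>c\<in>orb_atlas S. \<forall>d\<in>orb_atlas Z. \<forall>x\<in>chart_dom c. \<forall>y\<in>chart_dom d.
        q (chart_map c x) = chart_map d y \<longrightarrow> (\<exists>W f. submersive_lift X q c d W f \<and> x \<in> W \<and> f x = y))"

definition basic_form :: "('v::euclidean_space, 'a) orbifold_data \<Rightarrow> (('v, 'a) chart \<Rightarrow> 'v \<Rightarrow> 'v) \<Rightarrow>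
    nat \<Rightarrow> ('v, 'a) oform \<Rightarrow> bool" where
  "basic_form S X k \<beta> \<longleftrightarrow> orbifold_form S k \<beta> \<and>
     (\<forall>c\<in>orb_atlas S. \<forall>x\<in>chart_dom c. \<forall>vs.
        contraction (X c) (\<beta> c) x vs = 0 \<and> lie_derivative (X c) (\<beta> c) x vs = 0)"

text \<open>The form \<open>\<beta>\<close> on \<open>S\<close> descends to the form \<open>\<beta>'\<close> on \<open>Z\<close>: \<open>q\<^sup>* \<beta>' = \<beta>\<close>.
  On a quotient orbifold \<open>\<beta>'\<close> is determined by \<open>\<beta>\<close>, since lifts of \<open>q\<close> are submersions
  through every point of the chart domains of \<open>Z\<close>.\<close>
definition descends_to :: "('v::euclidean_space, 'a) orbifold_data \<Rightarrow> (('v, 'a) chart \<Rightarrow> 'v \<Rightarrow> 'v) \<Rightarrow>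
    ('w::euclidean_space, 'b) orbifold_data \<Rightarrow> ('a \<Rightarrow> 'b) \<Rightarrow> nat \<Rightarrow> ('v, 'a) oform \<Rightarrow> ('w, 'b) oform \<Rightarrow> bool" where
  "descends_to S X Z q k \<beta> \<beta>' \<longleftrightarrow> orbifold_form Z k \<beta>' \<and>
     (\<forall>c\<in>orb_atlas S. \<forall>d\<in>orb_atlas Z. \<forall>W f. submersive_lift X q c d W f \<longrightarrow>
        (\<forall>x\<in>W. pullback f (\<beta>' d) x = \<beta> c x))"


section \<open>SU(3)-structures on 6-dimensional orbifolds\<close>

text \<open>A \<open>(p + q)\<close>-form is of type \<open>(p, q)\<close> if it is homogeneous of bidegree \<open>(p, q)\<close> under
  multiplication of all its arguments by a complex scalar.\<close>
definition type_pq :: "('v::real_vector \<Rightarrow> 'v) \<Rightarrow> nat \<Rightarrow> nat \<Rightarrow> 'v mform \<Rightarrow> bool" where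
  "type_pq J p q \<beta> \<longleftrightarrow> (\<forall>z vs. length vs = p + q \<longrightarrow>
     \<beta> (map (\<lambda>v. Re z *\<^sub>R v + Im z *\<^sub>R J v) vs) = z ^ p * cnj z ^ q * \<beta> vs)"

text \<open>For \<open>k\<close>-forms in real dimension 6, \<open>k \<le> 3\<close>.\<close>
definition primitive :: "'v mform \<Rightarrow> nat \<Rightarrow> 'v mform \<Rightarrow> bool" where
  "primitive \<omega> k \<beta> \<longleftrightarrow> (\<forall>vs. (\<beta> \<and>\<^sub>f wedge_power \<omega> (4 - k)) vs = 0)"

definition su3_structure :: "(real^6, 'b) orbifold_data \<Rightarrow> ((real^6, 'b) chart \<Rightarrow> (real^6) metric) \<Rightarrow>
    ((real^6, 'b) chart \<Rightarrow> real^6 \<Rightarrow> real^6 \<Rightarrow> real^6) \<Rightarrow> (real^6, 'b) oform \<Rightarrow> (real^6, 'b) oform \<Rightarrow> bool" where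
  "su3_structure Z g J \<omega> \<Omega> \<longleftrightarrow>
     orbifold_metric Z g \<and> orbifold_almost_complex Z J \<and> orbifold_form Z 2 \<omega> \<and> orbifold_form Z 3 \<Omega> \<and>
     (\<forall>d\<in>orb_atlas Z. \<forall>x\<in>chart_dom d.
        real_form (\<omega> d x) \<and>
        (\<forall>u v. \<omega> d x [J d x u, J d x v] = \<omega> d x [u, v]) \<and>
        (\<forall>u v. of_real (g d x u v) = \<omega> d x [u, J d x v]) \<and>
        (\<exists>vs. \<Omega> d x vs \<noteq> 0) \<and> type_pq (J d x) 3 0 (\<Omega> d x) \<and>
        (\<forall>vs. (\<omega> d x \<and>\<^sub>f \<Omega> d x) vs = 0) \<and>
        (\<forall>vs. (\<Omega> d x \<and>\<^sub>f cnj_form (\<Omega> d x)) vs = - 8 * \<i> * (wedge_power (\<omega> d x) 3 vs / fact 3)))"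

definition defines_su3_structure :: "(real^6, 'b) orbifold_data \<Rightarrow>
    (real^6, 'b) oform \<Rightarrow> (real^6, 'b) oform \<Rightarrow> bool" where
  "defines_su3_structure Z \<omega> \<Omega> \<longleftrightarrow> (\<exists>g J. su3_structure Z g J \<omega> \<Omega>)"

definition torsion_classes :: "(real^6, 'b) orbifold_data \<Rightarrow>
    ((real^6, 'b) chart \<Rightarrow> real^6 \<Rightarrow> real^6 \<Rightarrow> real^6) \<Rightarrow> (real^6, 'b) oform \<Rightarrow> (real^6, 'b) oform \<Rightarrow>
    ((real^6, 'b) chart \<Rightarrow> real^6 \<Rightarrow> complex) \<Rightarrow> (real^6, 'b) oform \<Rightarrow> (real^6, 'b) oform \<Rightarrow>
    (real^6, 'b) oform \<Rightarrow> (real^6, 'b) oform \<Rightarrow> bool" where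
  "torsion_classes Z J \<omega> \<Omega> W1 W2 W3 W4 W5 \<longleftrightarrow>
     orbifold_function Z W1 \<and> orbifold_form Z 2 W2 \<and> orbifold_form Z 3 W3 \<and>
     orbifold_form Z 1 W4 \<and> orbifold_form Z 1 W5 \<and>
     (\<forall>d\<in>orb_atlas Z. \<forall>x\<in>chart_dom d.
        type_pq (J d x) 1 1 (W2 d x) \<and> primitive (\<omega> d x) 2 (W2 d x) \<and>
        real_form (W3 d x) \<and> primitive (\<omega> d x) 3 (W3 d x) \<and>
        (\<exists>\<sigma> \<tau>. alternating_form 3 \<sigma> \<and> type_pq (J d x) 2 1 \<sigma> \<and>
               alternating_form 3 \<tau> \<and> type_pq (J d x) 1 2 \<tau> \<and> (\<forall>vs. W3 d x vs = \<sigma> vs + \<tau> vs)) \<and>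
        real_form (W4 d x) \<and> type_pq (J d x) 1 0 (W5 d x) \<and>
        (\<forall>vs. ext_d (\<omega> d) x vs =
           of_real (3 / 2 * Im (cnj (W1 d x) * \<Omega> d x vs)) + (W4 d x \<and>\<^sub>f \<omega> d x) vs + W3 d x vs) \<and>
        (\<forall>vs. ext_d (\<Omega> d) x vs =
           W1 d x * wedge_power (\<omega> d x) 2 vs + (W2 d x \<and>\<^sub>f \<omega> d x) vs +
           (cnj_form (W5 d x) \<and>\<^sub>f \<Omega> d x) vs))"

definition zero_form :: "('v, 'a) oform" where
  "zero_form = (\<lambda>_ _ _. 0)"

definition LT_structure :: "(real^6, 'b) orbifold_data \<Rightarrow>
    ((real^6, 'b) chart \<Rightarrow> real^6 \<Rightarrow> real^6 \<Rightarrow> real^6) \<Rightarrow> (real^6, 'b) oform \<Rightarrow> (real^6, 'b) oform \<Rightarrow> bool" where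
  "LT_structure Z J \<omega> \<Omega> \<longleftrightarrow> (\<exists>W1 W2.
     torsion_classes Z J \<omega> \<Omega> W1 W2 zero_form zero_form zero_form \<and>
     (\<exists>d\<in>orb_atlas Z. \<exists>x\<in>chart_dom d. W1 d x \<noteq> 0) \<and>
     (\<exists>d\<in>orb_atlas Z. \<exists>x\<in>chart_dom d. \<exists>vs. W2 d x vs \<noteq> 0))"


section \<open>The invariant forms of a 3-Sasakian orbifold\<close>

definition alpha_i :: "(nat \<Rightarrow> ('v::euclidean_space, 'a) oform) \<Rightarrow> nat \<Rightarrow> ('v, 'a) oform" where
  "alpha_i \<eta> i c x vs = (ext_d (\<eta> i c) x vs -
     (\<Sum>j\<in>{1..3}. \<Sum>k\<in>{1..3}. of_real (eps i j k) * (\<eta> j c x \<and>\<^sub>f \<eta> k c x) vs)) / 2"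

definition alpha :: "(nat \<Rightarrow> ('v::euclidean_space, 'a) oform) \<Rightarrow> ('v, 'a) oform" where
  "alpha \<eta> c x vs = alpha_i \<eta> 1 c x vs + \<i> * alpha_i \<eta> 2 c x vs"

definition eta_c :: "(nat \<Rightarrow> ('v, 'a) oform) \<Rightarrow> ('v, 'a) oform" where
  "eta_c \<eta> c x vs = \<eta> 1 c x vs + \<i> * \<eta> 2 c x vs"

definition eta_eta_bar :: "(nat \<Rightarrow> ('v, 'a) oform) \<Rightarrow> ('v, 'a) oform" where
  "eta_eta_bar \<eta> c x = eta_c \<eta> c x \<and>\<^sub>f cnj_form (eta_c \<eta> c x)"

text \<open>For \<open>a = 2 b\<^sup>2\<close> the structure given by \<open>omega_ab\<close> is nearly Kaehler: its class \<open>W\<^sub>2\<close> vanishes,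
  so that it is not LT in the sense of \<open>LT_structure\<close>.\<close>
definition omega_ab :: "(nat \<Rightarrow> ('v::euclidean_space, 'a) oform) \<Rightarrow> real \<Rightarrow> real \<Rightarrow> ('v, 'a) oform" where
  "omega_ab \<eta> a b c x vs = of_real a * alpha_i \<eta> 3 c x vs - \<i> / 2 * of_real (b\<^sup>2) * eta_eta_bar \<eta> c x vs"

definition Omega_c :: "(nat \<Rightarrow> ('v::euclidean_space, 'a) oform) \<Rightarrow> complex \<Rightarrow> ('v, 'a) oform" where
  "Omega_c \<eta> k c x vs = k * (alpha \<eta> c x \<and>\<^sub>f cnj_form (eta_c \<eta> c x)) vs"

end

theory Submission
  imports Defs
begin

text \<open>
  The endomorphisms \<open>A\<^sub>i u = (J\<^sub>i u)\<^sup>T\<close> of the tangent spaces of \<open>S\<close> satisfy \<open>d\<eta>\<^sub>i(u, v) = 2 g(A\<^sub>i u, v)\<close>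
  and the quaternion relations on the horizontal space \<open>\<eta>\<^sub>1 = \<eta>\<^sub>2 = \<eta>\<^sub>3 = 0\<close>. For a horizontal unit vector
  \<open>e\<close> the frame \<open>e, A\<^sub>1 e, A\<^sub>2 e, A\<^sub>3 e, \<xi>\<^sub>1, \<xi>\<^sub>2, \<xi>\<^sub>3\<close> is orthonormal, and in the dual coframe, written with
  three complex covectors \<open>z\<^sub>0, z\<^sub>1, z\<^sub>2\<close> that vanish on \<open>\<xi>\<^sub>3\<close>, one has \<open>\<alpha> = z\<^sub>0 \<and> z\<^sub>1\<close>,
  \<open>\<alpha>\<^sub>3 = (\<i>/2) (z\<^sub>0 \<and> cnj z\<^sub>0 + z\<^sub>1 \<and> cnj z\<^sub>1)\<close> and \<open>z\<^sub>2 = cnj \<eta>\<close>. The three covectors descend to \<open>Z\<close>, where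
  \<open>\<omega> = (\<i>/2) (a z\<^sub>0 \<and> cnj z\<^sub>0 + a z\<^sub>1 \<and> cnj z\<^sub>1 + b\<^sup>2 z\<^sub>2 \<and> cnj z\<^sub>2)\<close> and \<open>\<Omega> = c z\<^sub>0 \<and> z\<^sub>1 \<and> z\<^sub>2\<close>.
  The type of \<open>\<Omega>\<close> forces the almost complex structure to be multiplication by \<open>\<i>\<close>, so that positivity and
  the volume identity become conditions on \<open>a, b, c\<close>. The torsion is read off from
  \<open>d\<omega> = 2 (a + b\<^sup>2) Im (\<alpha> \<and> cnj \<eta>)\<close> and \<open>d\<Omega> = c (2 \<alpha> \<and> cnj \<alpha> - 2\<i> \<alpha>\<^sub>3 \<and> \<eta> \<and> cnj \<eta>)\<close>, which
  follow from \<open>d\<alpha>\<^sub>1 = - 2 \<alpha>\<^sub>2 \<and> \<eta>\<^sub>3 + 2 \<alpha>\<^sub>3 \<and> \<eta>\<^sub>2\<close> and its cyclic permutations; exterior derivatives commute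
  with the pullback along the quotient map because second derivatives are symmetric.
\<close>

section \<open>Smooth functions and the symmetry of second derivatives\<close>

text \<open>The coframe is chosen separately at every point, from an arbitrary unit vector
  \<open>e\<close>, and need not depend smoothly on the point. It is therefore never differentiated:
  exterior derivatives are computed from the smooth forms \<open>\<eta> i\<close>, and only their
  values at a point are expressed in the coframe. For the same reason an almost complex structure on
  the quotient is not built from coframes. It is characterised by \<Omega> alone; uniqueness then
  gives invariance under transitions, and linear algebra gives smoothness. The constants in the
  torsion come from two coefficients. With \<open>\<theta> = \<eta> \<and> cnj \<eta>\<close> one
  has \<open>\<theta> \<and> \<theta> = 0\<close> and \<open>\<alpha> \<and> cnj \<alpha> = 2
  \<alpha>\<^sub>3 \<and> \<alpha>\<^sub>3\<close>, so \<open>d\<Omega>\<close>,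
  \<open>\<omega> \<and> \<omega>\<close> and \<open>W2 \<and> \<omega>\<close> are combinations of
  \<open>\<alpha>\<^sub>3 \<and> \<alpha>\<^sub>3\<close> and
  \<open>\<alpha>\<^sub>3 \<and> \<theta>\<close>. Primitivity fixes the multiple of \<theta> in
  \<open>W2\<close>; comparing the two coefficients of \<open>d\<Omega>\<close> then determines
  \<open>W1\<close> and the factor of \<open>W2\<close>. Identities for wedge and \<open>d\<close>
  are proved by induction on the list of arguments, by contraction with its first vector.\<close>

abbreviation dd :: "('v::real_normed_vector \<Rightarrow> 'w::real_normed_vector) \<Rightarrow> 'v \<Rightarrow> 'v \<Rightarrow> 'w" where
  "dd f x v \<equiv> frechet_derivative f (at x) v"

lemma dd_eqI: "(f has_derivative f') (at x) \<Longrightarrow> dd f x v = f' v"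
  by (metis frechet_derivative_at)

lemma has_derivative_dd: "f differentiable (at x) \<Longrightarrow> (f has_derivative dd f x) (at x)"
  using frechet_derivative_works by blast

lemma frechet_derivative_cong_open:
  assumes "open U" "x \<in> U" "\<And>y. y \<in> U \<Longrightarrow> f y = g y"
  shows "frechet_derivative f (at x) = frechet_derivative g (at x)"
proof -
  have "(f has_derivative f') (at x) \<longleftrightarrow> (g has_derivative f') (at x)" for f'
    using assms by (metis has_derivative_transform_within_open)
  then show ?thesis unfolding frechet_derivative_def by simp
qed

lemma differentiable_cong_open:
  assumes "open U" "x \<in> U" "\<And>y. y \<in> U \<Longrightarrow> f y = g y" "f differentiable (at x)"
  shows "g differentiable (at x)"
  using assms unfolding differentiable_def
  by (meson has_derivative_transform_within_open)

text \<open>Derivatives at a point of an open set see only nearby values, so agreement on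
  \<open>U\<close> passes to all directional derivatives.\<close>

lemma Ck_on_cong:
  assumes "open U"
  shows "(\<And>y. y \<in> U \<Longrightarrow> f y = g y) \<Longrightarrow> Ck_on k U f \<Longrightarrow> Ck_on k U g"
proof (induction k arbitrary: f g)
  case 0
  then show ?case using continuous_on_cong[of U U f g] by simp
next
  case (Suc k)
  have d: "g differentiable (at x)" if "x \<in> U" for x
    using Suc.prems differentiable_cong_open[OF assms that, of f g] that by auto
  have "Ck_on k U (\<lambda>x. dd g x v)" for v
  proof (rule Suc.IH[of "\<lambda>x. dd f x v"])
    show "dd f y v = dd g y v" if "y \<in> U" for y
      using frechet_derivative_cong_open[OF assms that, of f g] Suc.prems(1) by auto
    show "Ck_on k U (\<lambda>x. dd f x v)" using Suc.prems(2) by auto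
  qed
  with d show ?case by auto
qed

lemma smooth_on_cong:
  assumes "open U" "\<And>y. y \<in> U \<Longrightarrow> f y = g y" "smooth_on U f" shows "smooth_on U g"
  using Ck_on_cong[of U f g] assms by (auto simp: smooth_on_def)

lemma Ck_on_SucD: "Ck_on (Suc k) U f \<Longrightarrow> Ck_on k U f"
proof (induction k arbitrary: f)
  case 0
  then show ?case unfolding Ck_on.simps
    by (intro continuous_at_imp_continuous_on ballI differentiable_imp_continuous_within) simp
next
  case (Suc k)
  then show ?case by (metis Ck_on.simps(2))
qed

lemma smooth_on_differentiable: "smooth_on U f \<Longrightarrow> x \<in> U \<Longrightarrow> f differentiable (at x)"
  by (metis Ck_on.simps(2) smooth_on_def)

lemma smooth_on_frechet: "smooth_on U f \<Longrightarrow> smooth_on U (\<lambda>x. dd f x v)"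
  by (metis Ck_on.simps(2) smooth_on_def)

lemma smooth_on_continuous: "smooth_on U f \<Longrightarrow> continuous_on U f"
  by (metis Ck_on.simps(1) smooth_on_def)

lemma Ck_on_const: "Ck_on k U (\<lambda>x. c)"
  by (induction k arbitrary: c) (auto simp: frechet_derivative_const)

lemma smooth_on_const [intro]: "smooth_on U (\<lambda>x. c)"
  by (simp add: smooth_on_def Ck_on_const)

lemma Ck_on_bounded_linear:
  assumes "bounded_linear h" "open U" 
  shows "Ck_on k U f \<Longrightarrow> Ck_on k U (\<lambda>x. h (f x))"
proof (induction k arbitrary: f)
  case 0
  then show ?case using assms by (auto intro: bounded_linear.continuous_on)
next
  case (Suc k)
  have D: "((\<lambda>x. h (f x)) has_derivative (\<lambda>v. h (dd f x v))) (at x)" if "x \<in> U" for x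
    using Suc.prems that by (intro bounded_linear.has_derivative[OF assms(1)] has_derivative_dd) simp
  have "Ck_on k U (\<lambda>x. dd (\<lambda>x. h (f x)) x v)" for v
    by (rule Ck_on_cong[OF assms(2) _ Suc.IH[of "\<lambda>x. dd f x v"]])
      (use Suc.prems dd_eqI[OF D] in auto)
  moreover have "\<forall>x\<in>U. (\<lambda>x. h (f x)) differentiable (at x)"
    using D by (meson differentiable_def)
  ultimately show ?case by simp
qed

lemma Ck_on_add:
  assumes "open U" 
  shows "Ck_on k U f \<Longrightarrow> Ck_on k U g \<Longrightarrow> Ck_on k U (\<lambda>x. f x + g x)"
proof (induction k arbitrary: f g)
  case 0
  then show ?case by (auto intro: continuous_intros)
next
  case (Suc k)
  have D: "((\<lambda>x. f x + g x) has_derivative (\<lambda>v. dd f x v + dd g x v)) (at x)" if "x \<in> U" for x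
    using Suc.prems that by (intro has_derivative_add has_derivative_dd) simp_all
  have "Ck_on k U (\<lambda>x. dd (\<lambda>x. f x + g x) x v)" for v
    by (rule Ck_on_cong[OF assms _ Suc.IH[of "\<lambda>x. dd f x v" "\<lambda>x. dd g x v"]])
      (use Suc.prems dd_eqI[OF D] in auto)
  moreover have "\<forall>x\<in>U. (\<lambda>x. f x + g x) differentiable (at x)"
    using D by (meson differentiable_def)
  ultimately show ?case by simp
qed

text \<open>By the Leibniz rule the derivative is a sum of two products with one factor
  differentiated; the other factor is also of class \<open>k\<close>, so the induction hypothesis
  covers both.\<close>

lemma Ck_on_bilinear:
  assumes "bounded_bilinear p" "open U" 
  shows "Ck_on k U f \<Longrightarrow> Ck_on k U g \<Longrightarrow> Ck_on k U (\<lambda>x. p (f x) (g x))"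
proof (induction k arbitrary: f g)
  case 0
  then show ?case using assms by (auto intro: bounded_bilinear.continuous_on)
next
  case (Suc k)
  have D: "((\<lambda>x. p (f x) (g x)) has_derivative (\<lambda>v. p (f x) (dd g x v) + p (dd f x v) (g x))) (at x)"
    if "x \<in> U" for x
    using Suc.prems that by (intro bounded_bilinear.FDERIV[OF assms(1)] has_derivative_dd) simp_all
  have "Ck_on k U (\<lambda>x. dd (\<lambda>x. p (f x) (g x)) x v)" for v
  proof (rule Ck_on_cong[OF assms(2)])
    show "p (f y) (dd g y v) + p (dd f y v) (g y) = dd (\<lambda>x. p (f x) (g x)) y v" if "y \<in> U" for y
      using dd_eqI[OF D[OF that]] by simp
    show "Ck_on k U (\<lambda>x. p (f x) (dd g x v) + p (dd f x v) (g x))"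
      using Suc.prems by (intro Ck_on_add[OF assms(2)] Suc.IH Ck_on_SucD[OF Suc.prems(1)] Ck_on_SucD[OF Suc.prems(2)]) simp_all
  qed
  moreover have "\<forall>x\<in>U. (\<lambda>x. p (f x) (g x)) differentiable (at x)"
    using D by (meson differentiable_def)
  ultimately show ?case by simp
qed

text \<open>The derivative of \<open>inverse f\<close> is a product of \<open>inverse f\<close>
  twice and the derivative of \<open>f\<close>, so the induction hypothesis for the same
  \<open>f\<close> and the product rule suffice.\<close>

lemma Ck_on_inverse:
  fixes f :: "'v::euclidean_space \<Rightarrow> real"
  assumes "open U" "\<And>x. x \<in> U \<Longrightarrow> f x \<noteq> 0" 
  shows "Ck_on k U f \<Longrightarrow> Ck_on k U (\<lambda>x. inverse (f x))"
proof (induction k)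
  case 0
  then show ?case using assms by (auto intro: continuous_intros)
next
  case (Suc k)
  have D: "((\<lambda>x. inverse (f x)) has_derivative (\<lambda>v. - (inverse (f x) * dd f x v * inverse (f x)))) (at x)"
    if "x \<in> U" for x
    using Suc.prems that by (intro Deriv.has_derivative_inverse assms(2) has_derivative_dd) simp_all
  note mult = Ck_on_bilinear[OF bounded_bilinear_mult assms(1)]
  have "Ck_on k U (\<lambda>x. dd (\<lambda>x. inverse (f x)) x v)" for v
  proof (rule Ck_on_cong[OF assms(1)])
    \<comment> \<open>The sign is written as multiplication by a constant, so that the rule for
      products covers the whole expression.\<close>
    show "- 1 * (inverse (f y) * dd f y v * inverse (f y)) = dd (\<lambda>x. inverse (f x)) y v" if "y \<in> U" for y
      using dd_eqI[OF D[OF that]] by simp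
    have "Ck_on k U (\<lambda>x. inverse (f x))" "Ck_on k U (\<lambda>x. dd f x v)"
      using Suc.IH Ck_on_SucD[OF Suc.prems] Suc.prems by auto
    then show "Ck_on k U (\<lambda>x. - 1 * (inverse (f x) * dd f x v * inverse (f x)))"
      by (intro mult Ck_on_const)
  qed
  moreover have "\<forall>x\<in>U. (\<lambda>x. inverse (f x)) differentiable (at x)"
    using D by (meson differentiable_def)
  ultimately show ?case by simp
qed

lemma smooth_on_bounded_linear:
  "open U \<Longrightarrow> bounded_linear h \<Longrightarrow> smooth_on U f \<Longrightarrow> smooth_on U (\<lambda>x. h (f x))"
  by (auto simp: smooth_on_def intro: Ck_on_bounded_linear)

lemma smooth_on_add: "open U \<Longrightarrow> smooth_on U f \<Longrightarrow> smooth_on U g \<Longrightarrow> smooth_on U (\<lambda>x. f x + g x)"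
  by (auto simp: smooth_on_def intro: Ck_on_add)

lemma smooth_on_bilinear:
  "open U \<Longrightarrow> bounded_bilinear p \<Longrightarrow> smooth_on U f \<Longrightarrow> smooth_on U g \<Longrightarrow> smooth_on U (\<lambda>x. p (f x) (g x))"
  by (auto simp: smooth_on_def intro: Ck_on_bilinear)

lemma smooth_on_mult:
  fixes f g :: "'v::euclidean_space \<Rightarrow> 'a::real_normed_algebra"
  shows "open U \<Longrightarrow> smooth_on U f \<Longrightarrow> smooth_on U g \<Longrightarrow> smooth_on U (\<lambda>x. f x * g x)"
  by (rule smooth_on_bilinear[OF _ bounded_bilinear_mult])

lemma smooth_on_scaleR:
  "open U \<Longrightarrow> smooth_on U f \<Longrightarrow> smooth_on U g \<Longrightarrow> smooth_on U (\<lambda>x. f x *\<^sub>R g x)"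
  by (rule smooth_on_bilinear[OF _ bounded_bilinear_scaleR])

lemma smooth_on_minus: "open U \<Longrightarrow> smooth_on U f \<Longrightarrow> smooth_on U (\<lambda>x. - f x)"
  by (rule smooth_on_bounded_linear[OF _ bounded_linear_minus[OF bounded_linear_ident]])

lemma smooth_on_diff: "open U \<Longrightarrow> smooth_on U f \<Longrightarrow> smooth_on U g \<Longrightarrow> smooth_on U (\<lambda>x. f x - g x)"
  using smooth_on_add[of U f "\<lambda>x. - g x"] smooth_on_minus[of U g] by simp

lemma smooth_on_sum:
  assumes "open U" "\<And>i. i \<in> I \<Longrightarrow> smooth_on U (f i)"
  shows "smooth_on U (\<lambda>x. \<Sum>i\<in>I. f i x)"
  using assms(2) by (induction I rule: infinite_finite_induct) (auto intro: smooth_on_add[OF assms(1)])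

lemma smooth_on_prod:
  fixes f :: "'i \<Rightarrow> 'v::euclidean_space \<Rightarrow> real"
  assumes "open U" "\<And>i. i \<in> I \<Longrightarrow> smooth_on U (f i)"
  shows "smooth_on U (\<lambda>x. \<Prod>i\<in>I. f i x)"
  using assms(2) by (induction I rule: infinite_finite_induct) (auto intro: smooth_on_mult[OF assms(1)])

lemma smooth_on_inverse:
  fixes f :: "'v::euclidean_space \<Rightarrow> real"
  shows "open U \<Longrightarrow> (\<And>x. x \<in> U \<Longrightarrow> f x \<noteq> 0) \<Longrightarrow> smooth_on U f \<Longrightarrow> smooth_on U (\<lambda>x. inverse (f x))"
  by (auto simp: smooth_on_def intro: Ck_on_inverse)

text \<open>The mixed second difference is the increment of \<open>\<phi>\<close>, which is itself
  an increment in direction \<open>v\<close>. The mean value theorem is applied to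
  \<open>\<phi>\<close> in direction \<open>u\<close>, and then in direction \<open>v\<close> to the
  derivative of \<open>f\<close> along \<open>u\<close>.\<close>

lemma second_difference_mean_value:
  fixes f :: "'v::euclidean_space \<Rightarrow> real"
  assumes sub: "ball x e \<subseteq> U" and h: "0 < h" "h * (norm u + norm v) < e"
    and df: "\<And>y. y \<in> U \<Longrightarrow> f differentiable (at y)"
    and ddf: "\<And>y. y \<in> U \<Longrightarrow> (\<lambda>y. dd f y u) differentiable (at y)"
  obtains p where "dist x p \<le> h * (norm u + norm v)"
    "f (x + h *\<^sub>R u + h *\<^sub>R v) - f (x + h *\<^sub>R u) - f (x + h *\<^sub>R v) + f x = h\<^sup>2 * dd (\<lambda>y. dd f y u) p v"
proof -
  have dst: "dist x (x + s *\<^sub>R u + t *\<^sub>R v) \<le> h * (norm u + norm v)" if "0 \<le> s" "s \<le> h" "0 \<le> t" "t \<le> h" for s t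
  proof -
    have "dist x (x + s *\<^sub>R u + t *\<^sub>R v) = norm (s *\<^sub>R u + t *\<^sub>R v)"
      by (simp add: dist_norm norm_minus_commute algebra_simps)
    also have "\<dots> \<le> s * norm u + t * norm v"
      using norm_triangle_ineq[of "s *\<^sub>R u" "t *\<^sub>R v"] that by simp
    also have "\<dots> \<le> h * norm u + h * norm v"
      using that by (intro add_mono mult_right_mono) auto
    finally show ?thesis by (simp add: algebra_simps)
  qed
  have inU: "x + s *\<^sub>R u + t *\<^sub>R v \<in> U" if "0 \<le> s" "s \<le> h" "0 \<le> t" "t \<le> h" for s t
    using dst[OF that] h sub by (auto simp: subset_iff)
  define \<phi> where "\<phi> s = f (x + s *\<^sub>R u + h *\<^sub>R v) - f (x + s *\<^sub>R u)" for s
  have d1: "((\<lambda>s. f (x + s *\<^sub>R u + t *\<^sub>R v)) has_real_derivative dd f (x + s *\<^sub>R u + t *\<^sub>R v) u) (at s)"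
    if "0 \<le> s" "s \<le> h" "0 \<le> t" "t \<le> h" for s t
  proof -
    have "(f has_derivative (dd f (x + s *\<^sub>R u + t *\<^sub>R v))) (at (x + s *\<^sub>R u + t *\<^sub>R v))"
      using df[OF inU[OF that]] frechet_derivative_works by blast
    moreover have "((\<lambda>s. x + s *\<^sub>R u + t *\<^sub>R v) has_derivative (\<lambda>r. r *\<^sub>R u)) (at s)"
      by (auto intro!: derivative_eq_intros)
    ultimately have "((\<lambda>s. f (x + s *\<^sub>R u + t *\<^sub>R v)) has_derivative (\<lambda>r. dd f (x + s *\<^sub>R u + t *\<^sub>R v) (r *\<^sub>R u))) (at s)"
      by (rule has_derivative_compose[rotated])
    moreover have "dd f (x + s *\<^sub>R u + t *\<^sub>R v) (r *\<^sub>R u) = dd f (x + s *\<^sub>R u + t *\<^sub>R v) u * r" for r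
      using linear_frechet_derivative[OF df[OF inU[OF that]]] by (simp add: linear_cmul)
    ultimately show ?thesis by (simp add: has_field_derivative_def)
  qed
  have "\<exists>z. 0 < z \<and> z < h \<and> \<phi> h - \<phi> 0 = (h - 0) * (dd f (x + z *\<^sub>R u + h *\<^sub>R v) u - dd f (x + z *\<^sub>R u) u)"
    unfolding \<phi>_def
    by (rule MVT2[OF h(1)], rule DERIV_diff) (use d1[of _ h] d1[of _ 0] h(1) in auto)
  then obtain s where s: "0 < s" "s < h" 
    and e1: "\<phi> h - \<phi> 0 = h * (dd f (x + s *\<^sub>R u + h *\<^sub>R v) u - dd f (x + s *\<^sub>R u) u)" by auto
  have d2: "((\<lambda>t. dd f (x + s *\<^sub>R u + t *\<^sub>R v) u) has_real_derivative dd (\<lambda>y. dd f y u) (x + s *\<^sub>R u + t *\<^sub>R v) v) (at t)"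
    if "0 \<le> t" "t \<le> h" for t
  proof -
    have st: "0 \<le> s" "s \<le> h" using s by auto
    have "((\<lambda>y. dd f y u) has_derivative (dd (\<lambda>y. dd f y u) (x + s *\<^sub>R u + t *\<^sub>R v))) (at (x + s *\<^sub>R u + t *\<^sub>R v))"
      using ddf[OF inU[OF st that]] frechet_derivative_works by blast
    moreover have "((\<lambda>t. x + s *\<^sub>R u + t *\<^sub>R v) has_derivative (\<lambda>r. r *\<^sub>R v)) (at t)"
      by (auto intro!: derivative_eq_intros)
    ultimately have "((\<lambda>t. dd f (x + s *\<^sub>R u + t *\<^sub>R v) u) has_derivative (\<lambda>r. dd (\<lambda>y. dd f y u) (x + s *\<^sub>R u + t *\<^sub>R v) (r *\<^sub>R v))) (at t)"
      by (rule has_derivative_compose[rotated])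
    moreover have "dd (\<lambda>y. dd f y u) (x + s *\<^sub>R u + t *\<^sub>R v) (r *\<^sub>R v) = dd (\<lambda>y. dd f y u) (x + s *\<^sub>R u + t *\<^sub>R v) v * r" for r
      using linear_frechet_derivative[OF ddf[OF inU[OF st that]]] by (simp add: linear_cmul)
    ultimately show ?thesis by (simp add: has_field_derivative_def)
  qed
  have "\<exists>z. 0 < z \<and> z < h \<and> dd f (x + s *\<^sub>R u + h *\<^sub>R v) u - dd f (x + s *\<^sub>R u + 0 *\<^sub>R v) u
      = (h - 0) * dd (\<lambda>y. dd f y u) (x + s *\<^sub>R u + z *\<^sub>R v) v"
    by (rule MVT2[OF h(1)]) (use d2 in auto)
  then obtain t where t: "0 < t" "t < h" 
    and e2: "dd f (x + s *\<^sub>R u + h *\<^sub>R v) u - dd f (x + s *\<^sub>R u) u = h * dd (\<lambda>y. dd f y u) (x + s *\<^sub>R u + t *\<^sub>R v) v"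
    by auto
  show ?thesis
    by (rule that[of "x + s *\<^sub>R u + t *\<^sub>R v"])
      (use dst s t e1 e2 in \<open>auto simp: \<phi>_def power2_eq_square\<close>)
qed

text \<open>The second difference is symmetric in \<open>u\<close> and \<open>v\<close>, so it
  equals both mixed derivatives, taken at two points close to \<open>x\<close>; continuity carries
  the equality over to \<open>x\<close>.\<close>

lemma second_derivative_symmetric_real:
  fixes f :: "'v::euclidean_space \<Rightarrow> real"
  assumes "open U" "x \<in> U" "smooth_on U f"
  shows "dd (\<lambda>y. dd f y u) x v = dd (\<lambda>y. dd f y v) x u"
proof (rule ccontr)
  define F where "F y = dd (\<lambda>y. dd f y u) y v" for y
  define G where "G y = dd (\<lambda>y. dd f y v) y u" for y
  assume ne: "\<not> ?thesis"
  define \<epsilon> where "\<epsilon> = dist (F x) (G x) / 2"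
  have \<epsilon>: "\<epsilon> > 0" using ne by (simp add: \<epsilon>_def F_def G_def)
  have "continuous_on U F" "continuous_on U G"
    unfolding F_def G_def by (intro smooth_on_continuous smooth_on_frechet assms)+
  then have "isCont F x" "isCont G x"
    using assms(1,2) by (auto simp: continuous_on_eq_continuous_at)
  then obtain d1 d2 where d1: "d1 > 0" "\<And>y. dist y x < d1 \<Longrightarrow> dist (F y) (F x) < \<epsilon>"
    and d2: "d2 > 0" "\<And>y. dist y x < d2 \<Longrightarrow> dist (G y) (G x) < \<epsilon>"
    using \<epsilon> unfolding continuous_at_eps_delta by blast
  obtain e where e: "e > 0" "ball x e \<subseteq> U"
    using assms(1,2) openE by blast
  define m where "m = min e (min d1 d2)"
  \<comment> \<open>All points of evaluation then lie within \<open>m / 2\<close> of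
    \<open>x\<close>; the summand 1 keeps the denominator positive for
    \<open>u = v = 0\<close>.\<close>
  define h where "h = m / (2 * (norm u + norm v + 1))"
  have m: "m > 0" using d1 d2 e by (simp add: m_def)
  have h: "h > 0" using m by (simp add: h_def add_nonneg_pos)
  have "h * (norm u + norm v) \<le> h * (norm u + norm v + 1)" using h by simp
  also have "\<dots> = m / 2"
  proof -
    have "n > 0 \<Longrightarrow> m / (2 * n) * n = m / 2" for n :: real by simp
    then show ?thesis unfolding h_def by (meson add_nonneg_pos add_nonneg_nonneg norm_ge_zero zero_less_one)
  qed
  also have "\<dots> < m" using m by simp
  finally have hm: "h * (norm u + norm v) < m" .
  have he: "h * (norm u + norm v) < e" "h * (norm v + norm u) < e" using hm by (auto simp: m_def add.commute)
  note sm = smooth_on_differentiable[OF assms(3)] smooth_on_differentiable[OF smooth_on_frechet[OF assms(3)]]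
  obtain p where p: "dist x p \<le> h * (norm u + norm v)"
    "f (x + h *\<^sub>R u + h *\<^sub>R v) - f (x + h *\<^sub>R u) - f (x + h *\<^sub>R v) + f x = h\<^sup>2 * F p"
    unfolding F_def using second_difference_mean_value[OF e(2) h he(1) sm] by blast
  obtain q where q: "dist x q \<le> h * (norm v + norm u)"
    "f (x + h *\<^sub>R v + h *\<^sub>R u) - f (x + h *\<^sub>R v) - f (x + h *\<^sub>R u) + f x = h\<^sup>2 * G q"
    unfolding G_def using second_difference_mean_value[OF e(2) h he(2) sm] by blast
  have "h\<^sup>2 * F p = h\<^sup>2 * G q" using p(2) q(2) by (simp add: algebra_simps)
  then have "F p = G q" using h by simp
  moreover have "dist (F p) (F x) < \<epsilon>" using p(1) hm by (intro d1(2)) (simp add: m_def dist_commute)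
  moreover have "dist (G q) (G x) < \<epsilon>" using q(1) hm by (intro d2(2)) (simp add: m_def dist_commute add.commute)
  ultimately have "dist (F x) (G x) < 2 * \<epsilon>"
    using dist_triangle_half_r[of "F p" "F x" "2 * \<epsilon>" "G x"] by simp
  then show False by (simp add: \<epsilon>_def)
qed

lemma dd_bounded_linear:
  assumes "bounded_linear h" "f differentiable (at x)"
  shows "dd (\<lambda>y. h (f y)) x v = h (dd f x v)"
  by (rule dd_eqI) (intro bounded_linear.has_derivative[OF assms(1)] has_derivative_dd assms(2))

lemma second_derivative_symmetric:
  fixes f :: "'v::euclidean_space \<Rightarrow> 'w::euclidean_space"
  assumes "open U" "x \<in> U" "smooth_on U f"
  shows "dd (\<lambda>y. dd f y u) x v = dd (\<lambda>y. dd f y v) x u"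
proof (rule euclidean_eqI)
  fix b :: 'w assume "b \<in> Basis"
  note bl = bounded_linear_inner_left[of b]
  have "dd (\<lambda>y. dd f y u) x v \<bullet> b = dd (\<lambda>y. dd (\<lambda>z. f z \<bullet> b) y u) x v" for u v
  proof -
    have "dd (\<lambda>y. dd f y u) x v \<bullet> b = dd (\<lambda>y. dd f y u \<bullet> b) x v"
      by (intro dd_bounded_linear[OF bl, symmetric] smooth_on_differentiable[OF smooth_on_frechet[OF assms(3)] assms(2)])
    also have "frechet_derivative (\<lambda>y. dd f y u \<bullet> b) (at x) = frechet_derivative (\<lambda>y. dd (\<lambda>z. f z \<bullet> b) y u) (at x)"
      by (intro frechet_derivative_cong_open[OF assms(1,2)] dd_bounded_linear[OF bl, symmetric]
          smooth_on_differentiable[OF assms(3)])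
    finally show ?thesis .
  qed
  then show "dd (\<lambda>y. dd f y u) x v \<bullet> b = dd (\<lambda>y. dd f y v) x u \<bullet> b"
    using second_derivative_symmetric_real[OF assms(1,2) smooth_on_bounded_linear[OF assms(1) bl assms(3)]] by simp
qed

section \<open>The exterior algebra\<close>

definition form_add :: "'v mform \<Rightarrow> 'v mform \<Rightarrow> 'v mform" (infixl \<open>+\<^sub>f\<close> 65) where
  "(\<alpha> +\<^sub>f \<beta>) vs = \<alpha> vs + \<beta> vs"

definition form_scale :: "complex \<Rightarrow> 'v mform \<Rightarrow> 'v mform" (infixr \<open>*\<^sub>f\<close> 75) where
  "(k *\<^sub>f \<alpha>) vs = k * \<alpha> vs"

definition form_zero :: "'v mform" (\<open>0\<^sub>f\<close>) where
  "0\<^sub>f vs = 0"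

text \<open>The interior product with a constant vector. Together with \<open>grading\<close> it
  turns the recursion for the wedge into the antiderivation rule.\<close>

definition insertion :: "'v \<Rightarrow> 'v mform \<Rightarrow> 'v mform" where
  "insertion v \<alpha> vs = \<alpha> (v # vs)"

text \<open>The degree involution. On a form of degree \<open>k\<close> it is the sign
  \<open>(-1) ^ k\<close>, but it is defined without reference to a degree, so the product rules can
  be stated for arbitrary forms.\<close>

definition grading :: "'v mform \<Rightarrow> 'v mform" where
  "grading \<alpha> vs = (-1) ^ length vs * \<alpha> vs"

definition homogeneous :: "nat \<Rightarrow> 'v mform \<Rightarrow> bool" where
  "homogeneous k \<alpha> \<longleftrightarrow> (\<forall>vs. length vs \<noteq> k \<longrightarrow> \<alpha> vs = 0)"

lemma wedge_Cons:
  "(\<alpha> \<and>\<^sub>f \<beta>) (v # vs) = (insertion v \<alpha> \<and>\<^sub>f \<beta>) vs + (grading \<alpha> \<and>\<^sub>f insertion v \<beta>) vs"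
  by (simp add: insertion_def[abs_def] grading_def[abs_def])

declare wedge.simps(2)[simp del]

lemma insertion_add: "insertion v (\<alpha> +\<^sub>f \<beta>) = insertion v \<alpha> +\<^sub>f insertion v \<beta>"
  by (rule ext) (simp add: insertion_def form_add_def)

lemma insertion_scale: "insertion v (k *\<^sub>f \<alpha>) = k *\<^sub>f insertion v \<alpha>"
  by (rule ext) (simp add: insertion_def form_scale_def)

lemma grading_add: "grading (\<alpha> +\<^sub>f \<beta>) = grading \<alpha> +\<^sub>f grading \<beta>"
  by (rule ext) (simp add: grading_def form_add_def algebra_simps)

lemma grading_scale: "grading (k *\<^sub>f \<alpha>) = k *\<^sub>f grading \<alpha>"
  by (rule ext) (simp add: grading_def form_scale_def algebra_simps)

lemma grading_grading: "grading (grading \<alpha>) = \<alpha>"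
  by (rule ext) (simp add: grading_def mult.assoc[symmetric] power_mult_distrib[symmetric])

lemma insertion_grading: "insertion v (grading \<alpha>) = (-1) *\<^sub>f grading (insertion v \<alpha>)"
  by (rule ext) (simp add: grading_def insertion_def form_scale_def)

lemma wedge_add_left: "(\<alpha> +\<^sub>f \<alpha>') \<and>\<^sub>f \<beta> = (\<alpha> \<and>\<^sub>f \<beta>) +\<^sub>f (\<alpha>' \<and>\<^sub>f \<beta>)"
proof
  show "((\<alpha> +\<^sub>f \<alpha>') \<and>\<^sub>f \<beta>) vs = ((\<alpha> \<and>\<^sub>f \<beta>) +\<^sub>f (\<alpha>' \<and>\<^sub>f \<beta>)) vs" for vs
    by (induction vs arbitrary: \<alpha> \<alpha>' \<beta>)
      (simp_all add: wedge_Cons insertion_add grading_add form_add_def algebra_simps)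
qed

lemma wedge_add_right: "\<alpha> \<and>\<^sub>f (\<beta> +\<^sub>f \<beta>') = (\<alpha> \<and>\<^sub>f \<beta>) +\<^sub>f (\<alpha> \<and>\<^sub>f \<beta>')"
proof
  show "(\<alpha> \<and>\<^sub>f (\<beta> +\<^sub>f \<beta>')) vs = ((\<alpha> \<and>\<^sub>f \<beta>) +\<^sub>f (\<alpha> \<and>\<^sub>f \<beta>')) vs" for vs
    by (induction vs arbitrary: \<alpha> \<beta> \<beta>')
      (simp_all add: wedge_Cons insertion_add grading_add form_add_def algebra_simps)
qed

lemma wedge_scale_left: "(k *\<^sub>f \<alpha>) \<and>\<^sub>f \<beta> = k *\<^sub>f (\<alpha> \<and>\<^sub>f \<beta>)"
proof
  show "((k *\<^sub>f \<alpha>) \<and>\<^sub>f \<beta>) vs = (k *\<^sub>f (\<alpha> \<and>\<^sub>f \<beta>)) vs" for vs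
    by (induction vs arbitrary: \<alpha> \<beta>)
      (simp_all add: wedge_Cons insertion_scale grading_scale form_scale_def algebra_simps)
qed

lemma wedge_scale_right: "\<alpha> \<and>\<^sub>f (k *\<^sub>f \<beta>) = k *\<^sub>f (\<alpha> \<and>\<^sub>f \<beta>)"
proof
  show "(\<alpha> \<and>\<^sub>f (k *\<^sub>f \<beta>)) vs = (k *\<^sub>f (\<alpha> \<and>\<^sub>f \<beta>)) vs" for vs
    by (induction vs arbitrary: \<alpha> \<beta>)
      (simp_all add: wedge_Cons insertion_scale grading_scale form_scale_def algebra_simps)
qed

lemma form_scale_0: "0 *\<^sub>f \<alpha> = 0\<^sub>f"
  by (rule ext) (simp add: form_scale_def form_zero_def)

lemma wedge_zero_left: "0\<^sub>f \<and>\<^sub>f \<beta> = 0\<^sub>f"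
  using wedge_scale_left[of 0 "0\<^sub>f" \<beta>] by (simp add: form_scale_0)

lemma wedge_zero_right: "\<alpha> \<and>\<^sub>f 0\<^sub>f = 0\<^sub>f"
  using wedge_scale_right[of \<alpha> 0 "0\<^sub>f"] by (simp add: form_scale_0)

text \<open>Contraction lowers the degree by one, so \<open>grading\<close> anticommutes with
  \<open>insertion\<close>; the same sign arises in both terms of the recursion.\<close>

lemma grading_wedge: "grading (\<alpha> \<and>\<^sub>f \<beta>) = grading \<alpha> \<and>\<^sub>f grading \<beta>"
proof
  show "grading (\<alpha> \<and>\<^sub>f \<beta>) vs = (grading \<alpha> \<and>\<^sub>f grading \<beta>) vs" for vs
  proof (induction vs arbitrary: \<alpha> \<beta>)
    case Nil
    then show ?case by (simp add: grading_def)
  next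
    case (Cons v vs)
    have "grading (\<alpha> \<and>\<^sub>f \<beta>) (v # vs) =
        - (grading (insertion v \<alpha> \<and>\<^sub>f \<beta>) vs + grading (grading \<alpha> \<and>\<^sub>f insertion v \<beta>) vs)"
      by (simp add: grading_def wedge_Cons algebra_simps)
    also have "\<dots> = (grading \<alpha> \<and>\<^sub>f grading \<beta>) (v # vs)"
      by (simp add: Cons.IH wedge_Cons insertion_grading grading_grading wedge_scale_left
          wedge_scale_right form_scale_def)
    finally show ?case .
  qed
qed

lemma insertion_wedge:
  "insertion v (\<alpha> \<and>\<^sub>f \<beta>) = (insertion v \<alpha> \<and>\<^sub>f \<beta>) +\<^sub>f (grading \<alpha> \<and>\<^sub>f insertion v \<beta>)"
  by (rule ext) (simp add: insertion_def wedge_Cons form_add_def)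

text \<open>Contraction with the first vector gives three terms on either side, one for each factor;
  they agree by induction, the last one because \<open>grading\<close> is multiplicative.\<close>

lemma wedge_assoc: "(\<alpha> \<and>\<^sub>f \<beta>) \<and>\<^sub>f \<gamma> = \<alpha> \<and>\<^sub>f \<beta> \<and>\<^sub>f \<gamma>"
proof
  show "((\<alpha> \<and>\<^sub>f \<beta>) \<and>\<^sub>f \<gamma>) vs = (\<alpha> \<and>\<^sub>f \<beta> \<and>\<^sub>f \<gamma>) vs" for vs
    by (induction vs arbitrary: \<alpha> \<beta> \<gamma>)
      (simp_all add: wedge_Cons insertion_wedge grading_wedge wedge_add_left wedge_add_right
        form_add_def)
qed

lemma homogeneous_insertion: "homogeneous (Suc k) \<alpha> \<Longrightarrow> homogeneous k (insertion v \<alpha>)"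
  by (simp add: homogeneous_def insertion_def)

lemma homogeneous_0_insertion: "homogeneous 0 \<alpha> \<Longrightarrow> insertion v \<alpha> = 0\<^sub>f"
  by (rule ext) (simp add: homogeneous_def insertion_def form_zero_def)

lemma homogeneous_grading: "homogeneous k \<alpha> \<Longrightarrow> grading \<alpha> = (-1) ^ k *\<^sub>f \<alpha>"
  by (rule ext) (metis (no_types) form_scale_def grading_def homogeneous_def mult_zero_right)

lemma homogeneous_wedge:
  assumes "homogeneous k \<alpha>" "homogeneous l \<beta>" shows "homogeneous (k + l) (\<alpha> \<and>\<^sub>f \<beta>)"
proof -
  have "length vs \<noteq> k + l \<Longrightarrow> (\<alpha> \<and>\<^sub>f \<beta>) vs = 0" for vs
    using assms
  proof (induction vs arbitrary: \<alpha> \<beta> k l)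
    case Nil
    then show ?case by (cases k) (auto simp: homogeneous_def)
  next
    case (Cons v vs)
    have "(insertion v \<alpha> \<and>\<^sub>f \<beta>) vs = 0"
      \<comment> \<open>For \<open>k = 0\<close> the index \<open>k - 1\<close> is a default value,
        but then the contracted factor is zero; likewise for \<open>l\<close> below.\<close>
      using Cons.prems Cons.IH[of "k - 1" l "insertion v \<alpha>" \<beta>]
      by (cases k) (simp_all add: homogeneous_0_insertion wedge_zero_left form_zero_def homogeneous_insertion)
    moreover have "(\<alpha> \<and>\<^sub>f insertion v \<beta>) vs = 0"
      using Cons.prems Cons.IH[of k "l - 1" \<alpha> "insertion v \<beta>"]
      by (cases l) (simp_all add: homogeneous_0_insertion wedge_zero_right form_zero_def homogeneous_insertion)
    ultimately show ?case
      by (simp add: wedge_Cons homogeneous_grading[OF Cons.prems(2)] wedge_scale_left form_scale_def)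
  qed
  then show ?thesis by (simp add: homogeneous_def)
qed

text \<open>The wedge is the signed shuffle product on functions of lists, hence graded commutative.
  Contracting one factor changes the exponent \<open>k * l\<close> by \<open>l\<close> or by
  \<open>k\<close>, and this is the sign that \<open>grading\<close> puts on the other factor after
  the swap.\<close>

lemma wedge_commute:
  assumes "homogeneous k \<alpha>" "homogeneous l \<beta>" shows "\<alpha> \<and>\<^sub>f \<beta> = (-1) ^ (k * l) *\<^sub>f (\<beta> \<and>\<^sub>f \<alpha>)"
proof
  show "(\<alpha> \<and>\<^sub>f \<beta>) vs = ((-1) ^ (k * l) *\<^sub>f (\<beta> \<and>\<^sub>f \<alpha>)) vs" for vs
    using assms
  proof (induction vs arbitrary: \<alpha> \<beta> k l)
    case Nil
    then show ?case by (cases "k = 0 \<or> l = 0") (auto simp: homogeneous_def form_scale_def)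
  next
    case (Cons v vs)
    have 1: "(insertion v \<alpha> \<and>\<^sub>f \<beta>) vs = (-1) ^ (k * l) * (-1) ^ l * (\<beta> \<and>\<^sub>f insertion v \<alpha>) vs"
      using Cons.prems Cons.IH[of "k - 1" "insertion v \<alpha>" l \<beta>]
      by (cases k) (simp_all add: homogeneous_0_insertion wedge_zero_left wedge_zero_right
          form_zero_def homogeneous_insertion form_scale_def power_add power_mult_distrib[symmetric])
    have 2: "(-1) ^ k * (\<alpha> \<and>\<^sub>f insertion v \<beta>) vs = (-1) ^ (k * l) * (insertion v \<beta> \<and>\<^sub>f \<alpha>) vs"
      using Cons.prems Cons.IH[of k \<alpha> "l - 1" "insertion v \<beta>"]
      by (cases l) (simp_all add: homogeneous_0_insertion wedge_zero_left wedge_zero_right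
          form_zero_def homogeneous_insertion form_scale_def power_add power_mult_distrib[symmetric])
    from 1 2 show ?case
      by (simp add: wedge_Cons homogeneous_grading[OF Cons.prems(1)] homogeneous_grading[OF Cons.prems(2)]
          wedge_scale_left form_scale_def algebra_simps)
  qed
qed

lemma wedge_map: "(\<alpha> \<and>\<^sub>f \<beta>) (map f vs) = ((\<lambda>us. \<alpha> (map f us)) \<and>\<^sub>f (\<lambda>us. \<beta> (map f us))) vs"
proof (induction vs arbitrary: \<alpha> \<beta>)
  case (Cons v vs)
  have "(\<lambda>us. insertion (f v) \<gamma> (map f us)) = insertion v (\<lambda>us. \<gamma> (map f us))"
    "(\<lambda>us. grading \<gamma> (map f us)) = grading (\<lambda>us. \<gamma> (map f us))" for \<gamma>
    by (simp_all add: fun_eq_iff insertion_def grading_def)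
  then show ?case by (simp add: wedge_Cons Cons.IH)
qed simp

section \<open>Exterior derivative, pullback and Lie derivative\<close>

text \<open>The Lie derivative along the constant field \<open>v\<close>, which differentiates
  coefficients only.\<close>

definition form_deriv :: "'v::euclidean_space \<Rightarrow> 'v dform \<Rightarrow> 'v \<Rightarrow> 'v mform" where
  "form_deriv v \<beta> x vs = dd (\<lambda>y. \<beta> y vs) x v"

definition differentiable_form :: "'v::euclidean_space dform \<Rightarrow> 'v \<Rightarrow> bool" where
  "differentiable_form \<beta> x \<longleftrightarrow> (\<forall>vs. (\<lambda>y. \<beta> y vs) differentiable (at x))"

lemma dd_add: "f differentiable (at x) \<Longrightarrow> g differentiable (at x) \<Longrightarrow>
    dd (\<lambda>y. f y + g y) x v = dd f x v + dd g x v"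
  by (rule dd_eqI) (intro has_derivative_add has_derivative_dd)

lemma dd_mult:
  fixes f g :: "'v::real_normed_vector \<Rightarrow> 'a::real_normed_algebra"
  shows "f differentiable (at x) \<Longrightarrow> g differentiable (at x) \<Longrightarrow>
    dd (\<lambda>y. f y * g y) x v = dd f x v * g x + f x * dd g x v"
  using dd_eqI[OF has_derivative_mult[OF has_derivative_dd has_derivative_dd], of f x g v] by simp

lemma dd_cmult:
  fixes f :: "'v::real_normed_vector \<Rightarrow> 'a::real_normed_algebra"
  shows "f differentiable (at x) \<Longrightarrow> dd (\<lambda>y. c * f y) x v = c * dd f x v"
  by (rule dd_bounded_linear[OF bounded_linear_mult_right])

lemma differentiable_cmult:
  fixes f :: "'v::real_normed_vector \<Rightarrow> 'a::real_normed_algebra"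
  shows "f differentiable (at x) \<Longrightarrow> (\<lambda>y. c * f y) differentiable (at x)"
  by simp

lemma differentiable_form_insertion:
  "differentiable_form \<beta> x \<Longrightarrow> differentiable_form (\<lambda>y. insertion v (\<beta> y)) x"
  by (simp add: differentiable_form_def insertion_def)

lemma differentiable_form_grading:
  "differentiable_form \<beta> x \<Longrightarrow> differentiable_form (\<lambda>y. grading (\<beta> y)) x"
  by (simp add: differentiable_form_def grading_def)

lemma differentiable_form_add:
  "differentiable_form \<alpha> x \<Longrightarrow> differentiable_form \<beta> x \<Longrightarrow> differentiable_form (\<lambda>y. \<alpha> y +\<^sub>f \<beta> y) x"
  by (simp add: differentiable_form_def form_add_def)

lemma differentiable_form_scale:
  "differentiable_form \<beta> x \<Longrightarrow> differentiable_form (\<lambda>y. k *\<^sub>f \<beta> y) x"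
  by (simp add: differentiable_form_def form_scale_def)

lemma differentiable_form_wedge:
  assumes "differentiable_form \<alpha> x" "differentiable_form \<beta> x"
  shows "differentiable_form (\<lambda>y. \<alpha> y \<and>\<^sub>f \<beta> y) x"
proof -
  have "(\<lambda>y. (\<alpha> y \<and>\<^sub>f \<beta> y) vs) differentiable (at x)" for vs
    using assms
  proof (induction vs arbitrary: \<alpha> \<beta>)
    case Nil
    then show ?case by (simp add: differentiable_form_def)
  next
    case (Cons v vs)
    then show ?case
      by (simp add: wedge_Cons differentiable_form_insertion differentiable_form_grading)
  qed
  then show ?thesis by (simp add: differentiable_form_def)
qed

lemma form_deriv_insertion: "form_deriv u (\<lambda>y. insertion v (\<beta> y)) x = insertion v (form_deriv u \<beta> x)"
  by (rule ext) (simp add: form_deriv_def insertion_def)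

lemma form_deriv_grading:
  assumes "differentiable_form \<beta> x"
  shows "form_deriv u (\<lambda>y. grading (\<beta> y)) x = grading (form_deriv u \<beta> x)"
  using assms by (intro ext) (simp add: form_deriv_def grading_def differentiable_form_def dd_cmult)

lemma form_deriv_wedge:
  assumes "differentiable_form \<alpha> x" "differentiable_form \<beta> x"
  shows "form_deriv u (\<lambda>y. \<alpha> y \<and>\<^sub>f \<beta> y) x =
    (form_deriv u \<alpha> x \<and>\<^sub>f \<beta> x) +\<^sub>f (\<alpha> x \<and>\<^sub>f form_deriv u \<beta> x)"
proof
  show "form_deriv u (\<lambda>y. \<alpha> y \<and>\<^sub>f \<beta> y) x vs =
    ((form_deriv u \<alpha> x \<and>\<^sub>f \<beta> x) +\<^sub>f (\<alpha> x \<and>\<^sub>f form_deriv u \<beta> x)) vs" for vs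
    using assms
  proof (induction vs arbitrary: \<alpha> \<beta>)
    case Nil
    then show ?case by (simp add: differentiable_form_def form_add_def form_deriv_def dd_mult)
  next
    case (Cons v vs)
    let ?a = "\<lambda>y. insertion v (\<alpha> y)" and ?b = "\<lambda>y. insertion v (\<beta> y)" and ?g = "\<lambda>y. grading (\<alpha> y)"
    note d = Cons.prems differentiable_form_insertion[OF Cons.prems(1), of v]
      differentiable_form_insertion[OF Cons.prems(2), of v] differentiable_form_grading[OF Cons.prems(1)]
    have "form_deriv u (\<lambda>y. \<alpha> y \<and>\<^sub>f \<beta> y) x (v # vs) =
        form_deriv u (\<lambda>y. ?a y \<and>\<^sub>f \<beta> y) x vs + form_deriv u (\<lambda>y. ?g y \<and>\<^sub>f ?b y) x vs"
      unfolding form_deriv_def wedge_Cons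
      using differentiable_form_wedge[OF d(3,2)] differentiable_form_wedge[OF d(5,4)]
      by (intro dd_add) (simp_all add: differentiable_form_def)
    then show ?case
      using Cons.IH[OF d(3,2)] Cons.IH[OF d(5,4)] d(1)
      by (simp add: wedge_Cons form_add_def form_deriv_insertion form_deriv_grading algebra_simps)
  qed
qed

lemma ext_d_Nil: "ext_d \<beta> x [] = 0"
  by (simp add: ext_d_def)

text \<open>Cartan's formula for a constant field: contracting \<open>d\<beta>\<close> gives the Lie
  derivative minus \<open>d\<close> of the contraction. The inductions on the argument list rest on
  it.\<close>

lemma ext_d_Cons:
  "ext_d \<beta> x (v # vs) = form_deriv v \<beta> x vs - ext_d (\<lambda>y. insertion v (\<beta> y)) x vs"
  unfolding ext_d_def
  by (simp add: sum.lessThan_Suc_shift form_deriv_def insertion_def sum_negf del: sum.lessThan_Suc)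

lemma ext_d_add:
  assumes "differentiable_form \<alpha> x" "differentiable_form \<beta> x"
  shows "ext_d (\<lambda>y. \<alpha> y +\<^sub>f \<beta> y) x = ext_d \<alpha> x +\<^sub>f ext_d \<beta> x"
  using assms
  by (intro ext) (simp add: ext_d_def form_add_def differentiable_form_def dd_add algebra_simps sum.distrib)

lemma ext_d_scale:
  assumes "differentiable_form \<beta> x"
  shows "ext_d (\<lambda>y. k *\<^sub>f \<beta> y) x = k *\<^sub>f ext_d \<beta> x"
  using assms
  by (intro ext) (simp add: ext_d_def form_scale_def differentiable_form_def dd_cmult sum_distrib_left mult.left_commute)

lemma ext_d_grading:
  assumes "differentiable_form \<beta> x"
  shows "ext_d (\<lambda>y. grading (\<beta> y)) x = (-1) *\<^sub>f grading (ext_d \<beta> x)"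
proof
  fix vs :: "'a list"
  \<comment> \<open>The coefficients take one argument less than \<open>d\<beta>\<close>, hence the
    exponent \<open>length vs - 1\<close>; for the empty list both sides vanish.\<close>
  have "ext_d (\<lambda>y. grading (\<beta> y)) x vs = (\<Sum>i<length vs. (-1) ^ i *
     ((-1) ^ (length vs - 1) * dd (\<lambda>y. \<beta> y (take i vs @ drop (Suc i) vs)) x (vs ! i)))"
    unfolding ext_d_def grading_def using assms
    by (intro sum.cong) (simp_all add: differentiable_form_def dd_cmult)
  also have "\<dots> = (-1) ^ (length vs - 1) * ext_d \<beta> x vs"
    by (simp add: ext_d_def sum_distrib_left mult.left_commute)
  also have "\<dots> = ((-1) *\<^sub>f grading (ext_d \<beta> x)) vs"
    by (cases vs) (simp_all add: form_scale_def grading_def ext_d_Nil)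
  finally show "ext_d (\<lambda>y. grading (\<beta> y)) x vs = ((-1) *\<^sub>f grading (ext_d \<beta> x)) vs" .
qed

lemma insertion_ext_d:
  "insertion v (ext_d \<beta> x) = form_deriv v \<beta> x +\<^sub>f (-1) *\<^sub>f ext_d (\<lambda>y. insertion v (\<beta> y)) x"
  by (rule ext) (simp add: insertion_def ext_d_Cons form_add_def form_scale_def)

text \<open>After contraction with the first vector, Cartan's formula and the Leibniz rule for the
  Lie derivative reduce the claim to products with one contracted factor on the shorter list. The
  signs match because \<open>d\<close> and contraction are both of odd degree.\<close>

lemma ext_d_wedge:
  assumes "differentiable_form \<alpha> x" "differentiable_form \<beta> x"
  shows "ext_d (\<lambda>y. \<alpha> y \<and>\<^sub>f \<beta> y) x = (ext_d \<alpha> x \<and>\<^sub>f \<beta> x) +\<^sub>f (grading (\<alpha> x) \<and>\<^sub>f ext_d \<beta> x)"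
proof
  show "ext_d (\<lambda>y. \<alpha> y \<and>\<^sub>f \<beta> y) x vs =
    ((ext_d \<alpha> x \<and>\<^sub>f \<beta> x) +\<^sub>f (grading (\<alpha> x) \<and>\<^sub>f ext_d \<beta> x)) vs" for vs
    using assms
  proof (induction vs arbitrary: \<alpha> \<beta>)
    case Nil
    then show ?case by (simp add: ext_d_Nil form_add_def)
  next
    case (Cons v vs)
    let ?a = "\<lambda>y. insertion v (\<alpha> y)" and ?b = "\<lambda>y. insertion v (\<beta> y)" and ?g = "\<lambda>y. grading (\<alpha> y)"
    note d = Cons.prems differentiable_form_insertion[OF Cons.prems(1), of v]
      differentiable_form_insertion[OF Cons.prems(2), of v] differentiable_form_grading[OF Cons.prems(1)]
    have "ext_d (\<lambda>y. \<alpha> y \<and>\<^sub>f \<beta> y) x (v # vs) = form_deriv v (\<lambda>y. \<alpha> y \<and>\<^sub>f \<beta> y) x vs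
        - (ext_d (\<lambda>y. ?a y \<and>\<^sub>f \<beta> y) x vs + ext_d (\<lambda>y. ?g y \<and>\<^sub>f ?b y) x vs)"
      using ext_d_add[OF differentiable_form_wedge[OF d(3,2)] differentiable_form_wedge[OF d(5,4)]]
      by (simp add: ext_d_Cons insertion_wedge form_add_def)
    also have "form_deriv v (\<lambda>y. \<alpha> y \<and>\<^sub>f \<beta> y) x vs =
        (form_deriv v \<alpha> x \<and>\<^sub>f \<beta> x) vs + (\<alpha> x \<and>\<^sub>f form_deriv v \<beta> x) vs"
      by (simp only: form_deriv_wedge[OF d(1,2)] form_add_def)
    also have "ext_d (\<lambda>y. ?a y \<and>\<^sub>f \<beta> y) x vs =
        (ext_d ?a x \<and>\<^sub>f \<beta> x) vs + (grading (insertion v (\<alpha> x)) \<and>\<^sub>f ext_d \<beta> x) vs"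
      by (simp only: Cons.IH[OF d(3,2)] form_add_def)
    also have "ext_d (\<lambda>y. ?g y \<and>\<^sub>f ?b y) x vs =
        - (grading (ext_d \<alpha> x) \<and>\<^sub>f insertion v (\<beta> x)) vs + (\<alpha> x \<and>\<^sub>f ext_d ?b x) vs"
      by (simp only: Cons.IH[OF d(5,4)] form_add_def ext_d_grading[OF d(1)] grading_grading
          wedge_scale_left) (simp add: form_scale_def)
    also have "(form_deriv v \<alpha> x \<and>\<^sub>f \<beta> x) vs + (\<alpha> x \<and>\<^sub>f form_deriv v \<beta> x) vs
        - ((ext_d ?a x \<and>\<^sub>f \<beta> x) vs + (grading (insertion v (\<alpha> x)) \<and>\<^sub>f ext_d \<beta> x) vs
        + (- (grading (ext_d \<alpha> x) \<and>\<^sub>f insertion v (\<beta> x)) vs + (\<alpha> x \<and>\<^sub>f ext_d ?b x) vs))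
        = ((ext_d \<alpha> x \<and>\<^sub>f \<beta> x) +\<^sub>f (grading (\<alpha> x) \<and>\<^sub>f ext_d \<beta> x)) (v # vs)"
      by (simp only: form_add_def wedge_Cons insertion_ext_d insertion_grading grading_grading
          wedge_add_left wedge_add_right wedge_scale_left wedge_scale_right)
        (simp add: form_scale_def)
    finally show ?case .
  qed
qed

section \<open>Alternating forms and their derivatives along moving arguments\<close>

lemma alternating_form_homogeneous: "alternating_form k \<gamma> \<Longrightarrow> homogeneous k \<gamma>"
  by (simp add: alternating_form_def homogeneous_def)

lemma alternating_form_linear:
  assumes "alternating_form k \<gamma>" "length pre + Suc (length post) = k"
  shows "linear (\<lambda>v. \<gamma> (pre @ v # post))"
proof -
  have "linear (\<lambda>v. \<gamma> ((pre @ 0 # post)[length pre := v]))"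
    using assms(1)[unfolded alternating_form_def, THEN conjunct2, THEN conjunct1, rule_format,
        of "pre @ 0 # post" "length pre"] assms(2) by simp
  then show ?thesis by simp
qed

lemma alternating_form_repeat:
  assumes "alternating_form k \<gamma>"
  shows "\<gamma> (pre @ v # mid @ v # post) = 0"
proof (cases "length (pre @ v # mid @ v # post) = k")
  case True
  let ?vs = "pre @ v # mid @ v # post"
  have "?vs ! length pre = ?vs ! (Suc (length pre + length mid))"
    by (simp add: nth_append)
  with True assms show ?thesis unfolding alternating_form_def
    by (elim conjE allE[of _ ?vs] allE[of _ "length pre"] allE[of _ "Suc (length pre + length mid)"]) simp
qed (use assms in \<open>auto simp: alternating_form_def\<close>)

text \<open>Polarisation: the form vanishes with \<open>u + v\<close> in both slots.\<close>

lemma alternating_form_swap: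
  assumes "alternating_form k \<gamma>"
  shows "\<gamma> (pre @ u # mid @ v # post) = - \<gamma> (pre @ v # mid @ u # post)"
proof (cases "length (pre @ u # mid @ v # post) = k")
  case True
  have l1: "linear (\<lambda>w. \<gamma> (pre @ w # mid @ z # post))" for z
    using alternating_form_linear[OF assms, of pre "mid @ z # post"] True by simp
  have l2: "linear (\<lambda>w. \<gamma> (pre @ z # mid @ w # post))" for z
    using alternating_form_linear[OF assms, of "pre @ z # mid" post] True by simp
  have "0 = \<gamma> (pre @ (u + v) # mid @ (u + v) # post)"
    by (simp add: alternating_form_repeat[OF assms])
  also have "\<dots> = \<gamma> (pre @ u # mid @ v # post) + \<gamma> (pre @ v # mid @ u # post)"
    unfolding linear_add[OF l1] linear_add[OF l2] by (simp add: alternating_form_repeat[OF assms])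
  finally show ?thesis by (simp add: eq_neg_iff_add_eq_0)
qed (use assms in \<open>auto simp: alternating_form_def\<close>)

lemma form_on_D:
  assumes "form_on U k \<beta>" "x \<in> U"
  shows form_on_alternating: "alternating_form k (\<beta> x)"
    and form_on_differentiable_form: "differentiable_form \<beta> x"
    and form_on_differentiable: "(\<lambda>y. \<beta> y vs) differentiable (at x)"
proof -
  show "alternating_form k (\<beta> x)" using assms by (simp add: form_on_def)
  show d: "(\<lambda>y. \<beta> y vs) differentiable (at x)" for vs
    using assms smooth_on_differentiable[of U "\<lambda>y. \<beta> y vs" x] by (simp add: form_on_def)
  show "differentiable_form \<beta> x" by (simp add: differentiable_form_def d)
qed

lemma homogeneous_ext_d:
  assumes "open U" "x \<in> U" "\<And>y. y \<in> U \<Longrightarrow> homogeneous k (\<beta> y)"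
  shows "homogeneous (Suc k) (ext_d \<beta> x)"
  unfolding homogeneous_def
proof (intro allI impI)
  fix vs :: "'a list" assume len: "length vs \<noteq> Suc k"
  have "dd (\<lambda>y. \<beta> y (take i vs @ drop (Suc i) vs)) x = dd (\<lambda>y. 0) x" if "i < length vs" for i
    using assms that len
    by (intro frechet_derivative_cong_open[OF assms(1,2)]) (auto simp: homogeneous_def)
  then show "ext_d \<beta> x vs = 0"
    by (simp add: ext_d_def frechet_derivative_const)
qed

lemma ext_d_cong_open:
  assumes "open U" "x \<in> U" "\<And>y. y \<in> U \<Longrightarrow> \<beta> y = \<beta>' y"
  shows "ext_d \<beta> x = ext_d \<beta>' x"
proof
  fix vs
  have "dd (\<lambda>y. \<beta> y us) x = dd (\<lambda>y. \<beta>' y us) x" for us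
    using assms by (intro frechet_derivative_cong_open[OF assms(1,2)]) auto
  then show "ext_d \<beta> x vs = ext_d \<beta>' x vs" by (simp add: ext_d_def)
qed

lemma ext_d_3: "ext_d \<beta> x [u, v, w] = dd (\<lambda>y. \<beta> y [v, w]) x u - dd (\<lambda>y. \<beta> y [u, w]) x v
    + dd (\<lambda>y. \<beta> y [u, v]) x w"
  by (simp add: ext_d_Cons ext_d_Nil form_deriv_def insertion_def)

lemma ext_d_4: "ext_d \<beta> x [u, v, w, z] = dd (\<lambda>y. \<beta> y [v, w, z]) x u - dd (\<lambda>y. \<beta> y [u, w, z]) x v
    + dd (\<lambda>y. \<beta> y [u, v, z]) x w - dd (\<lambda>y. \<beta> y [u, v, w]) x z"
  by (simp add: ext_d_Cons ext_d_Nil form_deriv_def insertion_def)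

text \<open>Each pair holds the value of a moving argument and its derivative. The sum replaces one
  argument after the other by its derivative, and \<open>pre\<close> collects the arguments already
  passed, kept at their values.\<close>

fun slot_deriv :: "'v mform \<Rightarrow> 'v list \<Rightarrow> ('v \<times> 'v) list \<Rightarrow> complex" where
  "slot_deriv \<gamma> pre [] = 0"
| "slot_deriv \<gamma> pre ((a, a') # ps) = \<gamma> (pre @ a' # map fst ps) + slot_deriv \<gamma> (pre @ [a]) ps"

lemma linear_slot_deriv:
  assumes "alternating_form k \<gamma>"
  shows "length pre + Suc (length mid + length ps) = k \<Longrightarrow> linear (\<lambda>v. slot_deriv \<gamma> (pre @ v # mid) ps)"
proof (induction ps arbitrary: mid)
  case Nil
  then show ?case by (simp add: linear_zero)
next
  case (Cons p ps)
  obtain a a' where p: "p = (a, a')" by force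
  have "linear (\<lambda>v. \<gamma> (pre @ v # mid @ a' # map fst ps))"
    using Cons.prems by (intro alternating_form_linear[OF assms]) simp
  moreover have "linear (\<lambda>v. slot_deriv \<gamma> (pre @ v # mid @ [a]) ps)"
    using Cons.IH[of "mid @ [a]"] Cons.prems by simp
  ultimately show ?case by (simp add: p linear_compose_add)
qed

lemma linear_basis_expansion:
  fixes h :: "'a::euclidean_space \<Rightarrow> 'b::real_vector"
  assumes "linear h" shows "h a = (\<Sum>b\<in>Basis. (a \<bullet> b) *\<^sub>R h b)"
proof -
  have "h a = h (\<Sum>b\<in>Basis. (a \<bullet> b) *\<^sub>R b)" by (simp add: euclidean_representation)
  then show ?thesis by (simp add: linear_sum[OF assms] linear_cmul[OF assms])
qed

lemma linear_form_deriv: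
  assumes "open V" "z \<in> V" "form_on V k \<beta>" "length pre + Suc (length post) = k"
  shows "linear (\<lambda>v. form_deriv w \<beta> z (pre @ v # post))"
proof -
  note d = form_on_differentiable[OF assms(3,2)]
  have l: "linear (\<lambda>v. \<beta> y (pre @ v # post))" if "y \<in> V" for y
    by (rule alternating_form_linear[OF form_on_alternating[OF assms(3) that] assms(4)])
  show ?thesis
  proof (rule linearI)
    fix a b
    have "dd (\<lambda>y. \<beta> y (pre @ (a + b) # post)) z w = dd (\<lambda>y. \<beta> y (pre @ a # post) + \<beta> y (pre @ b # post)) z w"
      by (subst frechet_derivative_cong_open[OF assms(1,2)]) (auto simp: linear_add[OF l])
    then show "form_deriv w \<beta> z (pre @ (a + b) # post) = form_deriv w \<beta> z (pre @ a # post) + form_deriv w \<beta> z (pre @ b # post)"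
      by (simp add: form_deriv_def dd_add d)
  next
    fix r b
    have "dd (\<lambda>y. \<beta> y (pre @ (r *\<^sub>R b) # post)) z w = dd (\<lambda>y. r *\<^sub>R \<beta> y (pre @ b # post)) z w"
      by (subst frechet_derivative_cong_open[OF assms(1,2)]) (auto simp: linear_cmul[OF l])
    then show "form_deriv w \<beta> z (pre @ (r *\<^sub>R b) # post) = r *\<^sub>R form_deriv w \<beta> z (pre @ b # post)"
      by (simp add: form_deriv_def dd_bounded_linear[OF bounded_linear_scaleR_right] d)
  qed
qed

text \<open>The product rule for a form along \<open>f\<close> with moving arguments. Smoothness of
  a form is given for fixed arguments, so the first moving argument is expanded in the basis, which
  puts its dependence on the point into scalar coefficients; the other arguments follow by induction
  with a basis vector appended to \<open>pre\<close>.\<close>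

lemma has_derivative_form_fields:
  fixes f :: "'v::euclidean_space \<Rightarrow> 'w::euclidean_space"
  assumes W: "open W" "x \<in> W" and V: "open V" "f ` W \<subseteq> V" and \<beta>: "form_on V k \<beta>"
    and f: "f differentiable (at x)"
  shows "\<forall>A\<in>set As. A differentiable (at x) \<Longrightarrow> length pre + length As = k \<Longrightarrow>
    ((\<lambda>y. \<beta> (f y) (pre @ map (\<lambda>A. A y) As)) has_derivative
     (\<lambda>u. form_deriv (dd f x u) \<beta> (f x) (pre @ map (\<lambda>A. A x) As) +
       slot_deriv (\<beta> (f x)) pre (map (\<lambda>A. (A x, dd A x u)) As))) (at x)"
proof (induction As arbitrary: pre)
  case Nil
  have "f x \<in> V" using W V by auto
  then have "((\<lambda>z. \<beta> z pre) has_derivative dd (\<lambda>z. \<beta> z pre) (f x)) (at (f x))"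
    by (intro has_derivative_dd form_on_differentiable[OF \<beta>])
  then show ?case
    using has_derivative_compose[OF has_derivative_dd[OF f], of "\<lambda>z. \<beta> z pre"]
    by (simp add: form_deriv_def)
next
  case (Cons A As)
  have fx: "f x \<in> V" using W V by auto
  let ?rest = "\<lambda>y. map (\<lambda>A. A y) As" and ?ps = "\<lambda>u. map (\<lambda>A. (A x, dd A x u)) As"
  have lin: "linear (\<lambda>v. \<beta> (f y) (pre @ v # ?rest y'))" if "y \<in> W" for y y'
    using that V Cons.prems
    by (intro alternating_form_linear[OF form_on_alternating[OF \<beta>]]) auto
  have A: "(A has_derivative dd A x) (at x)" using Cons.prems by (intro has_derivative_dd) simp
  have IH: "((\<lambda>y. \<beta> (f y) (pre @ b # ?rest y)) has_derivative
      (\<lambda>u. form_deriv (dd f x u) \<beta> (f x) (pre @ b # ?rest x) +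
        slot_deriv (\<beta> (f x)) (pre @ [b]) (?ps u))) (at x)" for b
    using Cons.IH[of "pre @ [b]"] Cons.prems by simp
  have "((\<lambda>y. \<Sum>b\<in>Basis. (A y \<bullet> b) *\<^sub>R \<beta> (f y) (pre @ b # ?rest y)) has_derivative
      (\<lambda>u. \<Sum>b\<in>Basis. (A x \<bullet> b) *\<^sub>R (form_deriv (dd f x u) \<beta> (f x) (pre @ b # ?rest x) +
        slot_deriv (\<beta> (f x)) (pre @ [b]) (?ps u)) +
        (dd A x u \<bullet> b) *\<^sub>R \<beta> (f x) (pre @ b # ?rest x))) (at x)"
    by (intro has_derivative_sum has_derivative_scaleR IH has_derivative_inner_left[OF A])
  then have "((\<lambda>y. \<beta> (f y) (pre @ A y # ?rest y)) has_derivative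
      (\<lambda>u. \<Sum>b\<in>Basis. (A x \<bullet> b) *\<^sub>R (form_deriv (dd f x u) \<beta> (f x) (pre @ b # ?rest x) +
        slot_deriv (\<beta> (f x)) (pre @ [b]) (?ps u)) +
        (dd A x u \<bullet> b) *\<^sub>R \<beta> (f x) (pre @ b # ?rest x))) (at x)"
    by (rule has_derivative_transform_within_open[OF _ W])
      (rule linear_basis_expansion[OF lin, symmetric])
  moreover have "(\<Sum>b\<in>Basis. (A x \<bullet> b) *\<^sub>R (form_deriv (dd f x u) \<beta> (f x) (pre @ b # ?rest x) +
        slot_deriv (\<beta> (f x)) (pre @ [b]) (?ps u)) +
        (dd A x u \<bullet> b) *\<^sub>R \<beta> (f x) (pre @ b # ?rest x)) =
      form_deriv (dd f x u) \<beta> (f x) (pre @ A x # ?rest x) +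
        (\<beta> (f x) (pre @ dd A x u # ?rest x) + slot_deriv (\<beta> (f x)) (pre @ [A x]) (?ps u))" for u
  proof -
    have "linear (\<lambda>v. form_deriv (dd f x u) \<beta> (f x) (pre @ v # ?rest x))"
      using Cons.prems by (intro linear_form_deriv[OF V(1) fx \<beta>]) simp
    moreover have "linear (\<lambda>v. slot_deriv (\<beta> (f x)) (pre @ [v]) (?ps u))"
      using Cons.prems by (intro linear_slot_deriv[OF form_on_alternating[OF \<beta> fx]]) simp
    moreover note lin[OF W(2)]
    ultimately show ?thesis
      by (simp add: sum.distrib scaleR_add_right linear_basis_expansion[symmetric] add.assoc)
  qed
  ultimately show ?case by (simp add: comp_def)
qed

lemma dd_form_fields:
  fixes f :: "'v::euclidean_space \<Rightarrow> 'w::euclidean_space"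
  assumes "open W" "x \<in> W" "open V" "f ` W \<subseteq> V" "form_on V k \<beta>" "f differentiable (at x)"
  shows dd_form_fields_1: "k = 1 \<Longrightarrow> A differentiable (at x) \<Longrightarrow>
      dd (\<lambda>y. \<beta> (f y) [A y]) x u = dd (\<lambda>z. \<beta> z [A x]) (f x) (dd f x u) + \<beta> (f x) [dd A x u]"
    and dd_form_fields_2: "k = 2 \<Longrightarrow> A differentiable (at x) \<Longrightarrow> B differentiable (at x) \<Longrightarrow>
      dd (\<lambda>y. \<beta> (f y) [A y, B y]) x u = dd (\<lambda>z. \<beta> z [A x, B x]) (f x) (dd f x u) +
        \<beta> (f x) [dd A x u, B x] + \<beta> (f x) [A x, dd B x u]"
    and dd_form_fields_3: "k = 3 \<Longrightarrow> A differentiable (at x) \<Longrightarrow> B differentiable (at x) \<Longrightarrow>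
      C differentiable (at x) \<Longrightarrow>
      dd (\<lambda>y. \<beta> (f y) [A y, B y, C y]) x u = dd (\<lambda>z. \<beta> z [A x, B x, C x]) (f x) (dd f x u) +
        \<beta> (f x) [dd A x u, B x, C x] + \<beta> (f x) [A x, dd B x u, C x] + \<beta> (f x) [A x, B x, dd C x u]"
  using dd_eqI[OF has_derivative_form_fields[OF assms, of "[A]" "[]"], of u]
    dd_eqI[OF has_derivative_form_fields[OF assms, of "[A, B]" "[]"], of u]
    dd_eqI[OF has_derivative_form_fields[OF assms, of "[A, B, C]" "[]"], of u]
  by (simp_all add: form_deriv_def add.assoc)

lemma pullback_homogeneous: "homogeneous k (\<beta> (f x)) \<Longrightarrow> homogeneous k (pullback f \<beta> x)"
  by (simp add: homogeneous_def pullback_def)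

lemma alternating_form_swap2: "alternating_form 2 \<gamma> \<Longrightarrow> \<gamma> [u, v] = - \<gamma> [v, u]"
  using alternating_form_swap[of 2 \<gamma> "[]" u "[]" v "[]"] by simp

lemma alternating_form_swap3:
  assumes "alternating_form 3 \<gamma>"
  shows "\<gamma> [u, v, w] = - \<gamma> [v, u, w]" "\<gamma> [u, v, w] = - \<gamma> [u, w, v]" "\<gamma> [u, v, w] = - \<gamma> [w, v, u]"
  using alternating_form_swap[OF assms, of "[]" u "[]" v "[w]"] alternating_form_swap[OF assms, of "[u]" v "[]" w "[]"]
    alternating_form_swap[OF assms, of "[]" u "[v]" w "[]"] by simp_all

text \<open>Apart from the expected terms, the product rule yields terms with a second derivative of
  \<open>f\<close> in one slot. They cancel in pairs, since second derivatives are symmetric and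
  \<beta> alternates. The degrees are those of \<open>\<eta> i\<close>, \<omega> and
  \<Omega>.\<close>

lemma ext_d_pullback:
  fixes f :: "'v::euclidean_space \<Rightarrow> 'w::euclidean_space"
  assumes W: "open W" "x \<in> W" and V: "open V" "f ` W \<subseteq> V" and f: "smooth_on W f" and \<beta>: "form_on V k \<beta>"
    and k: "k \<in> {1, 2, 3}"
  shows "ext_d (pullback f \<beta>) x vs = ext_d \<beta> (f x) (map (dd f x) vs)"
proof (cases "length vs = Suc k")
  case False
  have "homogeneous (Suc k) (ext_d (pullback f \<beta>) x)"
    using V \<beta> by (intro homogeneous_ext_d[OF W] pullback_homogeneous alternating_form_homogeneous
        form_on_alternating[OF \<beta>]) auto
  moreover have "homogeneous (Suc k) (ext_d \<beta> (f x))"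
    using V W by (intro homogeneous_ext_d[OF V(1)] alternating_form_homogeneous form_on_alternating[OF \<beta>]) auto
  ultimately show ?thesis using False by (simp add: homogeneous_def)
next
  case True
  have fx: "f x \<in> V" using W V by auto
  note alt = form_on_alternating[OF \<beta> fx]
  note ff = dd_form_fields[OF W V \<beta> smooth_on_differentiable[OF f W(2)]]
  have d: "(\<lambda>y. dd f y v) differentiable (at x)" for v
    by (rule smooth_on_differentiable[OF smooth_on_frechet[OF f] W(2)])
  have sym: "dd (\<lambda>y. dd f y u) x v = dd (\<lambda>y. dd f y v) x u" for u v
    by (rule second_derivative_symmetric[OF W f])
  consider u v where "k = 1" "vs = [u, v]" | u v w where "k = 2" "vs = [u, v, w]"
    | u v w z where "k = 3" "vs = [u, v, w, z]"
    using k True by (auto simp: length_Suc_conv numeral_2_eq_2 numeral_3_eq_3)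
  then show ?thesis
  proof cases
    case 1
    then show ?thesis by (simp add: ext_d_one_form pullback_def ff d sym[of u v])
  next
    case 2
    note a = alternating_form_swap2[OF alt[unfolded 2]]
    show ?thesis
      by (simp add: 2 ext_d_3 pullback_def ff(2)[OF 2(1)] d)
        (simp add: sym[of u v] sym[of u w] sym[of v w] a[of "dd f x _" "dd (\<lambda>y. dd f y _) x _"])
  next
    case 3
    note a = alternating_form_swap3[OF alt[unfolded 3]]
    let ?H = "\<lambda>v u. dd (\<lambda>y. dd f y v) x u"
    \<comment> \<open>Second derivatives are moved to the first slot, where the twelve terms become
      comparable.\<close>
    have e: "\<beta> (f x) [p, ?H q r, s] = - \<beta> (f x) [?H q r, p, s]"
      "\<beta> (f x) [p, s, ?H q r] = \<beta> (f x) [?H q r, p, s]" for p q r s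
      using a(1)[of p "?H q r" s] a(2)[of p s "?H q r"] by simp_all
    show ?thesis
      apply (simp add: 3 ext_d_4 pullback_def ff(3)[OF 3(1)] d)
      apply (simp add: e)
      apply (simp add: sym[of u v] sym[of u w] sym[of u z] sym[of v w] sym[of v z] sym[of w z])
      done
  qed
qed

text \<open>Both summands of Cartan's formula \<open>L_X = i_X d + d i_X\<close> vanish. Concretely,
  differentiating \<open>\<beta>(X, ...) = 0\<close> trades a derivative of \<beta> for
  \<open>- \<beta>(DX, ...)\<close>, which turns the vanishing of \<open>i_X d\<beta>\<close> into
  the claim.\<close>

lemma lie_derivative_eq_0:
  fixes X :: "'v::euclidean_space \<Rightarrow> 'v"
  assumes U: "open U" "x \<in> U" and X: "smooth_on U X" and \<beta>: "form_on U k \<beta>" and k: "k \<in> {2, 3}"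
    and c: "\<And>y vs. y \<in> U \<Longrightarrow> contraction X \<beta> y vs = 0" "\<And>vs. contraction X (ext_d \<beta>) x vs = 0"
  shows "lie_derivative X \<beta> x vs = 0"
proof (cases "length vs = k")
  case False
  have "dd (\<lambda>y. \<beta> y vs) x = dd (\<lambda>y. 0) x"
    using False form_on_alternating[OF \<beta>]
    by (intro frechet_derivative_cong_open[OF U]) (auto simp: alternating_form_def)
  moreover have "\<beta> x (vs[i := w]) = 0" for i w
    using False form_on_alternating[OF \<beta> U(2)] by (auto simp: alternating_form_def)
  ultimately show ?thesis by (simp add: lie_derivative_def frechet_derivative_const)
next
  case True
  note alt = form_on_alternating[OF \<beta> U(2)]
  \<comment> \<open>The product rule is applied along the identity map, so that only the base point
    and the argument \<open>X\<close> move.\<close>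
  have id: "(\<lambda>y. y) differentiable (at x)" "(\<lambda>y. y) ` U \<subseteq> U" by auto
  note ff = dd_form_fields[OF U U(1) id(2) \<beta> id(1)]
  have d: "X differentiable (at x)" "(\<lambda>y. v) differentiable (at x)" for v
    by (auto intro: smooth_on_differentiable[OF X U(2)])
  have dX: "dd (\<lambda>y. \<beta> y (X y # us)) x u = 0" for us u
  proof -
    have "dd (\<lambda>y. \<beta> y (X y # us)) x = dd (\<lambda>y. 0) x"
      using c(1) by (intro frechet_derivative_cong_open[OF U]) (auto simp: contraction_def)
    then show ?thesis by (simp add: frechet_derivative_const)
  qed
  have ddid: "dd (\<lambda>y. y) x u = u" for u by (rule dd_eqI) simp
  consider u v where "k = 2" "vs = [u, v]" | u v w where "k = 3" "vs = [u, v, w]"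
    using k True by (auto simp: length_Suc_conv numeral_2_eq_2 numeral_3_eq_3)
  then show ?thesis
  proof cases
    case 1
    note a = alternating_form_swap2[OF alt[unfolded 1]]
    have z: "\<beta> x [p, 0] = 0" for p
      using linear_0[OF alternating_form_linear[OF alt, of "[p]" "[]"]] 1 by simp
    have D: "dd (\<lambda>y. \<beta> y [X x, p]) x q = - \<beta> x [dd X x q, p]" for p q
      using ff(2)[OF 1(1) d(1) d(2)[of p], of q] dX[of "[p]" q]
      by (simp add: ddid frechet_derivative_const z eq_neg_iff_add_eq_0)
    show ?thesis
      using c(2)[of vs] a[of u "dd X x v"]
      by (simp add: 1 contraction_def ext_d_3 D lie_derivative_def lessThan_Suc numeral_2_eq_2 add_diff_eq)
  next
    case 2
    note a = alternating_form_swap3[OF alt[unfolded 2]]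
    have z: "\<beta> x [p, 0, q] = 0" "\<beta> x [p, q, 0] = 0" for p q
      using linear_0[OF alternating_form_linear[OF alt, of "[p]" "[q]"]]
        linear_0[OF alternating_form_linear[OF alt, of "[p, q]" "[]"]] 2 by simp_all
    have D: "dd (\<lambda>y. \<beta> y [X x, p, r]) x q = - \<beta> x [dd X x q, p, r]" for p q r
      using ff(3)[OF 2(1) d(1) d(2)[of p] d(2)[of r], of q] dX[of "[p, r]" q]
      by (simp add: ddid frechet_derivative_const z eq_neg_iff_add_eq_0)
    show ?thesis
      using c(2)[of vs] a(1)[of u "dd X x v" w] a(2)[of u v "dd X x w"] a(1)[of u "dd X x w" v]
      by (simp add: 2 contraction_def ext_d_4 D lie_derivative_def lessThan_Suc numeral_3_eq_3 algebra_simps)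
  qed
qed

text \<open>For constant \<open>v\<close> one has \<open>i_v d d = L_v d - d L_v + d d i_v\<close>.
  The first two terms cancel by the symmetry of second derivatives, and the last one vanishes by
  induction on the argument list.\<close>

lemma ext_d_ext_d:
  assumes U: "open U" "x \<in> U" and \<beta>: "\<And>vs. smooth_on U (\<lambda>y. \<beta> y vs)"
  shows "ext_d (ext_d \<beta>) x = 0\<^sub>f"
proof
  show "ext_d (ext_d \<beta>) x vs = 0\<^sub>f vs" for vs
    using \<beta>
  proof (induction vs arbitrary: \<beta>)
    case Nil
    then show ?case by (simp add: ext_d_Nil form_zero_def)
  next
    case (Cons v vs)
    let ?b = "\<lambda>y. insertion v (\<beta> y)"
    have sm: "smooth_on U (\<lambda>y. ?b y us)" for us using Cons.prems by (simp add: insertion_def)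
    have d1: "(\<lambda>y. dd (\<lambda>z. \<beta> z us) y u) differentiable (at x)" for us u
      by (rule smooth_on_differentiable[OF smooth_on_frechet[OF Cons.prems] U(2)])
    have d2: "differentiable_form (form_deriv v \<beta>) x"
      using d1 by (simp add: differentiable_form_def form_deriv_def)
    have d3: "differentiable_form (ext_d \<gamma>) x" if "\<And>us. smooth_on U (\<lambda>y. \<gamma> y us)" for \<gamma>
      unfolding differentiable_form_def ext_d_def
      by (intro allI differentiable_sum finite_lessThan ballI differentiable_cmult
          smooth_on_differentiable[OF smooth_on_frechet[OF that] U(2)])
    have "form_deriv v (ext_d \<beta>) x vs = (\<Sum>i<length vs. (-1) ^ i *
        dd (\<lambda>y. dd (\<lambda>z. \<beta> z (take i vs @ drop (Suc i) vs)) y (vs ! i)) x v)"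
      unfolding form_deriv_def ext_d_def
      by (rule dd_eqI) (intro has_derivative_sum has_derivative_mult_right has_derivative_dd d1)
    also have "\<dots> = ext_d (form_deriv v \<beta>) x vs"
      unfolding ext_d_def form_deriv_def
      by (simp add: second_derivative_symmetric[OF U Cons.prems, of _ v])
    finally have e: "form_deriv v (ext_d \<beta>) x vs = ext_d (form_deriv v \<beta>) x vs" .
    have "ext_d (ext_d \<beta>) x (v # vs) = form_deriv v (ext_d \<beta>) x vs
        - ext_d (\<lambda>y. form_deriv v \<beta> y +\<^sub>f (-1) *\<^sub>f ext_d ?b y) x vs"
      by (simp add: ext_d_Cons[of "ext_d \<beta>"] insertion_ext_d)
    also have "\<dots> = ext_d (ext_d ?b) x vs"
      using e by (simp add: ext_d_add[OF d2 differentiable_form_scale[OF d3[OF sm]]]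
          ext_d_scale[OF d3[OF sm]] form_add_def) (simp add: form_scale_def)
    also have "\<dots> = 0\<^sub>f (v # vs)" using Cons.IH[OF sm] by (simp add: form_zero_def)
    finally show ?case .
  qed
qed

section \<open>Complex conjugation and reordering rules for products\<close>

lemma cnj_form_wedge: "cnj_form (\<alpha> \<and>\<^sub>f \<beta>) = cnj_form \<alpha> \<and>\<^sub>f cnj_form \<beta>"
proof
  show "cnj_form (\<alpha> \<and>\<^sub>f \<beta>) vs = (cnj_form \<alpha> \<and>\<^sub>f cnj_form \<beta>) vs" for vs
  proof (induction vs arbitrary: \<alpha> \<beta>)
    case Nil
    then show ?case by (simp add: cnj_form_def)
  next
    case (Cons v vs)
    have "cnj_form (insertion v \<gamma>) = insertion v (cnj_form \<gamma>)"
      "cnj_form (grading \<gamma>) = grading (cnj_form \<gamma>)" for \<gamma>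
      by (simp_all add: fun_eq_iff cnj_form_def insertion_def grading_def)
    moreover have "cnj_form (\<alpha> \<and>\<^sub>f \<beta>) (v # vs) =
        cnj_form (insertion v \<alpha> \<and>\<^sub>f \<beta>) vs + cnj_form (grading \<alpha> \<and>\<^sub>f insertion v \<beta>) vs"
      by (simp add: cnj_form_def wedge_Cons)
    ultimately show ?case by (simp add: wedge_Cons Cons.IH)
  qed
qed

lemma cnj_form_add: "cnj_form (\<alpha> +\<^sub>f \<beta>) = cnj_form \<alpha> +\<^sub>f cnj_form \<beta>"
  by (simp add: fun_eq_iff cnj_form_def form_add_def)

lemma cnj_form_scale: "cnj_form (k *\<^sub>f \<alpha>) = cnj k *\<^sub>f cnj_form \<alpha>"
  by (simp add: fun_eq_iff cnj_form_def form_scale_def)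

lemma cnj_form_cnj_form: "cnj_form (cnj_form \<alpha>) = \<alpha>"
  by (simp add: fun_eq_iff cnj_form_def)

lemma homogeneous_add: "homogeneous k \<alpha> \<Longrightarrow> homogeneous k \<beta> \<Longrightarrow> homogeneous k (\<alpha> +\<^sub>f \<beta>)"
  by (simp add: homogeneous_def form_add_def)

lemma homogeneous_scale: "homogeneous k \<alpha> \<Longrightarrow> homogeneous k (c *\<^sub>f \<alpha>)"
  by (simp add: homogeneous_def form_scale_def)

lemma homogeneous_cnj_form: "homogeneous k \<alpha> \<Longrightarrow> homogeneous k (cnj_form \<alpha>)"
  by (simp add: homogeneous_def cnj_form_def)

text \<open>Products are nested to the right, so two adjacent factors inside a longer product match
  only the version with a tail \<gamma>. The next two lemmas have two versions for the same
  reason.\<close>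

lemma wedge_anticommute:
  assumes "homogeneous 1 \<phi>" "homogeneous 1 \<psi>"
  shows "\<phi> \<and>\<^sub>f \<psi> = (-1) *\<^sub>f (\<psi> \<and>\<^sub>f \<phi>)" "\<phi> \<and>\<^sub>f \<psi> \<and>\<^sub>f \<gamma> = (-1) *\<^sub>f (\<psi> \<and>\<^sub>f \<phi> \<and>\<^sub>f \<gamma>)"
proof -
  show "\<phi> \<and>\<^sub>f \<psi> = (-1) *\<^sub>f (\<psi> \<and>\<^sub>f \<phi>)" using wedge_commute[OF assms] by simp
  then show "\<phi> \<and>\<^sub>f \<psi> \<and>\<^sub>f \<gamma> = (-1) *\<^sub>f (\<psi> \<and>\<^sub>f \<phi> \<and>\<^sub>f \<gamma>)"
    by (metis wedge_assoc wedge_scale_left)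
qed

lemma wedge_square_zero:
  assumes "homogeneous 1 \<phi>"
  shows "\<phi> \<and>\<^sub>f \<phi> = 0\<^sub>f" "\<phi> \<and>\<^sub>f \<phi> \<and>\<^sub>f \<gamma> = 0\<^sub>f"
proof -
  have "(\<phi> \<and>\<^sub>f \<phi>) vs = - (\<phi> \<and>\<^sub>f \<phi>) vs" for vs
    using fun_cong[OF wedge_anticommute(1)[OF assms assms], of vs] by (simp add: form_scale_def)
  then show "\<phi> \<and>\<^sub>f \<phi> = 0\<^sub>f" by (simp add: fun_eq_iff form_zero_def)
  then show "\<phi> \<and>\<^sub>f \<phi> \<and>\<^sub>f \<gamma> = 0\<^sub>f" by (metis wedge_assoc wedge_zero_left)
qed

lemma wedge_even_commute:
  assumes "homogeneous 2 \<alpha>" "homogeneous k \<beta>"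
  shows "\<beta> \<and>\<^sub>f \<alpha> = \<alpha> \<and>\<^sub>f \<beta>" "\<beta> \<and>\<^sub>f \<alpha> \<and>\<^sub>f \<gamma> = \<alpha> \<and>\<^sub>f \<beta> \<and>\<^sub>f \<gamma>"
proof -
  show "\<beta> \<and>\<^sub>f \<alpha> = \<alpha> \<and>\<^sub>f \<beta>"
    using wedge_commute[OF assms(2,1)] by (simp add: fun_eq_iff form_scale_def)
  then show "\<beta> \<and>\<^sub>f \<alpha> \<and>\<^sub>f \<gamma> = \<alpha> \<and>\<^sub>f \<beta> \<and>\<^sub>f \<gamma>" by (metis wedge_assoc)
qed

lemma form_scale_scale: "k *\<^sub>f l *\<^sub>f \<alpha> = (k * l) *\<^sub>f \<alpha>"
  by (simp add: fun_eq_iff form_scale_def)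

lemma form_scale_add: "k *\<^sub>f (\<alpha> +\<^sub>f \<beta>) = k *\<^sub>f \<alpha> +\<^sub>f k *\<^sub>f \<beta>"
  by (simp add: fun_eq_iff form_scale_def form_add_def algebra_simps)

lemma form_scale_zero: "k *\<^sub>f 0\<^sub>f = 0\<^sub>f" "\<alpha> +\<^sub>f 0\<^sub>f = \<alpha>" "0\<^sub>f +\<^sub>f \<alpha> = \<alpha>"
  by (simp_all add: fun_eq_iff form_scale_def form_zero_def form_add_def)

lemma form_scale_one: "1 *\<^sub>f \<alpha> = \<alpha>"
  by (simp add: fun_eq_iff form_scale_def)

lemma wedge_power_0_right: "\<alpha> \<and>\<^sub>f wedge_power \<beta> 0 = \<alpha>"
proof
  have h: "insertion v (wedge_power \<beta> 0) = 0\<^sub>f" for v :: 'a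
    by (simp add: fun_eq_iff insertion_def form_zero_def)
  show "(\<alpha> \<and>\<^sub>f wedge_power \<beta> 0) vs = \<alpha> vs" for vs
    by (induction vs arbitrary: \<alpha>)
      (simp_all add: wedge_Cons h wedge_zero_right form_zero_def insertion_def del: wedge_power.simps,
        simp)
qed

text \<open>Rewriting with these rules yields sums of scalar multiples of right-nested
  monomials.\<close>

lemmas wedge_expand = wedge_add_left wedge_add_right wedge_scale_left wedge_scale_right wedge_assoc
  wedge_zero_left wedge_zero_right form_scale_add form_scale_scale form_scale_zero

lemma wedge_power_2: "wedge_power \<omega> 2 = \<omega> \<and>\<^sub>f \<omega>"
  by (simp add: numeral_2_eq_2 wedge_power_0_right del: wedge_power.simps(1))

lemma wedge_power_3: "wedge_power \<omega> 3 = \<omega> \<and>\<^sub>f \<omega> \<and>\<^sub>f \<omega>"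
  by (simp add: numeral_3_eq_3 wedge_power_0_right del: wedge_power.simps(1))

section \<open>The flat model\<close>

definition one_form :: "('v \<Rightarrow> complex) \<Rightarrow> 'v mform" where
  "one_form \<phi> vs = (case vs of [u] \<Rightarrow> \<phi> u | _ \<Rightarrow> 0)"

lemma one_form_simps [simp]: "one_form \<phi> [] = 0" "one_form \<phi> [u] = \<phi> u" "one_form \<phi> (u # v # vs) = 0"
  by (simp_all add: one_form_def)

lemma homogeneous_one_form: "homogeneous 1 (one_form \<phi>)"
  by (auto simp: homogeneous_def one_form_def split: list.split)

text \<open>\<open>wedge_power 0\<^sub>f 0\<close> names the 0-form 1, the unit of the
  wedge.\<close>

lemma insertion_one_form: "insertion v (one_form \<phi>) = \<phi> v *\<^sub>f wedge_power 0\<^sub>f 0"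
proof
  show "insertion v (one_form \<phi>) vs = (\<phi> v *\<^sub>f wedge_power 0\<^sub>f 0) vs" for vs
    by (cases vs) (simp_all add: insertion_def form_scale_def)
qed

lemma wedge_power_0_left: "wedge_power \<beta> 0 \<and>\<^sub>f \<alpha> = \<alpha>"
proof
  have h: "insertion v (wedge_power \<beta> 0) = 0\<^sub>f" "grading (wedge_power \<beta> 0) = wedge_power \<beta> 0" for v :: 'a
    by (simp_all add: fun_eq_iff insertion_def form_zero_def grading_def)
  show "(wedge_power \<beta> 0 \<and>\<^sub>f \<alpha>) vs = \<alpha> vs" for vs
    by (induction vs arbitrary: \<alpha>)
      (simp_all add: wedge_Cons h wedge_zero_left form_zero_def insertion_def del: wedge_power.simps,
        simp)
qed

lemma one_form_wedge_Cons:
  "(one_form \<phi> \<and>\<^sub>f \<beta>) (v # vs) = \<phi> v * \<beta> vs - (one_form \<phi> \<and>\<^sub>f insertion v \<beta>) vs"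
  by (simp add: wedge_Cons insertion_one_form homogeneous_grading[OF homogeneous_one_form]
      wedge_scale_left wedge_power_0_left del: wedge_power.simps) (simp add: form_scale_def)

lemma insertion_one_form_wedge:
  "insertion v (one_form \<phi> \<and>\<^sub>f \<beta>) = \<phi> v *\<^sub>f \<beta> +\<^sub>f (-1) *\<^sub>f (one_form \<phi> \<and>\<^sub>f insertion v \<beta>)"
  by (rule ext) (simp add: insertion_def[of v "one_form \<phi> \<and>\<^sub>f \<beta>"] one_form_wedge_Cons form_add_def form_scale_def)

lemma one_form_wedge_2: "(one_form \<phi> \<and>\<^sub>f one_form \<psi>) [u, v] = \<phi> u * \<psi> v - \<phi> v * \<psi> u"
  by (simp add: one_form_wedge_Cons insertion_def)

lemma cnj_form_one_form: "cnj_form (one_form \<phi>) = one_form (\<lambda>v. cnj (\<phi> v))"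
  by (auto simp: fun_eq_iff cnj_form_def one_form_def split: list.split)

definition model_alpha3 :: "('v \<Rightarrow> complex) \<Rightarrow> ('v \<Rightarrow> complex) \<Rightarrow> 'v mform" where
  "model_alpha3 z0 z1 = (\<i> / 2) *\<^sub>f ((one_form z0 \<and>\<^sub>f cnj_form (one_form z0)) +\<^sub>f
     (one_form z1 \<and>\<^sub>f cnj_form (one_form z1)))"

text \<open>The conjugate comes first because \<open>z2\<close> is the conjugate of \<eta>: this is
  \<open>\<eta> \<and> cnj \<eta>\<close>.\<close>

definition model_theta :: "('v \<Rightarrow> complex) \<Rightarrow> 'v mform" where
  "model_theta z2 = cnj_form (one_form z2) \<and>\<^sub>f one_form z2"

definition model_omega :: "real \<Rightarrow> real \<Rightarrow> ('v \<Rightarrow> complex) \<Rightarrow> ('v \<Rightarrow> complex) \<Rightarrow> ('v \<Rightarrow> complex) \<Rightarrow> 'v mform" where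
  "model_omega a b z0 z1 z2 = of_real a *\<^sub>f model_alpha3 z0 z1 +\<^sub>f (- \<i> / 2 * of_real (b\<^sup>2)) *\<^sub>f model_theta z2"

definition model_Omega :: "complex \<Rightarrow> ('v \<Rightarrow> complex) \<Rightarrow> ('v \<Rightarrow> complex) \<Rightarrow> ('v \<Rightarrow> complex) \<Rightarrow> 'v mform" where
  "model_Omega c z0 z1 z2 = c *\<^sub>f (one_form z0 \<and>\<^sub>f one_form z1 \<and>\<^sub>f one_form z2)"

definition model_volume :: "('v \<Rightarrow> complex) \<Rightarrow> ('v \<Rightarrow> complex) \<Rightarrow> ('v \<Rightarrow> complex) \<Rightarrow> 'v mform" where
  "model_volume z0 z1 z2 = one_form z0 \<and>\<^sub>f one_form z1 \<and>\<^sub>f one_form z2 \<and>\<^sub>f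
     cnj_form (one_form z0) \<and>\<^sub>f cnj_form (one_form z1) \<and>\<^sub>f cnj_form (one_form z2)"

context
  fixes z0 z1 z2 :: "'v \<Rightarrow> complex"
begin

lemmas hom = homogeneous_one_form homogeneous_cnj_form[OF homogeneous_one_form]

text \<open>Monomials are sorted into the order \<open>z0, z1, z2, cnj z0, cnj z1, cnj z2\<close>,
  and squares are removed. Each swap is instantiated for one ordered pair, so rewriting terminates,
  and equations between forms become comparisons of coefficients.\<close>

lemmas normal_order =
  wedge_anticommute[OF hom(2)[of z0] hom(1)[of z0]] wedge_anticommute[OF hom(2)[of z0] hom(1)[of z1]]
  wedge_anticommute[OF hom(2)[of z0] hom(1)[of z2]] wedge_anticommute[OF hom(2)[of z1] hom(1)[of z0]]
  wedge_anticommute[OF hom(2)[of z1] hom(1)[of z1]] wedge_anticommute[OF hom(2)[of z1] hom(1)[of z2]]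
  wedge_anticommute[OF hom(2)[of z2] hom(1)[of z0]] wedge_anticommute[OF hom(2)[of z2] hom(1)[of z1]]
  wedge_anticommute[OF hom(2)[of z2] hom(1)[of z2]]
  wedge_anticommute[OF hom(1)[of z1] hom(1)[of z0]] wedge_anticommute[OF hom(1)[of z2] hom(1)[of z0]]
  wedge_anticommute[OF hom(1)[of z2] hom(1)[of z1]]
  wedge_anticommute[OF hom(2)[of z1] hom(2)[of z0]] wedge_anticommute[OF hom(2)[of z2] hom(2)[of z0]]
  wedge_anticommute[OF hom(2)[of z2] hom(2)[of z1]]
  wedge_square_zero[OF hom(1)] wedge_square_zero[OF hom(2)]

lemmas model_defs = model_alpha3_def model_theta_def model_omega_def model_Omega_def model_volume_def

lemma model_omega_Omega: "model_omega a b z0 z1 z2 \<and>\<^sub>f model_Omega c z0 z1 z2 = 0\<^sub>f"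
  by (simp only: model_defs wedge_expand normal_order)

lemma model_Omega_cnj:
  "model_Omega c z0 z1 z2 \<and>\<^sub>f cnj_form (model_Omega c z0 z1 z2) = of_real ((cmod c)\<^sup>2) *\<^sub>f model_volume z0 z1 z2"
  by (simp only: model_defs wedge_expand normal_order cnj_form_wedge cnj_form_scale complex_norm_square
      mult.commute[of c])

text \<open>The six orders of the three summands of \<omega> give
  \<open>6 * (\<i> / 2) ^ 3 * a\<^sup>2 * b\<^sup>2\<close>, and sorting the monomial contributes
  the sign \<open>- 1\<close>.\<close>

lemma model_omega_cubed: "wedge_power (model_omega a b z0 z1 z2) 3 =
    (3 / 4 * \<i> * of_real (a\<^sup>2 * b\<^sup>2)) *\<^sub>f model_volume z0 z1 z2"
  unfolding wedge_power_3
  apply (simp only: model_defs wedge_expand normal_order)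
  apply (simp add: fun_eq_iff form_add_def form_scale_def algebra_simps power2_eq_square)
  done

text \<open>Write \<open>\<theta>\<close> for \<open>model_theta z2\<close>. As \<open>z0 \<and> z1
  \<and> cnj z0 \<and> cnj z1 = 2 \<alpha>\<^sub>3 \<and> \<alpha>\<^sub>3\<close>, both sides equal
  \<open>3 a\<^sup>2 b\<^sup>2 k\<close> times \<open>\<alpha>\<^sub>3 \<and> \<alpha>\<^sub>3 -
  (\<i> / 2) \<alpha>\<^sub>3 \<and> \<theta>\<close>. The factor on the left keeps the identity
  polynomial in \<open>a\<close> and \<open>b\<close>; for \<open>k = 4 e / (3 a b)\<close> it
  becomes \<open>a b e = c\<close>.\<close>

lemma model_dOmega:
  fixes a b :: real and k :: complex
  defines "\<omega> \<equiv> model_omega a b z0 z1 z2"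
  shows "(3 / 4 * of_real (a\<^sup>2 * b\<^sup>2) * k) *\<^sub>f
      (2 *\<^sub>f (one_form z0 \<and>\<^sub>f one_form z1 \<and>\<^sub>f cnj_form (one_form z0) \<and>\<^sub>f cnj_form (one_form z1)) +\<^sub>f
       (- 2 * \<i>) *\<^sub>f (model_alpha3 z0 z1 \<and>\<^sub>f model_theta z2)) =
    (k * of_real (a + b\<^sup>2)) *\<^sub>f wedge_power \<omega> 2 +\<^sub>f
    (((k * of_real (2 * b\<^sup>2 - a)) *\<^sub>f (\<omega> +\<^sub>f (3 * \<i> * of_real (b\<^sup>2) / 2) *\<^sub>f model_theta z2)) \<and>\<^sub>f \<omega>)"
  unfolding wedge_power_2 \<omega>_def
  apply (simp only: model_defs wedge_expand normal_order)
  apply (simp add: fun_eq_iff form_add_def form_scale_def algebra_simps power2_eq_square)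
  done

text \<open>The added term turns \<omega> into
  \<open>a \<alpha>\<^sub>3 + \<i> b\<^sup>2 \<theta>\<close>. Its product with \<open>\<omega>
  \<and> \<omega> = a\<^sup>2 \<alpha>\<^sub>3 \<and> \<alpha>\<^sub>3 - \<i> a b\<^sup>2
  \<alpha>\<^sub>3 \<and> \<theta>\<close> vanishes for exactly this coefficient of \<theta>,
  because the cube of \<open>\<alpha>\<^sub>3\<close> is zero.\<close>

lemma model_W2_primitive:
  "(model_omega a b z0 z1 z2 +\<^sub>f (3 * \<i> * of_real (b\<^sup>2) / 2) *\<^sub>f model_theta z2) \<and>\<^sub>f
    wedge_power (model_omega a b z0 z1 z2) 2 = 0\<^sub>f"
  unfolding wedge_power_2
  apply (simp only: model_defs wedge_expand normal_order)
  apply (simp add: fun_eq_iff form_add_def form_scale_def form_zero_def algebra_simps power2_eq_square)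
  done

end

lemma model_alpha3_eval: "model_alpha3 z0 z1 [u, v] =
    of_real (Im (cnj (z0 u) * z0 v) + Im (cnj (z1 u) * z1 v))"
  by (simp add: model_alpha3_def form_add_def form_scale_def one_form_wedge_2 cnj_form_one_form
      complex_eq_iff field_simps)

lemma model_theta_eval: "model_theta z2 [u, v] = of_real (Im (cnj (z2 u) * z2 v)) * (2 * \<i>)"
  by (simp add: model_theta_def one_form_wedge_2 cnj_form_one_form complex_eq_iff algebra_simps)

lemma model_omega_eval: "model_omega a b z0 z1 z2 [u, v] =
    of_real (a * Im (cnj (z0 u) * z0 v) + a * Im (cnj (z1 u) * z1 v) + b\<^sup>2 * Im (cnj (z2 u) * z2 v))"
  by (simp add: model_omega_def form_add_def form_scale_def model_alpha3_eval model_theta_eval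
      complex_eq_iff algebra_simps)

lemma model_Omega_eval: "model_Omega c z0 z1 z2 [u, v, w] =
    c * (z0 u * (z1 v * z2 w - z1 w * z2 v) - z0 v * (z1 u * z2 w - z1 w * z2 u)
       + z0 w * (z1 u * z2 v - z1 v * z2 u))"
  by (simp add: model_Omega_def form_scale_def one_form_wedge_Cons insertion_one_form_wedge insertion_def
      form_add_def one_form_wedge_2 algebra_simps)

lemma homogeneous_model:
  shows homogeneous_model_alpha3: "homogeneous 2 (model_alpha3 z0 z1)"
    and homogeneous_model_theta: "homogeneous 2 (model_theta z2)"
    and homogeneous_model_omega: "homogeneous 2 (model_omega a b z0 z1 z2)"
    and homogeneous_model_Omega: "homogeneous 3 (model_Omega c z0 z1 z2)"
proof -
  note h = homogeneous_one_form homogeneous_cnj_form[OF homogeneous_one_form]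
  have w: "homogeneous 1 \<alpha> \<Longrightarrow> homogeneous 1 \<beta> \<Longrightarrow> homogeneous 2 (\<alpha> \<and>\<^sub>f \<beta>)"
    "homogeneous 1 \<alpha> \<Longrightarrow> homogeneous 2 \<beta> \<Longrightarrow> homogeneous 3 (\<alpha> \<and>\<^sub>f \<beta>)" for \<alpha> \<beta> :: "'a mform"
    using homogeneous_wedge[of 1 \<alpha> 1 \<beta>] homogeneous_wedge[of 1 \<alpha> 2 \<beta>] by (simp_all add: numeral_2_eq_2 numeral_3_eq_3)
  show 1: "homogeneous 2 (model_alpha3 z0 z1)" "homogeneous 2 (model_theta z2)"
    unfolding model_alpha3_def model_theta_def by (intro homogeneous_add homogeneous_scale w h)+
  then show "homogeneous 2 (model_omega a b z0 z1 z2)"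
    unfolding model_omega_def by (intro homogeneous_add homogeneous_scale)
  show "homogeneous 3 (model_Omega c z0 z1 z2)"
    unfolding model_Omega_def by (intro homogeneous_scale w h)
qed

section \<open>Smooth forms and the structure equations\<close>

text \<open>The smoothness half of \<open>form_on\<close>, which passes through sums, products and
  \<open>d\<close> independently of alternation.\<close>

definition smooth_form :: "'v::euclidean_space set \<Rightarrow> 'v dform \<Rightarrow> bool" where
  "smooth_form U \<beta> \<longleftrightarrow> (\<forall>vs. smooth_on U (\<lambda>x. \<beta> x vs))"

lemma smooth_form_differentiable: "smooth_form U \<beta> \<Longrightarrow> x \<in> U \<Longrightarrow> differentiable_form \<beta> x"
  by (auto simp: smooth_form_def differentiable_form_def intro: smooth_on_differentiable)

lemma smooth_form_add: "open U \<Longrightarrow> smooth_form U \<alpha> \<Longrightarrow> smooth_form U \<beta> \<Longrightarrow> smooth_form U (\<lambda>x. \<alpha> x +\<^sub>f \<beta> x)"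
  by (simp add: smooth_form_def form_add_def smooth_on_add)

lemma smooth_form_scale: "open U \<Longrightarrow> smooth_form U \<beta> \<Longrightarrow> smooth_form U (\<lambda>x. k *\<^sub>f \<beta> x)"
  by (simp add: smooth_form_def form_scale_def smooth_on_mult smooth_on_const)

lemma smooth_form_insertion: "smooth_form U \<beta> \<Longrightarrow> smooth_form U (\<lambda>x. insertion v (\<beta> x))"
  by (simp add: smooth_form_def insertion_def)

lemma smooth_form_grading: "open U \<Longrightarrow> smooth_form U \<beta> \<Longrightarrow> smooth_form U (\<lambda>x. grading (\<beta> x))"
  by (simp add: smooth_form_def grading_def smooth_on_mult smooth_on_const)

lemma smooth_form_wedge:
  assumes "open U" "smooth_form U \<alpha>" "smooth_form U \<beta>"
  shows "smooth_form U (\<lambda>x. \<alpha> x \<and>\<^sub>f \<beta> x)"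
proof -
  have "smooth_on U (\<lambda>x. (\<alpha> x \<and>\<^sub>f \<beta> x) vs)" for vs
    using assms(2,3)
  proof (induction vs arbitrary: \<alpha> \<beta>)
    case Nil
    then show ?case by (simp add: smooth_form_def smooth_on_mult[OF assms(1)])
  next
    case (Cons v vs)
    then show ?case
      by (simp add: wedge_Cons smooth_on_add[OF assms(1)] smooth_form_insertion smooth_form_grading[OF assms(1)])
  qed
  then show ?thesis by (simp add: smooth_form_def)
qed

lemma smooth_form_cnj: "open U \<Longrightarrow> smooth_form U \<beta> \<Longrightarrow> smooth_form U (\<lambda>x. cnj_form (\<beta> x))"
  by (simp add: smooth_form_def cnj_form_def smooth_on_bounded_linear[OF _ bounded_linear_cnj])

lemma smooth_form_ext_d: "open U \<Longrightarrow> smooth_form U \<beta> \<Longrightarrow> smooth_form U (ext_d \<beta>)"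
  unfolding smooth_form_def ext_d_def
  by (intro allI smooth_on_sum smooth_on_mult smooth_on_const smooth_on_frechet) auto

lemma form_onI: "(\<And>x. x \<in> U \<Longrightarrow> alternating_form k (\<beta> x)) \<Longrightarrow> smooth_form U \<beta> \<Longrightarrow> form_on U k \<beta>"
  by (simp add: form_on_def smooth_form_def)

lemma form_on_smooth_form: "form_on U k \<beta> \<Longrightarrow> smooth_form U \<beta>"
  by (simp add: form_on_def smooth_form_def)

lemma homogeneous_eqI2:
  assumes "homogeneous 2 \<alpha>" "homogeneous 2 \<beta>" "\<And>u v. \<alpha> [u, v] = \<beta> [u, v]" shows "\<alpha> = \<beta>"
proof
  fix vs show "\<alpha> vs = \<beta> vs"
  proof (cases "length vs = 2")
    case True
    then obtain u v where "vs = [u, v]" by (auto simp: length_Suc_conv numeral_2_eq_2)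
    then show ?thesis using assms(3) by simp
  qed (use assms in \<open>simp add: homogeneous_def\<close>)
qed

lemma alternating_form_1I:
  assumes "homogeneous 1 \<gamma>" "linear (\<lambda>u. \<gamma> [u])" shows "alternating_form 1 \<gamma>"
  unfolding alternating_form_def
proof (intro conjI allI impI)
  fix vs :: "'a list" and i :: nat assume "length vs = 1 \<and> i < 1"
  then show "linear (\<lambda>v. \<gamma> (vs[i := v]))"
    using assms(2) by (auto simp: length_Suc_conv)
qed (use assms(1) in \<open>auto simp: homogeneous_def\<close>)

lemma alternating_form_2I:
  assumes "homogeneous 2 \<gamma>" "\<And>v. linear (\<lambda>u. \<gamma> [u, v])" "\<And>u v. \<gamma> [u, v] = - \<gamma> [v, u]"
  shows "alternating_form 2 \<gamma>"
  unfolding alternating_form_def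
proof (intro conjI allI impI)
  have l2: "linear (\<lambda>v. \<gamma> [u, v])" for u
    using linear_compose_neg[OF assms(2)[of u]] assms(3)[of u] by simp
  show "linear (\<lambda>v. \<gamma> (vs[i := v]))" if "length vs = 2 \<and> i < 2" for vs i
    using that assms(2) l2 by (auto simp: length_Suc_conv numeral_2_eq_2 less_Suc_eq)
  show "\<gamma> vs = 0" if "length vs = 2 \<and> i < j \<and> j < 2 \<and> vs ! i = vs ! j" for vs i j
    using that assms(3)[of "vs ! 0" "vs ! 0"]
    by (auto simp: length_Suc_conv numeral_2_eq_2 less_Suc_eq)
qed (use assms(1) in \<open>auto simp: homogeneous_def\<close>)

lemma alternating_form_3I:
  assumes "homogeneous 3 \<gamma>" "\<And>v w. linear (\<lambda>u. \<gamma> [u, v, w])"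
    "\<And>u v w. \<gamma> [u, v, w] = - \<gamma> [v, u, w]" "\<And>u v w. \<gamma> [u, v, w] = - \<gamma> [u, w, v]"
  shows "alternating_form 3 \<gamma>"
  unfolding alternating_form_def
proof (intro conjI allI impI)
  have l2: "linear (\<lambda>v. \<gamma> [u, v, w])" for u w
    using linear_compose_neg[OF assms(2)[of u w]] assms(3)[of u _ w] by simp
  have l3: "linear (\<lambda>w. \<gamma> [u, v, w])" for u v
    using linear_compose_neg[OF l2[of u v]] assms(4)[of u v] by simp
  show "linear (\<lambda>v. \<gamma> (vs[i := v]))" if "length vs = 3 \<and> i < 3" for vs i
    using that assms(2) l2 l3 by (auto simp: length_Suc_conv numeral_3_eq_3 less_Suc_eq)
  have z: "\<gamma> [u, u, w] = 0" "\<gamma> [u, w, w] = 0" for u w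
    using assms(3)[of u u w] assms(4)[of u w w] by auto
  then have "\<gamma> [u, w, u] = 0" for u w
    using assms(4)[of u w u] by simp
  with z show "\<gamma> vs = 0" if "length vs = 3 \<and> i < j \<and> j < 3 \<and> vs ! i = vs ! j" for vs i j
    using that by (auto simp: length_Suc_conv numeral_3_eq_3 less_Suc_eq)
qed (use assms(1) in \<open>auto simp: homogeneous_def\<close>)

lemma form_on_ext_d_1:
  assumes U: "open U" and \<beta>: "form_on U 1 \<beta>"
  shows "form_on U 2 (ext_d \<beta>)"
proof (rule form_onI)
  fix x assume x: "x \<in> U"
  show "alternating_form 2 (ext_d \<beta> x)"
  proof (rule alternating_form_2I)
    show "homogeneous 2 (ext_d \<beta> x)"
      using homogeneous_ext_d[OF U x alternating_form_homogeneous[OF form_on_alternating[OF \<beta>]]]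
      by (simp add: numeral_2_eq_2)
    have "linear (\<lambda>u. dd (\<lambda>y. \<beta> y [v]) x u)" for v
      by (rule linear_frechet_derivative[OF form_on_differentiable[OF \<beta> x]])
    moreover have "linear (\<lambda>u. dd (\<lambda>y. \<beta> y [u]) x v)" for v
      using linear_form_deriv[OF U x \<beta>, of "[]" "[]" v] by (simp add: form_deriv_def)
    ultimately show "linear (\<lambda>u. ext_d \<beta> x [u, v])" for v
      by (simp add: ext_d_one_form linear_compose_sub)
    show "ext_d \<beta> x [u, v] = - ext_d \<beta> x [v, u]" for u v
      by (simp add: ext_d_one_form)
  qed
qed (rule smooth_form_ext_d[OF U form_on_smooth_form[OF \<beta>]])

lemma alternating_model:
  assumes z: "linear z0" "linear z1" "linear z2"
  shows alternating_model_omega: "alternating_form 2 (model_omega a b z0 z1 z2)"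
    and alternating_model_Omega: "alternating_form 3 (model_Omega c z0 z1 z2)"
proof -
  note l = linear_add[OF z(1)] linear_add[OF z(2)] linear_add[OF z(3)]
    linear_cmul[OF z(1)] linear_cmul[OF z(2)] linear_cmul[OF z(3)]
  show "alternating_form 2 (model_omega a b z0 z1 z2)"
    by (rule alternating_form_2I[OF homogeneous_model_omega])
      (auto intro!: linearI simp: model_omega_eval l complex_eq_iff algebra_simps)
  show "alternating_form 3 (model_Omega c z0 z1 z2)"
    by (rule alternating_form_3I[OF homogeneous_model_Omega])
      (auto intro!: linearI simp: model_Omega_eval l scaleR_conv_of_real algebra_simps)
qed

text \<open>The structure equation \<open>d\<alpha>\<^sub>1 = - 2 \<alpha>\<^sub>2 \<and> \<eta>\<^sub>3 + 2 \<alpha>\<^sub>3 \<and> \<eta>\<^sub>2\<close> and its cyclic permutations; it uses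
  nothing about \<open>\<eta>\<^sub>i\<close> except the definition of \<open>\<alpha>\<^sub>i\<close>.\<close>
lemma ext_d_alpha:
  fixes Ei Ej Ek :: "'v::euclidean_space dform"
  defines "A \<equiv> \<lambda>F G H y. (1 / 2) *\<^sub>f (ext_d F y +\<^sub>f (-2) *\<^sub>f (G y \<and>\<^sub>f H y))"
  assumes U: "open U" "x \<in> U" and sm: "smooth_form U Ei" "smooth_form U Ej" "smooth_form U Ek"
    and hom: "homogeneous 1 (Ei x)" "homogeneous 1 (Ej x)" "homogeneous 1 (Ek x)"
    and homd: "homogeneous 2 (ext_d Ei x)" "homogeneous 2 (ext_d Ej x)" "homogeneous 2 (ext_d Ek x)"
  shows "ext_d (A Ei Ej Ek) x =
    (-2) *\<^sub>f (A Ej Ek Ei x \<and>\<^sub>f Ek x) +\<^sub>f 2 *\<^sub>f (A Ek Ei Ej x \<and>\<^sub>f Ej x)"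
proof -
  note d = sm[THEN smooth_form_differentiable, OF U(2)]
  have dd: "differentiable_form (ext_d Ei) x" "differentiable_form (\<lambda>y. Ej y \<and>\<^sub>f Ek y) x"
    by (rule smooth_form_differentiable[OF smooth_form_ext_d[OF U(1) sm(1)] U(2)],
        rule differentiable_form_wedge[OF d(2,3)])
  have "ext_d (A Ei Ej Ek) x = (1 / 2) *\<^sub>f (ext_d (ext_d Ei) x +\<^sub>f (-2) *\<^sub>f ext_d (\<lambda>y. Ej y \<and>\<^sub>f Ek y) x)"
    unfolding A_def
    by (simp add: ext_d_scale ext_d_add differentiable_form_add differentiable_form_scale dd)
  also have "ext_d (ext_d Ei) x = 0\<^sub>f"
    using sm(1) by (intro ext_d_ext_d[OF U]) (simp add: smooth_form_def)
  also have "ext_d (\<lambda>y. Ej y \<and>\<^sub>f Ek y) x = (ext_d Ej x \<and>\<^sub>f Ek x) +\<^sub>f (-1) *\<^sub>f (Ej x \<and>\<^sub>f ext_d Ek x)"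
    using ext_d_wedge[OF d(2,3)] homogeneous_grading[OF hom(2)] by (simp add: wedge_scale_left)
  finally have "ext_d (A Ei Ej Ek) x = (-1) *\<^sub>f (ext_d Ej x \<and>\<^sub>f Ek x) +\<^sub>f (ext_d Ek x \<and>\<^sub>f Ej x)"
    by (simp add: wedge_even_commute(1)[OF homd(3) hom(2)] form_scale_add form_scale_scale form_scale_zero
        form_scale_one)
  \<comment> \<open>The quadratic parts of \<open>A Ej Ek Ei\<close> and \<open>A Ek Ei Ej\<close>
    drop out, as multiplication by \<open>Ek\<close> and \<open>Ej\<close> repeats a factor.\<close>
  moreover have "(-2) *\<^sub>f (A Ej Ek Ei x \<and>\<^sub>f Ek x) +\<^sub>f 2 *\<^sub>f (A Ek Ei Ej x \<and>\<^sub>f Ej x) =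
      (-1) *\<^sub>f (ext_d Ej x \<and>\<^sub>f Ek x) +\<^sub>f (ext_d Ek x \<and>\<^sub>f Ej x)"
    unfolding A_def
    apply (simp only: wedge_expand wedge_anticommute[OF hom(3) hom(1)] wedge_anticommute[OF hom(3) hom(2)]
        wedge_anticommute[OF hom(2) hom(1)] wedge_square_zero[OF hom(1)] wedge_square_zero[OF hom(2)]
        wedge_square_zero[OF hom(3)])
    apply (simp add: fun_eq_iff form_add_def form_scale_def)
    done
  ultimately show ?thesis by simp
qed

text \<open>With \<open>dE1 = 2 A1 + 2 E2 \<and> E3\<close> and its analogue for \<open>E2\<close>,
  both \<open>A3\<close> and \<open>- E1 \<and> E2\<close> have the derivative
  \<open>2 (A2 \<and> E1 - A1 \<and> E2)\<close>, hence the factor \<open>a + b\<^sup>2\<close>. For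
  \<Omega> the two factors contribute \<open>2 \<i> \<alpha> \<and> E3 \<and> cnj \<eta>\<close> and
  \<open>2 \<i> \<alpha> \<and> cnj \<eta> \<and> E3\<close>, which cancel, so that
  \<open>E3\<close> disappears from the result.\<close>

lemma ext_d_omega_Omega:
  fixes E1 E2 E3 :: "'v::euclidean_space dform" and a b :: real
  defines "A \<equiv> \<lambda>F G H y. (1 / 2) *\<^sub>f (ext_d F y +\<^sub>f (-2) *\<^sub>f (G y \<and>\<^sub>f H y))"
  defines "A1 \<equiv> A E1 E2 E3" and "A2 \<equiv> A E2 E3 E1" and "A3 \<equiv> A E3 E1 E2"
  assumes U: "open U" "x \<in> U" and sm: "smooth_form U E1" "smooth_form U E2" "smooth_form U E3"
    and hom: "homogeneous 1 (E1 x)" "homogeneous 1 (E2 x)" "homogeneous 1 (E3 x)"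
    and homd: "homogeneous 2 (ext_d E1 x)" "homogeneous 2 (ext_d E2 x)" "homogeneous 2 (ext_d E3 x)"
  shows ext_d_omega: "ext_d (\<lambda>y. of_real a *\<^sub>f A3 y +\<^sub>f (- of_real (b\<^sup>2)) *\<^sub>f (E1 y \<and>\<^sub>f E2 y)) x =
      of_real (2 * (a + b\<^sup>2)) *\<^sub>f ((A2 x \<and>\<^sub>f E1 x) +\<^sub>f (-1) *\<^sub>f (A1 x \<and>\<^sub>f E2 x))"
    and ext_d_Omega: "ext_d (\<lambda>y. (A1 y +\<^sub>f \<i> *\<^sub>f A2 y) \<and>\<^sub>f (E1 y +\<^sub>f (- \<i>) *\<^sub>f E2 y)) x =
      2 *\<^sub>f ((A1 x +\<^sub>f \<i> *\<^sub>f A2 x) \<and>\<^sub>f (A1 x +\<^sub>f (- \<i>) *\<^sub>f A2 x)) +\<^sub>f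
      (- 2 * \<i>) *\<^sub>f (A3 x \<and>\<^sub>f (E1 x +\<^sub>f \<i> *\<^sub>f E2 x) \<and>\<^sub>f (E1 x +\<^sub>f (- \<i>) *\<^sub>f E2 x))"
proof -
  note d = sm[THEN smooth_form_differentiable, OF U(2)]
  have smA: "smooth_form U (A F G H)" if "smooth_form U F" "smooth_form U G" "smooth_form U H" for F G H
    unfolding A_def using that
    by (intro smooth_form_scale smooth_form_add smooth_form_ext_d smooth_form_wedge U(1))
  have dA: "differentiable_form A1 x" "differentiable_form A2 x" "differentiable_form A3 x"
    unfolding A1_def A2_def A3_def by (intro smooth_form_differentiable[OF smA U(2)] sm)+
  have homA: "homogeneous 2 (A F G H x)"
    if "homogeneous 2 (ext_d F x)" "homogeneous 1 (G x)" "homogeneous 1 (H x)" for F G H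
    unfolding A_def using homogeneous_wedge[OF that(2,3)]
    by (intro homogeneous_scale homogeneous_add that(1)) (simp add: numeral_2_eq_2)
  have hA: "homogeneous 2 (A1 x)" "homogeneous 2 (A2 x)" "homogeneous 2 (A3 x)"
    unfolding A1_def A2_def A3_def by (intro homA hom homd)+
  have e: "ext_d A1 x = (-2) *\<^sub>f (A2 x \<and>\<^sub>f E3 x) +\<^sub>f 2 *\<^sub>f (A3 x \<and>\<^sub>f E2 x)"
    "ext_d A2 x = (-2) *\<^sub>f (A3 x \<and>\<^sub>f E1 x) +\<^sub>f 2 *\<^sub>f (A1 x \<and>\<^sub>f E3 x)"
    "ext_d A3 x = (-2) *\<^sub>f (A1 x \<and>\<^sub>f E2 x) +\<^sub>f 2 *\<^sub>f (A2 x \<and>\<^sub>f E1 x)"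
    unfolding A1_def A2_def A3_def A_def by (intro ext_d_alpha[OF U] sm hom homd)+
  have AE: "ext_d F x = 2 *\<^sub>f A F G H x +\<^sub>f 2 *\<^sub>f (G x \<and>\<^sub>f H x)" for F G H
    by (simp add: A_def fun_eq_iff form_add_def form_scale_def field_simps)
  note dE = AE[of E1 E2 E3, folded A1_def] AE[of E2 E3 E1, folded A2_def]
  note comm = wedge_even_commute[OF hA(1) hom(1)] wedge_even_commute[OF hA(1) hom(2)]
    wedge_even_commute[OF hA(1) hom(3)] wedge_even_commute[OF hA(2) hom(1)] wedge_even_commute[OF hA(2) hom(2)]
    wedge_even_commute[OF hA(2) hom(3)] wedge_even_commute[OF hA(3) hom(1)] wedge_even_commute[OF hA(3) hom(2)]
    wedge_even_commute[OF hA(3) hom(3)] wedge_even_commute[OF hA(1) hA(2)]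
    wedge_anticommute[OF hom(3) hom(1)] wedge_anticommute[OF hom(3) hom(2)]
    wedge_anticommute[OF hom(2) hom(1)] wedge_square_zero[OF hom(1)] wedge_square_zero[OF hom(2)]
    wedge_square_zero[OF hom(3)]
  have g: "grading (E1 x) = (-1) *\<^sub>f E1 x" "grading (A1 x +\<^sub>f \<i> *\<^sub>f A2 x) = A1 x +\<^sub>f \<i> *\<^sub>f A2 x"
    using homogeneous_grading[OF hom(1)] homogeneous_grading[OF hA(1)] homogeneous_grading[OF hA(2)]
    by (simp_all add: grading_add grading_scale form_scale_one)
  have "ext_d (\<lambda>y. of_real a *\<^sub>f A3 y +\<^sub>f (- of_real (b\<^sup>2)) *\<^sub>f (E1 y \<and>\<^sub>f E2 y)) x =
      of_real a *\<^sub>f ext_d A3 x +\<^sub>f (- of_real (b\<^sup>2)) *\<^sub>f ((ext_d E1 x \<and>\<^sub>f E2 x) +\<^sub>f (-1) *\<^sub>f (E1 x \<and>\<^sub>f ext_d E2 x))"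
    by (simp add: ext_d_add ext_d_scale ext_d_wedge differentiable_form_scale differentiable_form_wedge d dA g
        wedge_scale_left del: of_real_power)
  also have "\<dots> = of_real (2 * (a + b\<^sup>2)) *\<^sub>f ((A2 x \<and>\<^sub>f E1 x) +\<^sub>f (-1) *\<^sub>f (A1 x \<and>\<^sub>f E2 x))"
    unfolding e dE
    apply (simp only: wedge_expand comm)
    apply (simp add: fun_eq_iff form_add_def form_scale_def algebra_simps)
    done
  finally show "ext_d (\<lambda>y. of_real a *\<^sub>f A3 y +\<^sub>f (- of_real (b\<^sup>2)) *\<^sub>f (E1 y \<and>\<^sub>f E2 y)) x =
      of_real (2 * (a + b\<^sup>2)) *\<^sub>f ((A2 x \<and>\<^sub>f E1 x) +\<^sub>f (-1) *\<^sub>f (A1 x \<and>\<^sub>f E2 x))" .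
  have "ext_d (\<lambda>y. (A1 y +\<^sub>f \<i> *\<^sub>f A2 y) \<and>\<^sub>f (E1 y +\<^sub>f (- \<i>) *\<^sub>f E2 y)) x =
      ((ext_d A1 x +\<^sub>f \<i> *\<^sub>f ext_d A2 x) \<and>\<^sub>f (E1 x +\<^sub>f (- \<i>) *\<^sub>f E2 x)) +\<^sub>f
      ((A1 x +\<^sub>f \<i> *\<^sub>f A2 x) \<and>\<^sub>f (ext_d E1 x +\<^sub>f (- \<i>) *\<^sub>f ext_d E2 x))"
    by (simp add: ext_d_add ext_d_scale ext_d_wedge differentiable_form_scale differentiable_form_add d dA g)
  also have "\<dots> = 2 *\<^sub>f ((A1 x +\<^sub>f \<i> *\<^sub>f A2 x) \<and>\<^sub>f (A1 x +\<^sub>f (- \<i>) *\<^sub>f A2 x)) +\<^sub>f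
      (- 2 * \<i>) *\<^sub>f (A3 x \<and>\<^sub>f (E1 x +\<^sub>f \<i> *\<^sub>f E2 x) \<and>\<^sub>f (E1 x +\<^sub>f (- \<i>) *\<^sub>f E2 x))"
    unfolding e dE
    apply (simp only: wedge_expand comm)
    apply (simp add: fun_eq_iff form_add_def form_scale_def algebra_simps)
    done
  finally show "ext_d (\<lambda>y. (A1 y +\<^sub>f \<i> *\<^sub>f A2 y) \<and>\<^sub>f (E1 y +\<^sub>f (- \<i>) *\<^sub>f E2 y)) x =
      2 *\<^sub>f ((A1 x +\<^sub>f \<i> *\<^sub>f A2 x) \<and>\<^sub>f (A1 x +\<^sub>f (- \<i>) *\<^sub>f A2 x)) +\<^sub>f
      (- 2 * \<i>) *\<^sub>f (A3 x \<and>\<^sub>f (E1 x +\<^sub>f \<i> *\<^sub>f E2 x) \<and>\<^sub>f (E1 x +\<^sub>f (- \<i>) *\<^sub>f E2 x))" .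
qed

section \<open>Adapted coframes of a 3-Sasakian structure\<close>

text \<open>Pairing with \<open>G\<close> recovers the coefficients of any combination of the
  vectors, so they are independent, and by their number they span.\<close>

lemma orthonormal_list_expansion:
  fixes G :: "'v::euclidean_space \<Rightarrow> 'v \<Rightarrow> real"
  assumes G: "bilinear G" and len: "length xs = DIM('v)"
    and on: "\<And>i j. i < length xs \<Longrightarrow> j < length xs \<Longrightarrow> G (xs ! i) (xs ! j) = (if i = j then 1 else 0)"
  shows "u = (\<Sum>i<length xs. G (xs ! i) u *\<^sub>R xs ! i)"
proof -
  have lin: "linear (G v)" for v using G by (simp add: bilinear_def)
  have dist: "distinct xs"
    unfolding distinct_conv_nth using on by (metis zero_neq_one)
  have on': "G v w = (if v = w then 1 else 0)" if vw: "v \<in> set xs" "w \<in> set xs" for v w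
  proof -
    obtain i j where "i < length xs" "v = xs ! i" "j < length xs" "w = xs ! j"
      using vw by (metis in_set_conv_nth)
    then show ?thesis using on[of i j] dist by (simp add: nth_eq_iff_index_eq)
  qed
  have coef: "G b (\<Sum>v\<in>set xs. k v *\<^sub>R v) = k b" if "b \<in> set xs" for b k
  proof -
    have "G b (\<Sum>v\<in>set xs. k v *\<^sub>R v) = (\<Sum>v\<in>set xs. k v * G b v)"
      by (simp add: linear_sum[OF lin] linear_cmul[OF lin])
    also have "\<dots> = (\<Sum>v\<in>set xs. if v = b then k v else 0)"
      using on' that by (intro sum.cong) auto
    finally show ?thesis using that by simp
  qed
  have ind: "independent (set xs)"
  proof
    assume "dependent (set xs)"
    then obtain k v where k: "(\<Sum>v\<in>set xs. k v *\<^sub>R v) = 0" "v \<in> set xs" "k v \<noteq> 0"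
      by (auto simp: dependent_finite)
    then show False using coef[of v k] linear_0[OF lin] by simp
  qed
  have "card (set xs) = DIM('v)" using dist len by (simp add: distinct_card)
  then have "span (set xs) = UNIV"
    using card_ge_dim_independent[OF _ ind, of UNIV] by auto
  then have "u \<in> span (set xs)" by simp
  then obtain k where k: "u = (\<Sum>v\<in>set xs. k v *\<^sub>R v)"
    by (auto simp: span_finite)
  have "u = (\<Sum>v\<in>set xs. G v u *\<^sub>R v)"
    by (subst k, rule sum.cong[OF refl]) (simp add: coef[of _ k, folded k])
  also have "\<dots> = (\<Sum>i<length xs. G (xs ! i) u *\<^sub>R xs ! i)"
    using bij_betw_nth[OF dist refl refl] by (simp add: sum.reindex_bij_betw[symmetric])
  finally show ?thesis .
qed

lemma three_sasakian_onD:
  assumes "three_sasakian_on U g \<xi> \<eta> \<Phi>"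
  shows "riemannian_on U g" "\<And>i. i \<in> {1..3} \<Longrightarrow> smooth_on U (\<xi> i)"
    "\<And>x i. x \<in> U \<Longrightarrow> i \<in> {1..3} \<Longrightarrow> \<eta> i x = form1 (\<lambda>u. g x (\<xi> i x) u)"
    "\<exists>J. hyperkaehler_on (U \<times> {0<..}) (cone_metric g) J \<and>
       (\<forall>x\<in>U. \<forall>r>0. \<forall>i\<in>{1..3}. J i (x, r) (0, r) = (\<xi> i x, 0)) \<and>
       (\<forall>p\<in>U \<times> {0<..}. \<forall>i\<in>{1..3}. \<forall>vs. fundamental_form (cone_metric g) (J i) p vs =
          ext_d (\<lambda>q us. of_real ((snd q)\<^sup>2) * \<eta> i (fst q) (map fst us)) p vs / 2)"
    "\<And>x i j. x \<in> U \<Longrightarrow> i \<in> {1..3} \<Longrightarrow> j \<in> {1..3} \<Longrightarrow> \<eta> i x [\<xi> j x] = of_real (delta i j)"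
    "\<And>x i vs. x \<in> U \<Longrightarrow> i \<in> {1..3} \<Longrightarrow> contraction (\<xi> i) (ext_d (\<eta> i)) x vs = 0"
  using assms unfolding three_sasakian_on_def by blast+

text \<open>\<open>d(r\<^sup>2 \<beta>) = 2 r dr \<and> \<beta> + r\<^sup>2 d\<beta>\<close>, and
  the first term vanishes on vectors tangent to the slice \<open>r = 1\<close>.\<close>

lemma ext_d_cone:
  fixes \<beta> :: "'v::euclidean_space dform"
  assumes "\<And>w. (\<lambda>y. \<beta> y [w]) differentiable (at x)"
  shows "ext_d (\<lambda>q us. of_real ((snd q)\<^sup>2) * \<beta> (fst q) (map fst us)) (x, 1) [(u, 0), (v, 0)] = ext_d \<beta> x [u, v]"
proof -
  have "dd (\<lambda>q. complex_of_real ((snd q)\<^sup>2) * \<beta> (fst q) [w]) (x, 1) (u, 0) = dd (\<lambda>y. \<beta> y [w]) x u" for u w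
  proof -
    have 1: "((\<lambda>q::'v \<times> real. \<beta> (fst q) [w]) has_derivative (\<lambda>h. dd (\<lambda>y. \<beta> y [w]) x (fst h))) (at (x, 1))"
      by (rule has_derivative_compose[OF has_derivative_fst[OF has_derivative_ident]])
        (simp add: has_derivative_dd assms)
    have 2: "((\<lambda>q::'v \<times> real. complex_of_real ((snd q)\<^sup>2)) has_derivative (\<lambda>h. of_real (2 * snd h))) (at (x, 1))"
      by (intro has_derivative_of_real) (auto intro!: derivative_eq_intros)
    show ?thesis using dd_eqI[OF has_derivative_mult[OF 2 1]] by simp
  qed
  then show ?thesis by (simp add: ext_d_one_form)
qed

text \<open>At \<open>r = 1\<close> the tangent space of the cone splits into that of
  \<open>S\<close> and the radial line, and \<open>J i\<close> maps \<open>(u, s)\<close> to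
  \<open>(A i u + s \<xi>\<^sub>i, - g(\<xi>\<^sub>i, u))\<close>. The radial component produces the
  term \<open>g(\<xi>\<^sub>j, u) \<xi>\<^sub>i\<close> in \<open>A i (A j u)\<close>. Skewness of
  \<open>A i\<close> holds because \<open>J i\<close> is orthogonal with square
  \<open>- 1\<close>.\<close>

lemma three_sasakian_endomorphisms:
  fixes \<xi> :: "nat \<Rightarrow> 'v::euclidean_space \<Rightarrow> 'v"
  assumes S: "three_sasakian_on U g \<xi> \<eta> \<Phi>" and x: "x \<in> U"
    and \<eta>: "\<And>i w. i \<in> {1..3} \<Longrightarrow> (\<lambda>y. \<eta> i y [w]) differentiable (at x)"
  obtains A where "\<And>i. i \<in> {1..3} \<Longrightarrow> linear (A i)"
    "\<And>i u v. i \<in> {1..3} \<Longrightarrow> ext_d (\<eta> i) x [u, v] = of_real (2 * g x (A i u) v)"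
    "\<And>i u v. i \<in> {1..3} \<Longrightarrow> g x (A i u) v = - g x u (A i v)"
    "\<And>i j. i \<in> {1..3} \<Longrightarrow> j \<in> {1..3} \<Longrightarrow> A i (\<xi> j x) = (\<Sum>k\<in>{1..3}. eps i j k *\<^sub>R \<xi> k x)"
    "\<And>i j u. i \<in> {1..3} \<Longrightarrow> j \<in> {1..3} \<Longrightarrow> A i (A j u) =
       g x (\<xi> j x) u *\<^sub>R \<xi> i x - delta i j *\<^sub>R u + (\<Sum>k\<in>{1..3}. eps i j k *\<^sub>R A k u)"
proof -
  let ?p = "(x, 1::real)" and ?G = "g x"
  obtain J where hk: "hyperkaehler_on (U \<times> {0<..}) (cone_metric g) J"
    and Jr: "\<And>x r i. x \<in> U \<Longrightarrow> r > 0 \<Longrightarrow> i \<in> {1..3} \<Longrightarrow> J i (x, r) (0, r) = (\<xi> i x, 0)"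
    and ff: "\<And>p i vs. p \<in> U \<times> {0<..} \<Longrightarrow> i \<in> {1..3} \<Longrightarrow> fundamental_form (cone_metric g) (J i) p vs =
          ext_d (\<lambda>q us. of_real ((snd q)\<^sup>2) * \<eta> i (fst q) (map fst us)) p vs / 2"
    using three_sasakian_onD(4)[OF S] by blast
  have p: "?p \<in> U \<times> {0<..}" using x by simp
  have G: "bilinear ?G" and sym: "?G u v = ?G v u" for u v
    using three_sasakian_onD(1)[OF S] x by (auto simp: riemannian_on_def)
  have k: "kaehler_on (U \<times> {0<..}) (cone_metric g) (J i)" if "i \<in> {1..3}" for i
    using hk that by (auto simp: hyperkaehler_on_def)
  have lin: "linear (J i ?p)" if "i \<in> {1..3}" for i
    using k[OF that] p by (auto simp: kaehler_on_def almost_complex_on_def)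
  have JJ: "J i ?p (J i ?p w) = - w" if "i \<in> {1..3}" for i w
    using k[OF that] p unfolding kaehler_on_def almost_complex_on_def by blast
  have orth: "cone_metric g ?p (J i ?p w) (J i ?p w') = cone_metric g ?p w w'" if "i \<in> {1..3}" for i w w'
    using k[OF that] p unfolding kaehler_on_def by blast
  have quat: "J i ?p (J j ?p w) = - delta i j *\<^sub>R w + (\<Sum>k\<in>{1..3}. eps i j k *\<^sub>R J k ?p w)"
    if "i \<in> {1..3}" "j \<in> {1..3}" for i j w
    using hk p that unfolding hyperkaehler_on_def by blast
  have cm: "cone_metric g ?p (u, s) (v, t) = s * t + ?G u v" for u v s t
    by (simp add: cone_metric_def)
  have skew: "cone_metric g ?p (J i ?p w) w' = - cone_metric g ?p w (J i ?p w')" if "i \<in> {1..3}" for i w w'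
    using orth[OF that, of w "J i ?p w'"] JJ[OF that, of w']
    by (cases w'; cases "J i ?p w") (simp add: cone_metric_def bilinear_rneg[OF G])
  have J1: "J i ?p (0, 1) = (\<xi> i x, 0)" if "i \<in> {1..3}" for i
    using Jr[OF x _ that, of 1] by simp
  define A where "A i u = fst (J i ?p (u, 0))" for i u
  \<comment> \<open>At \<open>r = 1\<close> the radial field is \<open>(0, 1)\<close>; skewness
    against it yields the radial component.\<close>
  have Ju: "J i ?p (u, 0) = (A i u, - ?G (\<xi> i x) u)" if "i \<in> {1..3}" for i u
    using skew[OF that, of "(u, 0)" "(0, 1)"] J1[OF that] sym[of u]
    by (cases "J i ?p (u, 0)") (simp add: A_def cm bilinear_rzero[OF G])
  have Jus: "J i ?p (u, s) = (A i u + s *\<^sub>R \<xi> i x, - ?G (\<xi> i x) u)" if "i \<in> {1..3}" for i u s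
    using linear_add[OF lin[OF that], of "(u, 0)" "s *\<^sub>R (0, 1)"]
      linear_cmul[OF lin[OF that], of s "(0, 1)"] Ju[OF that] J1[OF that] by simp
  show ?thesis
  proof (rule that)
    show "linear (A i)" if "i \<in> {1..3}" for i
    proof (rule linearI)
      show "A i (u + v) = A i u + A i v" for u v
        using linear_add[OF lin[OF that], of "(u, 0)" "(v, 0)"] by (simp add: A_def)
      show "A i (r *\<^sub>R v) = r *\<^sub>R A i v" for r v
        using linear_cmul[OF lin[OF that], of r "(v, 0)"] by (simp add: A_def)
    qed
    \<comment> \<open>The fundamental form of \<open>J i\<close> is half of
      \<open>d(r\<^sup>2 \<eta>\<^sub>i)\<close>, hence the factor 2.\<close>
    show "ext_d (\<eta> i) x [u, v] = of_real (2 * ?G (A i u) v)" if "i \<in> {1..3}" for i u v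
      using ff[OF p that, of "[(u, 0), (v, 0)]"] ext_d_cone[where \<beta> = "\<eta> i", OF \<eta>[OF that], of u v] Ju[OF that]
      by (simp add: fundamental_form_def form2_def cm mult.commute)
    show "?G (A i u) v = - ?G u (A i v)" if "i \<in> {1..3}" for i u v
      using skew[OF that, of "(u, 0)" "(v, 0)"] by (simp add: Ju[OF that] cm)
    show "A i (\<xi> j x) = (\<Sum>k\<in>{1..3}. eps i j k *\<^sub>R \<xi> k x)" if "i \<in> {1..3}" "j \<in> {1..3}" for i j
    proof -
      have "A i (\<xi> j x) = fst (J i ?p (J j ?p (0, 1)))"
        by (simp add: A_def J1[OF that(2)])
      also have "\<dots> = (\<Sum>k\<in>{1..3}. eps i j k *\<^sub>R fst (J k ?p (0, 1)))"
        by (simp add: quat[OF that] fst_sum)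
      finally show ?thesis using J1 by simp
    qed
    show "A i (A j u) = ?G (\<xi> j x) u *\<^sub>R \<xi> i x - delta i j *\<^sub>R u + (\<Sum>k\<in>{1..3}. eps i j k *\<^sub>R A k u)"
      if "i \<in> {1..3}" "j \<in> {1..3}" for i j u
    proof -
      have "A i (A j u) - ?G (\<xi> j x) u *\<^sub>R \<xi> i x = fst (J i ?p (J j ?p (u, 0)))"
        by (simp add: Ju[OF that(2)] Jus[OF that(1)])
      also have "\<dots> = - delta i j *\<^sub>R u + (\<Sum>k\<in>{1..3}. eps i j k *\<^sub>R A k u)"
        by (simp add: quat[OF that] fst_sum A_def)
      finally show ?thesis by (simp add: algebra_simps)
    qed
  qed
qed

lemma sum_1_3: "(\<Sum>k\<in>{1..3::nat}. f k) = f 1 + f 2 + (f 3 :: 'a::comm_monoid_add)"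
  by (simp add: numeral_3_eq_3 numeral_2_eq_2 add.assoc)

text \<open>By dimension some vector lies outside the span of \<open>p, q, r\<close>; its
  \<open>G\<close>-orthogonal remainder is non-zero and is normalised.\<close>

lemma ex_orthonormal_complement_3:
  fixes G :: "'v::euclidean_space \<Rightarrow> 'v \<Rightarrow> real"
  assumes G: "bilinear G" and sym: "\<And>u v. G u v = G v u" and pos: "\<And>u. u \<noteq> 0 \<Longrightarrow> G u u > 0"
    and dim: "DIM('v) > 3"
    and on: "G p p = 1" "G q q = 1" "G r r = 1" "G p q = 0" "G p r = 0" "G q r = 0"
  obtains e where "G e e = 1" "G p e = 0" "G q e = 0" "G r e = 0"
proof -
  have "dim {p, q, r} \<le> card {p, q, r}" by (rule dim_le_card') simp
  also have "\<dots> \<le> 3" using card_length[of "[p, q, r]"] by simp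
  finally have "dim (span {p, q, r}) \<noteq> DIM('v)" using dim by simp
  then have "span {p, q, r} \<noteq> UNIV" by (metis dim_UNIV)
  then obtain u where u: "u \<notin> span {p, q, r}" by blast
  define w where "w = u - G p u *\<^sub>R p - G q u *\<^sub>R q - G r u *\<^sub>R r"
  have w0: "w \<noteq> 0"
  proof
    assume "w = 0"
    then have "u = G p u *\<^sub>R p + G q u *\<^sub>R q + G r u *\<^sub>R r" by (simp add: w_def algebra_simps)
    also have "\<dots> \<in> span {p, q, r}" by (intro span_add span_scale span_base) auto
    finally show False using u by simp
  qed
  note b = bilinear_rsub[OF G] bilinear_rmul[OF G] bilinear_lmul[OF G]
  have o: "G p w = 0" "G q w = 0" "G r w = 0"
    using on sym[of q p] sym[of r p] sym[of r q] by (simp_all add: w_def b)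
  let ?e = "(1 / sqrt (G w w)) *\<^sub>R w"
  have "G ?e ?e = 1" using pos[OF w0] by (simp add: b)
  with o show ?thesis by (intro that[of ?e]) (simp_all add: b)
qed

text \<open>The index 1 has to stay a numeral, so that the values of \<open>eps\<close> at the
  indices 1, 2, 3 match.\<close>

declare One_nat_def [simp del]

lemma eps_simps:
  "eps i i k = 0" "eps i k i = 0" "eps k i i = 0" "eps 1 2 3 = 1" "eps 2 3 1 = 1" "eps 3 1 2 = 1"
  "eps 2 1 3 = - 1" "eps 3 2 1 = - 1" "eps 1 3 2 = - 1"
  by (auto simp: eps_def)

text \<open>\<open>A 3\<close> maps \<open>e\<close> to \<open>e3\<close> and \<open>e1\<close> to
  \<open>e2\<close>. The covectors \<open>z0\<close> and \<open>z1\<close>, whose real and imaginary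
  parts are dual to these pairs, are therefore of type (1,0) for \<open>A 3\<close> on the
  horizontal space, where \<open>\<alpha>\<^sub>3\<close> becomes the standard Kaehler form and
  \<alpha> the standard (2,0)-form.\<close>

lemma three_sasakian_coframe:
  fixes \<xi> :: "nat \<Rightarrow> (real^7, 's) chart \<Rightarrow> real^7 \<Rightarrow> real^7"
  assumes S: "three_sasakian_on U (g c) (\<lambda>i. \<xi> i c) (\<lambda>i. \<eta> i c) (\<lambda>i. \<Phi> i c)" and x: "x \<in> U"
    and \<eta>: "\<And>i w. i \<in> {1..3} \<Longrightarrow> (\<lambda>y. \<eta> i c y [w]) differentiable (at x)"
    and hom: "\<And>i. i \<in> {1..3} \<Longrightarrow> homogeneous 2 (ext_d (\<eta> i c) x)"
  obtains z0 z1 z2 where "linear z0" "linear z1" "linear z2"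
    "z0 (\<xi> 3 c x) = 0" "z1 (\<xi> 3 c x) = 0" "z2 (\<xi> 3 c x) = 0"
    "\<And>p q r. \<exists>v. z0 v = p \<and> z1 v = q \<and> z2 v = r"
    "\<And>v. z0 v = 0 \<Longrightarrow> z1 v = 0 \<Longrightarrow> z2 v = 0 \<Longrightarrow> v \<in> span {\<xi> 3 c x}"
    "alpha \<eta> c x = one_form z0 \<and>\<^sub>f one_form z1" "alpha_i \<eta> 3 c x = model_alpha3 z0 z1"
    "eta_c \<eta> c x = cnj_form (one_form z2)"
proof -
  let ?G = "g c x"
  have G: "bilinear ?G" and sym: "?G u v = ?G v u" and pos: "u \<noteq> 0 \<Longrightarrow> ?G u u > 0" for u v
    using three_sasakian_onD(1)[OF S] x by (auto simp: riemannian_on_def)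
  note bl = bilinear_ladd[OF G] bilinear_lsub[OF G] bilinear_lmul[OF G] bilinear_radd[OF G]
    bilinear_rsub[OF G] bilinear_rmul[OF G] bilinear_lneg[OF G] bilinear_rneg[OF G]
    bilinear_lzero[OF G] bilinear_rzero[OF G]
  obtain A where linA: "\<And>i. i \<in> {1..3} \<Longrightarrow> linear (A i)"
    and dA: "\<And>i u v. i \<in> {1..3} \<Longrightarrow> ext_d (\<eta> i c) x [u, v] = of_real (2 * ?G (A i u) v)"
    and skew: "\<And>i u v. i \<in> {1..3} \<Longrightarrow> ?G (A i u) v = - ?G u (A i v)"
    and A\<xi>: "\<And>i j. i \<in> {1..3} \<Longrightarrow> j \<in> {1..3} \<Longrightarrow> A i (\<xi> j c x) = (\<Sum>k\<in>{1..3}. eps i j k *\<^sub>R \<xi> k c x)"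
    and AA: "\<And>i j u. i \<in> {1..3} \<Longrightarrow> j \<in> {1..3} \<Longrightarrow> A i (A j u) =
       ?G (\<xi> j c x) u *\<^sub>R \<xi> i c x - delta i j *\<^sub>R u + (\<Sum>k\<in>{1..3}. eps i j k *\<^sub>R A k u)"
    using three_sasakian_endomorphisms[OF S x \<eta>] by blast
  have \<eta>f: "\<eta> i c x = form1 (\<lambda>u. ?G (\<xi> i c x) u)" if "i \<in> {1..3}" for i
    using three_sasakian_onD(3)[OF S x that] .
  define p q r where "p = \<xi> 1 c x" and "q = \<xi> 2 c x" and "r = \<xi> 3 c x"
  have on: "?G (\<xi> i c x) (\<xi> j c x) = delta i j" if "i \<in> {1..3}" "j \<in> {1..3}" for i j
    using three_sasakian_onD(5)[OF S x that] \<eta>f[OF that(1)] by (simp add: form1_def)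
  have on3: "?G p p = 1" "?G q q = 1" "?G r r = 1" "?G p q = 0" "?G p r = 0" "?G q r = 0"
    by (simp_all add: p_def q_def r_def on delta_def)
  obtain e where e: "?G e e = 1" "?G p e = 0" "?G q e = 0" "?G r e = 0"
    using ex_orthonormal_complement_3[OF G sym pos _ on3] by auto
  define e1 e2 e3 where "e1 = A 1 e" and "e2 = A 2 e" and "e3 = A 3 e"
  have Ap: "A 1 p = 0" "A 2 p = - r" "A 3 p = q" "A 1 q = r" "A 2 q = 0" "A 3 q = - p"
      "A 1 r = - q" "A 2 r = p" "A 3 r = 0"
    by (simp_all add: p_def q_def r_def A\<xi> sum_1_3 eps_simps del: One_nat_def)
  have Ae: "A 1 e = e1" "A 2 e = e2" "A 3 e = e3"
    by (simp_all add: e1_def e2_def e3_def)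
  \<comment> \<open>As \<open>e\<close> is orthogonal to the Reeb vectors, the additional term
    vanishes and the plain quaternion relations remain.\<close>
  have AA': "A i (A j e) = - delta i j *\<^sub>R e + (\<Sum>k\<in>{1..3}. eps i j k *\<^sub>R A k e)" if "i \<in> {1..3}" "j \<in> {1..3}" for i j
  proof -
    have "j = 1 \<or> j = 2 \<or> j = 3" using that(2) unfolding atLeastAtMost_iff by presburger
    then have "?G (\<xi> j c x) e = 0" using e by (auto simp: p_def q_def r_def)
    then show ?thesis by (simp add: AA[OF that])
  qed
  have Ae1: "A 1 e1 = - e" "A 2 e1 = - e3" "A 3 e1 = e2" "A 1 e2 = e3" "A 2 e2 = - e" "A 3 e2 = - e1"
      "A 1 e3 = - e2" "A 2 e3 = e1" "A 3 e3 = - e"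
    by (simp_all add: e1_def e2_def e3_def AA' sum_1_3 eps_simps delta_def del: One_nat_def)
  have I: "1 \<in> {1..3::nat}" "2 \<in> {1..3::nat}" "3 \<in> {1..3::nat}" by auto
  have ee: "?G e e1 = 0" "?G e e2 = 0" "?G e e3 = 0"
    using skew[OF I(1), of e e] skew[OF I(2), of e e] skew[OF I(3), of e e] sym[of e1 e] sym[of e2 e] sym[of e3 e]
    by (simp_all add: Ae)
  have eij: "?G e1 e1 = 1" "?G e2 e2 = 1" "?G e3 e3 = 1" "?G e1 e2 = 0" "?G e1 e3 = 0" "?G e2 e3 = 0"
    using skew[OF I(1), of e e1] skew[OF I(2), of e e2] skew[OF I(3), of e e3]
      skew[OF I(1), of e e2] skew[OF I(1), of e e3] skew[OF I(2), of e e3]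
    by (simp_all add: Ae Ae1 bl e ee)
  have ep: "?G p e1 = 0" "?G p e2 = 0" "?G p e3 = 0" "?G q e1 = 0" "?G q e2 = 0" "?G q e3 = 0"
      "?G r e1 = 0" "?G r e2 = 0" "?G r e3 = 0"
    using skew[OF I(1), of p e] skew[OF I(2), of p e] skew[OF I(3), of p e]
      skew[OF I(1), of q e] skew[OF I(2), of q e] skew[OF I(3), of q e]
      skew[OF I(1), of r e] skew[OF I(2), of r e] skew[OF I(3), of r e]
    by (simp_all add: Ae Ap bl e)
  note on7 = on3 e ee eij ep
  have on7s: "?G q p = 0" "?G r p = 0" "?G r q = 0" "?G e p = 0" "?G e q = 0" "?G e r = 0"
    "?G e1 p = 0" "?G e1 q = 0" "?G e1 r = 0" "?G e1 e = 0" "?G e2 p = 0" "?G e2 q = 0" "?G e2 r = 0"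
    "?G e2 e = 0" "?G e2 e1 = 0" "?G e3 p = 0" "?G e3 q = 0" "?G e3 r = 0" "?G e3 e = 0"
    "?G e3 e1 = 0" "?G e3 e2 = 0"
    using on7 by (metis sym)+
  let ?xs = "[p, q, r, e, e1, e2, e3]"
  have "\<forall>i<7. \<forall>j<7. ?G (?xs ! i) (?xs ! j) = (if i = j then 1 else 0)"
    by (simp add: eval_nat_numeral All_less_Suc on7 on7s One_nat_def)
  then have expand: "u = ?G p u *\<^sub>R p + ?G q u *\<^sub>R q + ?G r u *\<^sub>R r + ?G e u *\<^sub>R e +
      ?G e1 u *\<^sub>R e1 + ?G e2 u *\<^sub>R e2 + ?G e3 u *\<^sub>R e3" for u
    using orthonormal_list_expansion[OF G, of ?xs u] by (simp add: lessThan_Suc numeral_eq_Suc add_ac)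
  \<comment> \<open>The sign in \<open>z2\<close> makes it the conjugate of \<eta>: since \<Omega>
    contains \<open>cnj \<eta>\<close>, this is the covector that has to be of type (1,0).\<close>
  define z0 z1 z2 where "z0 u = Complex (?G e u) (?G e3 u)" and "z1 u = Complex (?G e1 u) (?G e2 u)"
    and "z2 u = Complex (?G p u) (- ?G q u)" for u
  note zdef = z0_def z1_def z2_def
  show ?thesis
  proof (rule that)
    show "linear z0" "linear z1" "linear z2"
      by (auto intro!: linearI simp: zdef bl complex_eq_iff)
    show "z0 (\<xi> 3 c x) = 0" "z1 (\<xi> 3 c x) = 0" "z2 (\<xi> 3 c x) = 0"
      by (simp_all add: zdef complex_eq_iff on7 on7s flip: r_def)
    show "\<exists>v. z0 v = P \<and> z1 v = Q \<and> z2 v = R" for P Q R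
    proof -
      define w where "w = Re P *\<^sub>R e + Im P *\<^sub>R e3 + Re Q *\<^sub>R e1 + Im Q *\<^sub>R e2 + Re R *\<^sub>R p - Im R *\<^sub>R q"
      have "?G u w = Re P * ?G u e + Im P * ?G u e3 + Re Q * ?G u e1 + Im Q * ?G u e2 + Re R * ?G u p - Im R * ?G u q" for u
        by (simp only: w_def bl real_scaleR_def)
      then have "z0 w = P" "z1 w = Q" "z2 w = R"
        unfolding zdef by (simp_all only: on7 on7s) simp_all
      then show ?thesis by blast
    qed
    show "v \<in> span {\<xi> 3 c x}" if "z0 v = 0" "z1 v = 0" "z2 v = 0" for v
    proof -
      have "v = ?G r v *\<^sub>R r"
        using expand[of v] that by (simp add: zdef complex_eq_iff)
      then show ?thesis by (metis r_def span_base span_scale singletonI)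
    qed
    \<comment> \<open>Expanding \<open>u\<close> alone leaves the images of the frame vectors under
      \<open>A i\<close>, all of which are known.\<close>
    have AG: "?G (A i u) v = ?G p u * ?G (A i p) v + ?G q u * ?G (A i q) v + ?G r u * ?G (A i r) v +
        ?G e u * ?G (A i e) v + ?G e1 u * ?G (A i e1) v + ?G e2 u * ?G (A i e2) v + ?G e3 u * ?G (A i e3) v"
      if "i \<in> {1..3}" for i u v
      by (subst (1) expand[of u])
        (simp add: linear_add[OF linA[OF that]] linear_cmul[OF linA[OF that]] bl)
    have homw: "homogeneous 2 (\<phi> \<and>\<^sub>f \<psi>)" if "homogeneous 1 \<phi>" "homogeneous 1 \<psi>" for \<phi> \<psi> :: "(real^7) mform"
      using homogeneous_wedge[OF that] by (simp add: numeral_2_eq_2)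
    have hf: "homogeneous 1 (form1 f)" for f :: "real^7 \<Rightarrow> real"
      by (auto simp: homogeneous_def form1_def split: list.split)
    have homa: "homogeneous 2 (alpha_i \<eta> i c x)" if "i \<in> {1..3}" for i
      using hom[OF that] homw[OF hf hf] \<eta>f
      by (auto simp: homogeneous_def alpha_i_def intro!: sum.neutral)
    have ae: "alpha_i \<eta> 1 c x [u, v] = of_real (?G (A 1 u) v - (?G q u * ?G r v - ?G q v * ?G r u))"
      "alpha_i \<eta> 2 c x [u, v] = of_real (?G (A 2 u) v - (?G r u * ?G p v - ?G r v * ?G p u))"
      "alpha_i \<eta> 3 c x [u, v] = of_real (?G (A 3 u) v - (?G p u * ?G q v - ?G p v * ?G q u))" for u v
      using I \<eta>f[OF I(1)] \<eta>f[OF I(2)] \<eta>f[OF I(3)] dA[OF I(1)] dA[OF I(2)] dA[OF I(3)]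
      by (simp_all add: alpha_i_def sum_1_3 eps_simps wedge_form1 field_simps flip: p_def q_def r_def del: One_nat_def)
    show "alpha \<eta> c x = one_form z0 \<and>\<^sub>f one_form z1"
    proof (rule homogeneous_eqI2)
      show "homogeneous 2 (alpha \<eta> c x)"
        using homa[OF I(1)] homa[OF I(2)] by (simp add: homogeneous_def alpha_def)
      show "homogeneous 2 (one_form z0 \<and>\<^sub>f one_form z1)" by (intro homw homogeneous_one_form)
      show "alpha \<eta> c x [u, v] = (one_form z0 \<and>\<^sub>f one_form z1) [u, v]" for u v
        by (simp add: alpha_def ae AG[OF I(1)] AG[OF I(2)] Ap Ae Ae1 bl one_form_wedge_2 zdef complex_eq_iff
            algebra_simps del: One_nat_def)
    qed
    show "alpha_i \<eta> 3 c x = model_alpha3 z0 z1"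
    proof (rule homogeneous_eqI2)
      show "homogeneous 2 (alpha_i \<eta> 3 c x)" by (rule homa) simp
      show "homogeneous 2 (model_alpha3 z0 z1)" by (rule homogeneous_model_alpha3)
      show "alpha_i \<eta> 3 c x [u, v] = model_alpha3 z0 z1 [u, v]" for u v
        by (simp add: ae AG[OF I(3)] Ap Ae Ae1 bl model_alpha3_eval zdef complex_eq_iff algebra_simps)
    qed
    show "eta_c \<eta> c x = cnj_form (one_form z2)"
      using \<eta>f[OF I(1)] \<eta>f[OF I(2)]
      by (auto simp: fun_eq_iff eta_c_def cnj_form_def one_form_def form1_def z2_def complex_eq_iff
          simp flip: p_def q_def split: list.split)
  qed
qed

section \<open>The invariant forms and their derivatives at a point\<close>

lemma insertion_one_form_zero: "\<phi> v = 0 \<Longrightarrow> insertion v (one_form \<phi>) = 0\<^sub>f"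
  by (simp add: insertion_one_form form_scale_0 del: wedge_power.simps)

lemma insertion_wedge_zero:
  "insertion v \<alpha> = 0\<^sub>f \<Longrightarrow> insertion v \<beta> = 0\<^sub>f \<Longrightarrow> insertion v (\<alpha> \<and>\<^sub>f \<beta>) = 0\<^sub>f"
  by (simp add: insertion_wedge wedge_zero_left wedge_zero_right form_scale_zero)

lemma insertion_cnj_form: "insertion v (cnj_form \<alpha>) = cnj_form (insertion v \<alpha>)"
  by (simp add: fun_eq_iff insertion_def cnj_form_def)

lemma cnj_form_zero: "cnj_form 0\<^sub>f = 0\<^sub>f"
  by (simp add: fun_eq_iff cnj_form_def form_zero_def)

lemma insertion_model_zero:
  assumes "z0 v = 0" "z1 v = 0" "z2 v = 0"
  shows "insertion v (model_alpha3 z0 z1) = 0\<^sub>f" "insertion v (model_theta z2) = 0\<^sub>f"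
    "insertion v (model_omega a b z0 z1 z2) = 0\<^sub>f" "insertion v (model_Omega c z0 z1 z2) = 0\<^sub>f"
proof -
  note h = insertion_one_form_zero[of z0, OF assms(1)] insertion_one_form_zero[of z1, OF assms(2)]
    insertion_one_form_zero[of z2, OF assms(3)]
  note s = insertion_add insertion_scale insertion_wedge_zero insertion_cnj_form cnj_form_zero form_scale_zero h
  show "insertion v (model_alpha3 z0 z1) = 0\<^sub>f" "insertion v (model_theta z2) = 0\<^sub>f"
    by (simp_all add: model_alpha3_def model_theta_def s)
  then show "insertion v (model_omega a b z0 z1 z2) = 0\<^sub>f" "insertion v (model_Omega c z0 z1 z2) = 0\<^sub>f"
    by (simp_all add: model_omega_def model_Omega_def s)
qed

lemma ext_d_cnj:
  assumes "differentiable_form \<beta> x"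
  shows "cnj_form (ext_d \<beta> x) = ext_d (\<lambda>y. cnj_form (\<beta> y)) x"
  using assms
  by (intro ext) (simp add: cnj_form_def ext_d_def differentiable_form_def dd_bounded_linear[OF bounded_linear_cnj])

text \<open>The form \<open>\<alpha>\<^sub>i\<close> in a single chart with the double sum over
  \<open>eps\<close> collapsed, in the shape of the structure equations.\<close>

definition alpha_of :: "'v::euclidean_space dform \<Rightarrow> 'v dform \<Rightarrow> 'v dform \<Rightarrow> 'v dform" where
  "alpha_of F G H = (\<lambda>y. (1 / 2) *\<^sub>f (ext_d F y +\<^sub>f (-2) *\<^sub>f (G y \<and>\<^sub>f H y)))"

text \<open>The metric is smooth for constant arguments, so \<open>\<xi> i\<close> is expanded in
  the basis to get smoothness of \<open>\<eta> i\<close>.\<close>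

lemma three_sasakian_one_form:
  fixes \<xi> :: "nat \<Rightarrow> 'v::euclidean_space \<Rightarrow> 'v"
  assumes U: "open U" and S: "three_sasakian_on U g \<xi> \<eta> \<Phi>" and i: "i \<in> {1..3}"
  shows "form_on U 1 (\<eta> i)"
proof (rule form_onI)
  have b: "bilinear (g x)" if "x \<in> U" for x
    using three_sasakian_onD(1)[OF S] that by (auto simp: riemannian_on_def)
  have hf: "homogeneous 1 (form1 f)" for f :: "'v \<Rightarrow> real"
    by (auto simp: homogeneous_def form1_def split: list.split)
  show "alternating_form 1 (\<eta> i x)" if x: "x \<in> U" for x
    unfolding three_sasakian_onD(3)[OF S x i]
    by (rule alternating_form_1I[OF hf])
      (auto intro!: linearI simp: form1_def bilinear_radd[OF b[OF x]] bilinear_rmul[OF b[OF x]] scaleR_conv_of_real)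
  have g: "smooth_on U (\<lambda>x. g x u v)" for u v
    using three_sasakian_onD(1)[OF S] by (auto simp: riemannian_on_def)
  have sm: "smooth_on U (\<lambda>x. g x (\<xi> i x) w)" for w
  proof (rule smooth_on_cong[OF U])
    show "smooth_on U (\<lambda>x. \<Sum>b\<in>Basis. (\<xi> i x \<bullet> b) *\<^sub>R g x b w)"
      by (intro smooth_on_sum smooth_on_scaleR U g smooth_on_bounded_linear[OF U bounded_linear_inner_left]
          three_sasakian_onD(2)[OF S i])
    show "(\<Sum>b\<in>Basis. (\<xi> i x \<bullet> b) *\<^sub>R g x b w) = g x (\<xi> i x) w" if "x \<in> U" for x
      using linear_basis_expansion[of "\<lambda>u. g x u w" "\<xi> i x"] b[OF that] by (simp add: bilinear_def)
  qed
  have sf: "smooth_on U (\<lambda>x. form1 (\<lambda>u. g x (\<xi> i x) u) vs)" for vs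
  proof (cases "length vs = 1")
    case True
    then obtain w where "vs = [w]" by (auto simp: length_Suc_conv One_nat_def)
    then show ?thesis using smooth_on_bounded_linear[OF U bounded_linear_of_real sm] by (simp add: form1_def)
  qed (use hf in \<open>auto simp: homogeneous_def\<close>)
  show "smooth_form U (\<eta> i)"
    unfolding smooth_form_def
    by (intro allI smooth_on_cong[OF U _ sf]) (simp add: three_sasakian_onD(3)[OF S _ i])
qed

text \<open>The double sum has two non-zero terms, which are equal since \<open>eps\<close> and the
  wedge both change sign; this accounts for the factor 2.\<close>

lemma alpha_i_alpha_of:
  assumes "\<And>i. i \<in> {1..3} \<Longrightarrow> homogeneous 1 (\<eta> i c x)"
  shows "alpha_i \<eta> 1 c x = alpha_of (\<eta> 1 c) (\<eta> 2 c) (\<eta> 3 c) x"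
    "alpha_i \<eta> 2 c x = alpha_of (\<eta> 2 c) (\<eta> 3 c) (\<eta> 1 c) x"
    "alpha_i \<eta> 3 c x = alpha_of (\<eta> 3 c) (\<eta> 1 c) (\<eta> 2 c) x"
proof -
  have I: "1 \<in> {1..3::nat}" "2 \<in> {1..3::nat}" "3 \<in> {1..3::nat}" by auto
  note h = assms[OF I(1)] assms[OF I(2)] assms[OF I(3)]
  have c: "(\<eta> 3 c x \<and>\<^sub>f \<eta> 2 c x) vs = - (\<eta> 2 c x \<and>\<^sub>f \<eta> 3 c x) vs"
    "(\<eta> 1 c x \<and>\<^sub>f \<eta> 3 c x) vs = - (\<eta> 3 c x \<and>\<^sub>f \<eta> 1 c x) vs"
    "(\<eta> 2 c x \<and>\<^sub>f \<eta> 1 c x) vs = - (\<eta> 1 c x \<and>\<^sub>f \<eta> 2 c x) vs" for vs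
    using wedge_anticommute(1)[OF h(3) h(2)] wedge_anticommute(1)[OF h(1) h(3)] wedge_anticommute(1)[OF h(2) h(1)]
    by (simp_all add: form_scale_def)
  show "alpha_i \<eta> 1 c x = alpha_of (\<eta> 1 c) (\<eta> 2 c) (\<eta> 3 c) x"
    "alpha_i \<eta> 2 c x = alpha_of (\<eta> 2 c) (\<eta> 3 c) (\<eta> 1 c) x"
    "alpha_i \<eta> 3 c x = alpha_of (\<eta> 3 c) (\<eta> 1 c) (\<eta> 2 c) x"
    by (auto simp: fun_eq_iff alpha_i_def alpha_of_def form_add_def form_scale_def sum_1_3 eps_simps c
        field_simps)
qed

lemma omega_ab_eq: "omega_ab \<eta> a b c x = of_real a *\<^sub>f alpha_i \<eta> 3 c x +\<^sub>f
    (- \<i> / 2 * of_real (b\<^sup>2)) *\<^sub>f eta_eta_bar \<eta> c x"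
  by (simp add: fun_eq_iff omega_ab_def form_add_def form_scale_def)

lemma Omega_c_eq: "Omega_c \<eta> k c x = k *\<^sub>f (alpha \<eta> c x \<and>\<^sub>f cnj_form (eta_c \<eta> c x))"
  by (simp add: fun_eq_iff Omega_c_def form_scale_def)

lemma alpha_eq: "alpha \<eta> c x = alpha_i \<eta> 1 c x +\<^sub>f \<i> *\<^sub>f alpha_i \<eta> 2 c x"
  by (simp add: fun_eq_iff alpha_def form_add_def form_scale_def)

lemma eta_c_eq: "eta_c \<eta> c x = \<eta> 1 c x +\<^sub>f \<i> *\<^sub>f \<eta> 2 c x"
  by (simp add: fun_eq_iff eta_c_def form_add_def form_scale_def)

text \<open>All data at a point in one predicate: both forms,
  \<open>\<eta> \<and> cnj \<eta>\<close>, and the values \<open>\<omega>'\<close> and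
  \<open>\<Omega>'\<close> of the exterior derivatives. They thus share one coframe and pass to the
  quotient together.\<close>

definition model_forms where
  "model_forms a b k \<omega> \<Omega> \<theta> \<omega>' \<Omega>' z0 z1 z2 \<longleftrightarrow>
     \<omega> = model_omega a b z0 z1 z2 \<and> \<Omega> = model_Omega k z0 z1 z2 \<and> \<theta> = model_theta z2 \<and>
     (\<forall>vs. \<omega>' vs = of_real (2 * (a + b\<^sup>2) * Im (model_Omega 1 z0 z1 z2 vs))) \<and>
     \<Omega>' = k *\<^sub>f
      (2 *\<^sub>f (one_form z0 \<and>\<^sub>f one_form z1 \<and>\<^sub>f cnj_form (one_form z0) \<and>\<^sub>f cnj_form (one_form z1)) +\<^sub>f
       (- 2 * \<i>) *\<^sub>f (model_alpha3 z0 z1 \<and>\<^sub>f model_theta z2))"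

text \<open>The coframe belongs to the single point \<open>x\<close>. The derivatives are found from
  the forms \<open>\<eta> i\<close> near \<open>x\<close>, and only the resulting values at
  \<open>x\<close> are rewritten in the coframe.\<close>

lemma three_sasakian_local_model:
  fixes \<xi> :: "nat \<Rightarrow> (real^7, 's) chart \<Rightarrow> real^7 \<Rightarrow> real^7" and a b :: real
  assumes U: "open U" and S: "three_sasakian_on U (g c) (\<lambda>i. \<xi> i c) (\<lambda>i. \<eta> i c) (\<lambda>i. \<Phi> i c)" and x: "x \<in> U"
  obtains z0 z1 z2 where "linear z0" "linear z1" "linear z2"
    "z0 (\<xi> 3 c x) = 0" "z1 (\<xi> 3 c x) = 0" "z2 (\<xi> 3 c x) = 0"
    "\<And>p q r. \<exists>v. z0 v = p \<and> z1 v = q \<and> z2 v = r"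
    "\<And>v. z0 v = 0 \<Longrightarrow> z1 v = 0 \<Longrightarrow> z2 v = 0 \<Longrightarrow> v \<in> span {\<xi> 3 c x}"
    "model_forms a b k (omega_ab \<eta> a b c x) (Omega_c \<eta> k c x) (eta_eta_bar \<eta> c x)
       (ext_d (omega_ab \<eta> a b c) x) (ext_d (Omega_c \<eta> k c) x) z0 z1 z2"
proof -
  have I: "1 \<in> {1..3::nat}" "2 \<in> {1..3::nat}" "3 \<in> {1..3::nat}" by auto
  have f: "form_on U 1 (\<eta> i c)" if "i \<in> {1..3}" for i
    by (rule three_sasakian_one_form[OF U S that])
  note sm = form_on_smooth_form[OF f]
  have hom: "homogeneous 1 (\<eta> i c y)" if "i \<in> {1..3}" "y \<in> U" for i y
    by (rule alternating_form_homogeneous[OF form_on_alternating[OF f[OF that(1)] that(2)]])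
  have homd: "homogeneous 2 (ext_d (\<eta> i c) x)" if "i \<in> {1..3}" for i
    by (rule alternating_form_homogeneous[OF form_on_alternating[OF form_on_ext_d_1[OF U f[OF that]] x]])
  have real_\<eta>: "cnj_form (\<eta> i c y) = \<eta> i c y" if "i \<in> {1..3}" "y \<in> U" for i y
    using three_sasakian_onD(3)[OF S that(2,1)]
    by (auto simp: fun_eq_iff cnj_form_def form1_def split: list.split)
  define A1 A2 A3 where "A1 = alpha_of (\<eta> 1 c) (\<eta> 2 c) (\<eta> 3 c)" and "A2 = alpha_of (\<eta> 2 c) (\<eta> 3 c) (\<eta> 1 c)"
    and "A3 = alpha_of (\<eta> 3 c) (\<eta> 1 c) (\<eta> 2 c)"
  have A: "alpha_i \<eta> 1 c y = A1 y" "alpha_i \<eta> 2 c y = A2 y" "alpha_i \<eta> 3 c y = A3 y" if "y \<in> U" for y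
    using alpha_i_alpha_of[of \<eta> c y, OF hom[OF _ that]] by (simp_all add: A1_def A2_def A3_def)
  have real_d: "cnj_form (ext_d (\<eta> i c) x) = ext_d (\<eta> i c) x" if "i \<in> {1..3}" for i
    unfolding ext_d_cnj[OF form_on_differentiable_form[OF f[OF that] x]]
    by (rule ext_d_cong_open[OF U x]) (rule real_\<eta>[OF that])
  have real_A: "cnj_form (A1 x) = A1 x" "cnj_form (A2 x) = A2 x"
    by (simp_all add: A1_def A2_def alpha_of_def cnj_form_scale cnj_form_add cnj_form_wedge real_d I real_\<eta> x)
  have cnj_eta: "cnj_form (eta_c \<eta> c y) = \<eta> 1 c y +\<^sub>f (- \<i>) *\<^sub>f \<eta> 2 c y" if "y \<in> U" for y
    by (simp add: eta_c_eq cnj_form_add cnj_form_scale real_\<eta>[OF I(1) that] real_\<eta>[OF I(2) that])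
  have eeb: "eta_eta_bar \<eta> c y = (- 2 * \<i>) *\<^sub>f (\<eta> 1 c y \<and>\<^sub>f \<eta> 2 c y)" if "y \<in> U" for y
    unfolding eta_eta_bar_def cnj_eta[OF that] unfolding eta_c_eq
    by (simp add: wedge_expand wedge_anticommute[OF hom[OF I(2) that] hom[OF I(1) that]]
        wedge_square_zero[OF hom[OF I(1) that]] wedge_square_zero[OF hom[OF I(2) that]]
        fun_eq_iff form_add_def form_scale_def)
  have d\<eta>: "(\<lambda>y. \<eta> i c y [w]) differentiable (at x)" if "i \<in> {1..3}" for i w
    by (rule form_on_differentiable[OF f[OF that] x])
  obtain z0 z1 z2 where z: "linear z0" "linear z1" "linear z2"
    "z0 (\<xi> 3 c x) = 0" "z1 (\<xi> 3 c x) = 0" "z2 (\<xi> 3 c x) = 0"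
    "\<And>p q r. \<exists>v. z0 v = p \<and> z1 v = q \<and> z2 v = r"
    "\<And>v. z0 v = 0 \<Longrightarrow> z1 v = 0 \<Longrightarrow> z2 v = 0 \<Longrightarrow> v \<in> span {\<xi> 3 c x}"
    and al: "alpha \<eta> c x = one_form z0 \<and>\<^sub>f one_form z1" and al3: "alpha_i \<eta> 3 c x = model_alpha3 z0 z1"
    and et: "eta_c \<eta> c x = cnj_form (one_form z2)"
    using three_sasakian_coframe[where \<eta> = \<eta> and \<xi> = \<xi> and g = g and \<Phi> = \<Phi>, OF S x d\<eta> homd] by blast
  have th: "eta_eta_bar \<eta> c x = model_theta z2"
    by (simp add: eta_eta_bar_def et model_theta_def cnj_form_cnj_form)
  have al': "A1 x +\<^sub>f \<i> *\<^sub>f A2 x = one_form z0 \<and>\<^sub>f one_form z1"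
    using al by (simp add: alpha_eq A[OF x])
  have et': "\<eta> 1 c x +\<^sub>f (- \<i>) *\<^sub>f \<eta> 2 c x = one_form z2"
    using cnj_eta[OF x] by (simp add: et cnj_form_cnj_form)
  note dd = ext_d_omega[OF U x sm[OF I(1)] sm[OF I(2)] sm[OF I(3)] hom[OF I(1) x] hom[OF I(2) x] hom[OF I(3) x]
      homd[OF I(1)] homd[OF I(2)] homd[OF I(3)]]
    ext_d_Omega[OF U x sm[OF I(1)] sm[OF I(2)] sm[OF I(3)] hom[OF I(1) x] hom[OF I(2) x] hom[OF I(3) x]
      homd[OF I(1)] homd[OF I(2)] homd[OF I(3)]]
  show ?thesis
  proof (rule that)
    show "linear z0" "linear z1" "linear z2" "z0 (\<xi> 3 c x) = 0" "z1 (\<xi> 3 c x) = 0" "z2 (\<xi> 3 c x) = 0"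
      by (fact z)+
    show "\<exists>v. z0 v = p \<and> z1 v = q \<and> z2 v = r" for p q r by (fact z)
    show "v \<in> span {\<xi> 3 c x}" if "z0 v = 0" "z1 v = 0" "z2 v = 0" for v using that by (fact z)
    show "model_forms a b k (omega_ab \<eta> a b c x) (Omega_c \<eta> k c x) (eta_eta_bar \<eta> c x)
       (ext_d (omega_ab \<eta> a b c) x) (ext_d (Omega_c \<eta> k c) x) z0 z1 z2"
      unfolding model_forms_def
      proof (intro conjI allI)
        show "omega_ab \<eta> a b c x = model_omega a b z0 z1 z2"
          by (simp add: omega_ab_eq al3 th model_omega_def)
        show "Omega_c \<eta> k c x = model_Omega k z0 z1 z2"
          by (simp add: Omega_c_eq al et cnj_form_cnj_form model_Omega_def wedge_assoc)
        show "eta_eta_bar \<eta> c x = model_theta z2" by (rule th)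
        show "ext_d (omega_ab \<eta> a b c) x vs = of_real (2 * (a + b\<^sup>2) * Im (model_Omega 1 z0 z1 z2 vs))" for vs
        proof -
          have "ext_d (omega_ab \<eta> a b c) x =
              ext_d (\<lambda>y. of_real a *\<^sub>f A3 y +\<^sub>f (- of_real (b\<^sup>2)) *\<^sub>f (\<eta> 1 c y \<and>\<^sub>f \<eta> 2 c y)) x"
          proof (rule ext_d_cong_open[OF U x])
            fix y assume y: "y \<in> U"
            have c: "(- \<i> / 2 * of_real (b\<^sup>2)) * (- 2 * \<i>) = - complex_of_real (b\<^sup>2)"
              by (simp add: complex_eq_iff)
            show "omega_ab \<eta> a b c y = of_real a *\<^sub>f A3 y +\<^sub>f (- of_real (b\<^sup>2)) *\<^sub>f (\<eta> 1 c y \<and>\<^sub>f \<eta> 2 c y)"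
              by (simp only: omega_ab_eq A[OF y] eeb[OF y] form_scale_scale c)
          qed
          also have "\<dots> = of_real (2 * (a + b\<^sup>2)) *\<^sub>f ((A2 x \<and>\<^sub>f \<eta> 1 c x) +\<^sub>f (-1) *\<^sub>f (A1 x \<and>\<^sub>f \<eta> 2 c x))"
            unfolding A1_def A2_def A3_def alpha_of_def by (rule dd(1))
          finally have 1: "ext_d (omega_ab \<eta> a b c) x vs =
              of_real (2 * (a + b\<^sup>2)) * ((A2 x \<and>\<^sub>f \<eta> 1 c x) vs - (A1 x \<and>\<^sub>f \<eta> 2 c x) vs)"
            by (simp add: form_add_def form_scale_def)
          have "model_Omega 1 z0 z1 z2 = (A1 x +\<^sub>f \<i> *\<^sub>f A2 x) \<and>\<^sub>f (\<eta> 1 c x +\<^sub>f (- \<i>) *\<^sub>f \<eta> 2 c x)"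
            by (simp add: al' et' model_Omega_def wedge_assoc form_scale_one)
          then have 2: "model_Omega 1 z0 z1 z2 vs = (A1 x \<and>\<^sub>f \<eta> 1 c x) vs + (A2 x \<and>\<^sub>f \<eta> 2 c x) vs +
              \<i> * ((A2 x \<and>\<^sub>f \<eta> 1 c x) vs - (A1 x \<and>\<^sub>f \<eta> 2 c x) vs)"
            by (simp add: wedge_expand form_add_def form_scale_def algebra_simps)
          \<comment> \<open>Products of real forms are real, so the imaginary part of
            \<open>\<alpha> \<and> cnj \<eta>\<close> is the bracket that occurs in
            \<open>d\<omega>\<close>.\<close>
          have im: "Im ((\<alpha> \<and>\<^sub>f \<beta>) vs) = 0" if "cnj_form \<alpha> = \<alpha>" "cnj_form \<beta> = \<beta>" for \<alpha> \<beta> :: "(real^7) mform"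
          proof -
            have "cnj_form (\<alpha> \<and>\<^sub>f \<beta>) vs = (\<alpha> \<and>\<^sub>f \<beta>) vs" by (simp add: cnj_form_wedge that)
            then show ?thesis by (simp add: cnj_form_def complex_eq_iff)
          qed
          show ?thesis
            unfolding 1 2
            by (simp add: complex_eq_iff im[OF real_A(1) real_\<eta>[OF I(1) x]] im[OF real_A(1) real_\<eta>[OF I(2) x]]
                im[OF real_A(2) real_\<eta>[OF I(1) x]] im[OF real_A(2) real_\<eta>[OF I(2) x]])
        qed
        show "ext_d (Omega_c \<eta> k c) x = k *\<^sub>f
          (2 *\<^sub>f (one_form z0 \<and>\<^sub>f one_form z1 \<and>\<^sub>f cnj_form (one_form z0) \<and>\<^sub>f cnj_form (one_form z1)) +\<^sub>f
           (- 2 * \<i>) *\<^sub>f (model_alpha3 z0 z1 \<and>\<^sub>f model_theta z2))"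
        proof -
          let ?X = "\<lambda>y. (A1 y +\<^sub>f \<i> *\<^sub>f A2 y) \<and>\<^sub>f (\<eta> 1 c y +\<^sub>f (- \<i>) *\<^sub>f \<eta> 2 c y)"
          have smA: "smooth_form U A1" "smooth_form U A2"
            unfolding A1_def A2_def alpha_of_def using sm
            by (intro smooth_form_scale smooth_form_add smooth_form_ext_d smooth_form_wedge U; simp)+
          have dX: "differentiable_form ?X x"
            by (intro smooth_form_differentiable[OF _ x] smooth_form_wedge smooth_form_add smooth_form_scale U smA
                sm I)
          have "ext_d (Omega_c \<eta> k c) x = ext_d (\<lambda>y. k *\<^sub>f ?X y) x"
            by (rule ext_d_cong_open[OF U x]) (simp add: Omega_c_eq alpha_eq A cnj_eta)
          also have "\<dots> = k *\<^sub>f ext_d ?X x" by (rule ext_d_scale[OF dX])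
          also have "ext_d ?X x = 2 *\<^sub>f ((A1 x +\<^sub>f \<i> *\<^sub>f A2 x) \<and>\<^sub>f (A1 x +\<^sub>f (- \<i>) *\<^sub>f A2 x)) +\<^sub>f
            (- 2 * \<i>) *\<^sub>f (A3 x \<and>\<^sub>f (\<eta> 1 c x +\<^sub>f \<i> *\<^sub>f \<eta> 2 c x) \<and>\<^sub>f (\<eta> 1 c x +\<^sub>f (- \<i>) *\<^sub>f \<eta> 2 c x))"
            unfolding A1_def A2_def A3_def alpha_of_def by (rule dd(2))
          also have "A1 x +\<^sub>f (- \<i>) *\<^sub>f A2 x = cnj_form (A1 x +\<^sub>f \<i> *\<^sub>f A2 x)"
            by (simp add: cnj_form_add cnj_form_scale real_A)
          also have "\<eta> 1 c x +\<^sub>f \<i> *\<^sub>f \<eta> 2 c x = cnj_form (one_form z2)"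
            using et by (simp add: eta_c_eq)
          also have "A3 x = model_alpha3 z0 z1" using al3 A[OF x] by simp
          finally show ?thesis
            by (simp add: al' et' cnj_form_wedge wedge_assoc model_theta_def)
        qed
      qed
  qed
qed

section \<open>Descent to the leaf space\<close>

lemma three_sasakian_orbifoldD:
  assumes "three_sasakian_orbifold S g \<xi> \<eta> \<Phi>" "c \<in> orb_atlas S"
  shows "open (chart_dom c)"
    "three_sasakian_on (chart_dom c) (g c) (\<lambda>i. \<xi> i c) (\<lambda>i. \<eta> i c) (\<lambda>i. \<Phi> i c)"
  using assms by (auto simp: three_sasakian_orbifold_def orbifold_def uniformizing_chart_def)

lemma smooth_form_alpha_i:
  assumes U: "open U" and \<eta>: "\<And>i. i \<in> {1..3} \<Longrightarrow> smooth_form U (\<eta> i c)" and i: "i \<in> {1..3}"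
  shows "smooth_form U (alpha_i \<eta> i c)"
proof -
  have "smooth_on U (\<lambda>x. ext_d (\<eta> i c) x vs)" for vs
    using smooth_form_ext_d[OF U \<eta>[OF i]] by (simp add: smooth_form_def)
  moreover have "smooth_on U (\<lambda>x. (\<eta> j c x \<and>\<^sub>f \<eta> k c x) vs)" if "j \<in> {1..3}" "k \<in> {1..3}" for j k vs
    using smooth_form_wedge[OF U \<eta>[OF that(1)] \<eta>[OF that(2)]] by (simp add: smooth_form_def)
  ultimately show ?thesis
    unfolding smooth_form_def alpha_i_def
    by (intro allI smooth_on_bounded_linear[OF U bounded_linear_divide] smooth_on_diff[OF U]
        smooth_on_sum[OF U] smooth_on_mult[OF U] smooth_on_const)
qed

lemma smooth_form_invariant_forms:
  assumes U: "open U" and \<eta>: "\<And>i. i \<in> {1..3} \<Longrightarrow> smooth_form U (\<eta> i c)"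
  shows "smooth_form U (omega_ab \<eta> a b c)" "smooth_form U (Omega_c \<eta> k c)"
proof -
  have I: "1 \<in> {1..3::nat}" "2 \<in> {1..3::nat}" "3 \<in> {1..3::nat}" by auto
  note al = smooth_form_alpha_i[where \<eta> = \<eta>, OF U \<eta>]
  have e: "smooth_form U (eta_c \<eta> c)"
    using smooth_form_add[OF U \<eta>[OF I(1)] smooth_form_scale[OF U \<eta>[OF I(2)], of \<i>]] by (simp add: eta_c_eq[abs_def])
  have a: "smooth_form U (alpha \<eta> c)"
    using smooth_form_add[OF U al[OF _ I(1)] smooth_form_scale[OF U al[OF _ I(2)], of \<i>]] by (simp add: alpha_eq[abs_def])
  have eb: "smooth_form U (eta_eta_bar \<eta> c)"
    using smooth_form_wedge[OF U e smooth_form_cnj[OF U e]] by (simp add: eta_eta_bar_def[abs_def])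
  show "smooth_form U (omega_ab \<eta> a b c)"
    unfolding omega_ab_eq[abs_def] by (intro smooth_form_add smooth_form_scale U al I eb)
  show "smooth_form U (Omega_c \<eta> k c)"
    unfolding Omega_c_eq[abs_def] by (intro smooth_form_scale smooth_form_wedge smooth_form_cnj U a e)
qed

context
  fixes S :: "(real^7, 's) orbifold_data"
    and g :: "(real^7, 's) chart \<Rightarrow> (real^7) metric"
    and \<xi> :: "nat \<Rightarrow> (real^7, 's) chart \<Rightarrow> real^7 \<Rightarrow> real^7"
    and \<eta> :: "nat \<Rightarrow> (real^7, 's) oform"
    and \<Phi> :: "nat \<Rightarrow> (real^7, 's) chart \<Rightarrow> real^7 \<Rightarrow> real^7 \<Rightarrow> real^7"
  assumes S: "three_sasakian_orbifold S g \<xi> \<eta> \<Phi>"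
begin

lemma local_model:
  fixes a b :: real and k :: complex
  assumes c: "c \<in> orb_atlas S" and x: "x \<in> chart_dom c"
  obtains z0 z1 z2 where "linear z0" "linear z1" "linear z2"
    "z0 (\<xi> 3 c x) = 0" "z1 (\<xi> 3 c x) = 0" "z2 (\<xi> 3 c x) = 0"
    "\<And>p q r. \<exists>v. z0 v = p \<and> z1 v = q \<and> z2 v = r"
    "\<And>v. z0 v = 0 \<Longrightarrow> z1 v = 0 \<Longrightarrow> z2 v = 0 \<Longrightarrow> v \<in> span {\<xi> 3 c x}"
    "model_forms a b k (omega_ab \<eta> a b c x) (Omega_c \<eta> k c x) (eta_eta_bar \<eta> c x)
       (ext_d (omega_ab \<eta> a b c) x) (ext_d (Omega_c \<eta> k c) x) z0 z1 z2"
proof -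
  show ?thesis
    by (rule three_sasakian_local_model[where g = g and \<xi> = \<xi> and \<eta> = \<eta> and \<Phi> = \<Phi>,
        OF three_sasakian_orbifoldD[OF S c] x]) (fact that)
qed

lemma eta_smooth: "c \<in> orb_atlas S \<Longrightarrow> i \<in> {1..3} \<Longrightarrow> form_on (chart_dom c) 1 (\<eta> i c)"
  using three_sasakian_one_form[OF three_sasakian_orbifoldD[OF S]] by blast

text \<open>Alternation is read off from the model at each point, smoothness from the forms
  \<open>\<eta> i\<close>. The model treats both forms at once; the constants of the other form are
  set to 0.\<close>

lemma invariant_form_on:
  assumes c: "c \<in> orb_atlas S"
  shows "form_on (chart_dom c) 2 (omega_ab \<eta> a b c)" "form_on (chart_dom c) 3 (Omega_c \<eta> k c)"
proof -
  note sm = smooth_form_invariant_forms[where \<eta> = \<eta>, OF three_sasakian_orbifoldD(1)[OF S c]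
      form_on_smooth_form[OF eta_smooth[OF c]]]
  show "form_on (chart_dom c) 2 (omega_ab \<eta> a b c)"
  proof (rule form_onI[OF _ sm(1)])
    fix x assume x: "x \<in> chart_dom c"
    show "alternating_form 2 (omega_ab \<eta> a b c x)"
      by (rule local_model[OF c x, of a b 0]) (simp add: alternating_model_omega model_forms_def)
  qed
  show "form_on (chart_dom c) 3 (Omega_c \<eta> k c)"
  proof (rule form_onI[OF _ sm(2)])
    fix x assume x: "x \<in> chart_dom c"
    show "alternating_form 3 (Omega_c \<eta> k c x)"
      by (rule local_model[OF c x, of 0 0 k]) (simp add: alternating_model_Omega model_forms_def)
  qed
qed

text \<open>\<open>\<eta> i\<close> is the metric dual of \<open>\<xi> i\<close>, and transitions
  preserve both the metric and the Reeb fields.\<close>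

lemma pullback_eta:
  assumes c: "c \<in> orb_atlas S" and d: "d \<in> orb_atlas S" and h: "transition c d W h" and x: "x \<in> W"
    and i: "i \<in> {1..3}"
  shows "pullback h (\<eta> i d) x = \<eta> i c x"
proof
  fix vs
  have hx: "h x \<in> chart_dom d" "x \<in> chart_dom c" using h x by (auto simp: transition_def)
  have gi: "g d (h x) (dd h x u) (dd h x v) = g c x u v" for u v
    using S c d h x unfolding three_sasakian_orbifold_def orbifold_metric_def by blast
  have xi: "dd h x (\<xi> i c x) = \<xi> i d (h x)"
    using S c d h x i unfolding three_sasakian_orbifold_def orbifold_vector_field_def by blast
  note e = three_sasakian_onD(3)[OF three_sasakian_orbifoldD(2)[OF S d] hx(1) i]
    three_sasakian_onD(3)[OF three_sasakian_orbifoldD(2)[OF S c] hx(2) i]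
  show "pullback h (\<eta> i d) x vs = \<eta> i c x vs"
    using e gi[of "\<xi> i c x"] by (auto simp: pullback_def form1_def xi split: list.split)
qed

lemma pullback_alpha_i:
  assumes c: "c \<in> orb_atlas S" and d: "d \<in> orb_atlas S" and h: "transition c d W h" and x: "x \<in> W"
    and i: "i \<in> {1..3}"
  shows "pullback h (alpha_i \<eta> i d) x = alpha_i \<eta> i c x"
proof
  fix vs
  have W: "open W" "h ` W \<subseteq> chart_dom d" "smooth_on W h" using h by (auto simp: transition_def)
  have "ext_d (\<eta> i d) (h x) (map (dd h x) vs) = ext_d (pullback h (\<eta> i d)) x vs"
    by (rule ext_d_pullback[symmetric, OF W(1) x three_sasakian_orbifoldD(1)[OF S d] W(2,3) eta_smooth[OF d i]]) simp
  also have "ext_d (pullback h (\<eta> i d)) x = ext_d (\<eta> i c) x"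
    by (rule ext_d_cong_open[OF W(1) x]) (rule pullback_eta[OF c d h _ i])
  finally have 1: "ext_d (\<eta> i d) (h x) (map (dd h x) vs) = ext_d (\<eta> i c) x vs" .
  have "(\<lambda>us. \<eta> j d (h x) (map (dd h x) us)) = \<eta> j c x" if "j \<in> {1..3}" for j
    using pullback_eta[OF c d h x that] by (simp add: fun_eq_iff pullback_def)
  then have "(\<eta> j d (h x) \<and>\<^sub>f \<eta> k d (h x)) (map (dd h x) vs) = (\<eta> j c x \<and>\<^sub>f \<eta> k c x) vs"
    if "j \<in> {1..3}" "k \<in> {1..3}" for j k
    using that by (simp add: wedge_map)
  then show "pullback h (alpha_i \<eta> i d) x vs = alpha_i \<eta> i c x vs"
    by (simp add: pullback_def alpha_i_def 1)
qed

lemma pullback_invariant_forms: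
  assumes c: "c \<in> orb_atlas S" and d: "d \<in> orb_atlas S" and h: "transition c d W h" and x: "x \<in> W"
  shows "pullback h (omega_ab \<eta> a b d) x = omega_ab \<eta> a b c x"
    "pullback h (Omega_c \<eta> k d) x = Omega_c \<eta> k c x"
proof -
  note p = pullback_eta[OF c d h x, unfolded fun_eq_iff pullback_def]
    pullback_alpha_i[OF c d h x, unfolded fun_eq_iff pullback_def]
  have e: "(\<lambda>us. eta_c \<eta> d (h x) (map (dd h x) us)) = eta_c \<eta> c x"
    "(\<lambda>us. cnj_form (eta_c \<eta> d (h x)) (map (dd h x) us)) = cnj_form (eta_c \<eta> c x)"
    "(\<lambda>us. alpha \<eta> d (h x) (map (dd h x) us)) = alpha \<eta> c x"
    by (auto simp: fun_eq_iff cnj_form_def eta_c_def alpha_def p)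
  show "pullback h (omega_ab \<eta> a b d) x = omega_ab \<eta> a b c x"
    by (rule ext) (simp add: pullback_def omega_ab_def eta_eta_bar_def wedge_map e p)
  show "pullback h (Omega_c \<eta> k d) x = Omega_c \<eta> k c x"
    by (rule ext) (simp add: pullback_def Omega_c_def wedge_map e)
qed

text \<open>The coframe annihilates \<open>\<xi> 3\<close>, and \<omega>, \<Omega> and their
  exterior derivatives are all expressed in it; the Lie derivatives then vanish by Cartan's
  formula.\<close>

lemma basic_invariant_forms:
  "basic_form S (\<xi> 3) 2 (omega_ab \<eta> a b)" "basic_form S (\<xi> 3) 3 (Omega_c \<eta> k)"
proof -
  have contr: "contraction X \<beta> x vs = insertion (X x) (\<beta> x) vs" for X :: "real^7 \<Rightarrow> real^7" and \<beta> x vs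
    by (simp add: contraction_def insertion_def)
  have om: "contraction (\<xi> 3 c) (omega_ab \<eta> a b c) x vs = 0" "contraction (\<xi> 3 c) (ext_d (omega_ab \<eta> a b c)) x vs = 0"
    "contraction (\<xi> 3 c) (Omega_c \<eta> k c) x vs = 0" "contraction (\<xi> 3 c) (ext_d (Omega_c \<eta> k c)) x vs = 0"
    if c: "c \<in> orb_atlas S" and x: "x \<in> chart_dom c" for c x vs
  proof -
    obtain z0 z1 z2 where z: "z0 (\<xi> 3 c x) = 0" "z1 (\<xi> 3 c x) = 0" "z2 (\<xi> 3 c x) = 0"
      and mf: "model_forms a b k (omega_ab \<eta> a b c x) (Omega_c \<eta> k c x) (eta_eta_bar \<eta> c x)
       (ext_d (omega_ab \<eta> a b c) x) (ext_d (Omega_c \<eta> k c) x) z0 z1 z2"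
      using local_model[OF c x, where a = a and b = b and k = k] by metis
    note e = mf[unfolded model_forms_def, THEN conjunct1]
      mf[unfolded model_forms_def, THEN conjunct2, THEN conjunct1]
    note d1 = mf[unfolded model_forms_def, THEN conjunct2, THEN conjunct2, THEN conjunct2, THEN conjunct1, rule_format]
    note d2 = mf[unfolded model_forms_def, THEN conjunct2, THEN conjunct2, THEN conjunct2, THEN conjunct2]
    note iz = insertion_model_zero[of z0 _ z1 z2, OF z]
    show "contraction (\<xi> 3 c) (omega_ab \<eta> a b c) x vs = 0" "contraction (\<xi> 3 c) (Omega_c \<eta> k c) x vs = 0"
      by (simp_all add: contr e iz form_zero_def)
    have "model_Omega 1 z0 z1 z2 (\<xi> 3 c x # vs) = 0"
      using fun_cong[OF iz(4), of 1 vs] by (simp add: insertion_def form_zero_def)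
    then show "contraction (\<xi> 3 c) (ext_d (omega_ab \<eta> a b c)) x vs = 0"
      by (simp add: contraction_def d1)
    have "insertion (\<xi> 3 c x) (ext_d (Omega_c \<eta> k c) x) = 0\<^sub>f"
      unfolding d2
      by (simp add: insertion_add insertion_scale insertion_wedge_zero iz insertion_one_form_zero z insertion_cnj_form
          cnj_form_zero form_scale_zero)
    then show "contraction (\<xi> 3 c) (ext_d (Omega_c \<eta> k c)) x vs = 0"
      by (simp add: contr form_zero_def)
  qed
  have lie: "lie_derivative (\<xi> 3 c) (omega_ab \<eta> a b c) x vs = 0" "lie_derivative (\<xi> 3 c) (Omega_c \<eta> k c) x vs = 0"
    if c: "c \<in> orb_atlas S" and x: "x \<in> chart_dom c" for c x vs
  proof -
    have X: "smooth_on (chart_dom c) (\<xi> 3 c)"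
      by (rule three_sasakian_onD(2)[OF three_sasakian_orbifoldD(2)[OF S c]]) simp
    note l = lie_derivative_eq_0[OF three_sasakian_orbifoldD(1)[OF S c] x X]
    show "lie_derivative (\<xi> 3 c) (omega_ab \<eta> a b c) x vs = 0"
      by (rule l[OF invariant_form_on(1)[OF c]]) (simp_all add: om c x)
    show "lie_derivative (\<xi> 3 c) (Omega_c \<eta> k c) x vs = 0"
      by (rule l[OF invariant_form_on(2)[OF c]]) (simp_all add: om c x)
  qed
  show "basic_form S (\<xi> 3) 2 (omega_ab \<eta> a b)" "basic_form S (\<xi> 3) 3 (Omega_c \<eta> k)"
    unfolding basic_form_def orbifold_form_def
    by (auto simp: invariant_form_on pullback_invariant_forms om lie)
qed

end

section \<open>Passage of the pointwise model to the quotient by the leaves\<close>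

lemma model_map:
  assumes "\<And>u. z0' (D u) = z0 u" "\<And>u. z1' (D u) = z1 u" "\<And>u. z2' (D u) = z2 u"
  shows "model_omega a b z0' z1' z2' (map D us) = model_omega a b z0 z1 z2 us"
    "model_Omega c z0' z1' z2' (map D us) = model_Omega c z0 z1 z2 us"
    "model_theta z2' (map D us) = model_theta z2 us"
    "(k *\<^sub>f (2 *\<^sub>f (one_form z0' \<and>\<^sub>f one_form z1' \<and>\<^sub>f cnj_form (one_form z0') \<and>\<^sub>f cnj_form (one_form z1')) +\<^sub>f
       (- 2 * \<i>) *\<^sub>f (model_alpha3 z0' z1' \<and>\<^sub>f model_theta z2'))) (map D us) =
     (k *\<^sub>f (2 *\<^sub>f (one_form z0 \<and>\<^sub>f one_form z1 \<and>\<^sub>f cnj_form (one_form z0) \<and>\<^sub>f cnj_form (one_form z1)) +\<^sub>f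
       (- 2 * \<i>) *\<^sub>f (model_alpha3 z0 z1 \<and>\<^sub>f model_theta z2))) us"
proof -
  have o: "(\<lambda>us. one_form \<phi>' (map D us)) = one_form \<phi>" "(\<lambda>us. cnj_form (one_form \<phi>') (map D us)) = cnj_form (one_form \<phi>)"
    if "\<And>u. \<phi>' (D u) = \<phi> u" for \<phi>' \<phi>
    using that by (auto simp: fun_eq_iff one_form_def cnj_form_def split: list.split)
  note s = form_add_def form_scale_def wedge_map o[of z0' z0, OF assms(1)] o[of z1' z1, OF assms(2)] o[of z2' z2, OF assms(3)]
  have t: "(\<lambda>us. model_alpha3 z0' z1' (map D us)) = model_alpha3 z0 z1" "(\<lambda>us. model_theta z2' (map D us)) = model_theta z2"
    by (simp_all add: fun_eq_iff model_alpha3_def model_theta_def s)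
  note t' = t[THEN fun_cong]
  show "model_theta z2' (map D us) = model_theta z2 us" by (rule t'(2))
  show "model_omega a b z0' z1' z2' (map D us) = model_omega a b z0 z1 z2 us"
    by (simp add: model_omega_def s t')
  show "model_Omega c z0' z1' z2' (map D us) = model_Omega c z0 z1 z2 us"
    by (simp add: model_Omega_def s)
  show "(k *\<^sub>f (2 *\<^sub>f (one_form z0' \<and>\<^sub>f one_form z1' \<and>\<^sub>f cnj_form (one_form z0') \<and>\<^sub>f cnj_form (one_form z1')) +\<^sub>f
       (- 2 * \<i>) *\<^sub>f (model_alpha3 z0' z1' \<and>\<^sub>f model_theta z2'))) (map D us) =
     (k *\<^sub>f (2 *\<^sub>f (one_form z0 \<and>\<^sub>f one_form z1 \<and>\<^sub>f cnj_form (one_form z0) \<and>\<^sub>f cnj_form (one_form z1)) +\<^sub>f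
       (- 2 * \<i>) *\<^sub>f (model_alpha3 z0 z1 \<and>\<^sub>f model_theta z2))) us"
    by (simp add: s t)
qed

text \<open>\<open>z'\<close> is \<open>z\<close> composed with a right inverse of \<open>D\<close>;
  two preimages of a vector differ by an element of the kernel of \<open>D\<close>, where
  \<open>z\<close> vanishes.\<close>

lemma quotient_functional:
  fixes D :: "'v::real_vector \<Rightarrow> 'w::real_vector" and z :: "'v \<Rightarrow> 'u::real_vector"
  assumes D: "linear D" "surj D" and z: "linear z" and k: "\<And>v. D v = 0 \<Longrightarrow> z v = 0"
  obtains z' where "linear z'" "\<And>u. z' (D u) = z u"
proof
  define z' where "z' w = z (inv_into UNIV D w)" for w
  show e: "z' (D u) = z u" for u
  proof -
    have "D (inv_into UNIV D (D u) - u) = 0" by (simp add: linear_diff[OF D(1)] surj_f_inv_f[OF D(2)])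
    then show ?thesis using k[of "inv_into UNIV D (D u) - u"] by (simp add: z'_def linear_diff[OF z])
  qed
  show "linear z'"
  proof (rule linearI)
    fix p q :: 'w and r :: real
    obtain u v where "p = D u" "q = D v" using D(2) by (meson surjD)
    then show "z' (p + q) = z' p + z' q" "z' (r *\<^sub>R p) = r *\<^sub>R z' p"
      using e[of "u + v"] e[of "r *\<^sub>R u"] by (simp_all add: e linear_add[OF D(1)] linear_add[OF z] linear_cmul[OF D(1)] linear_cmul[OF z])
  qed
qed

text \<open>The kernel of the differential of a lift is spanned by \<open>\<xi> 3\<close>, as is the
  common kernel of the coframe on \<open>S\<close>. Hence the coframe factors through the
  differential and stays injective on the quotient. As the claim concerns one point
  \<open>y\<close>, a single lift through \<open>y\<close> is enough.\<close>

lemma quotient_local_model: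
  fixes S :: "(real^7, 's) orbifold_data" and Z :: "(real^6, 'z) orbifold_data" and a b :: real and k :: complex
  assumes S: "three_sasakian_orbifold S g \<xi> \<eta> \<Phi>" and Q: "leaf_quotient S (\<xi> 3) \<rho> Z q"
    and \<omega>: "descends_to S (\<xi> 3) Z q 2 (omega_ab \<eta> a b) \<omega>" and \<Omega>: "descends_to S (\<xi> 3) Z q 3 (Omega_c \<eta> k) \<Omega>"
    and d: "d \<in> orb_atlas Z" and y: "y \<in> chart_dom d"
  obtains z0 z1 z2 where "linear z0" "linear z1" "linear z2"
    "\<And>p q r. \<exists>v. z0 v = p \<and> z1 v = q \<and> z2 v = r"
    "\<And>v. z0 v = 0 \<Longrightarrow> z1 v = 0 \<Longrightarrow> z2 v = 0 \<Longrightarrow> v = 0"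
    "model_forms a b k (\<omega> d y) (\<Omega> d y) (model_theta z2) (ext_d (\<omega> d) y) (ext_d (\<Omega> d) y) z0 z1 z2"
    "\<And>\<theta>. descends_to S (\<xi> 3) Z q 2 (eta_eta_bar \<eta>) \<theta> \<Longrightarrow> \<theta> d y = model_theta z2"
proof -
  have orb: "orbifold Z" "quotient_map (orb_space S) (orb_space Z) q"
    and lift: "\<And>c x. c \<in> orb_atlas S \<Longrightarrow> x \<in> chart_dom c \<Longrightarrow> q (chart_map c x) = chart_map d y \<Longrightarrow>
      \<exists>W f. submersive_lift (\<xi> 3) q c d W f \<and> x \<in> W \<and> f x = y"
    using Q d y by (auto simp: leaf_quotient_def)
  have "chart_map d y \<in> topspace (orb_space Z)"
    using orb(1) d y by (auto simp: orbifold_def)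
  then obtain p where p: "p \<in> topspace (orb_space S)" "q p = chart_map d y"
    using quotient_imp_surjective_map[OF orb(2)] by force
  have "topspace (orb_space S) = (\<Union>c\<in>orb_atlas S. chart_map c ` chart_dom c)"
    using S by (simp add: three_sasakian_orbifold_def orbifold_def)
  with p obtain c x where c: "c \<in> orb_atlas S" and x: "x \<in> chart_dom c" and px: "p = chart_map c x" by auto
  obtain W f where sl: "submersive_lift (\<xi> 3) q c d W f" and xW: "x \<in> W" and fx: "f x = y"
    using lift[OF c x] p px by auto
  have W: "open W" "W \<subseteq> chart_dom c" "f ` W \<subseteq> chart_dom d" "smooth_on W f"
    and surj: "surj (dd f x)" and ker: "{v. dd f x v = 0} = span {\<xi> 3 c x}"
    using sl xW by (auto simp: submersive_lift_def)
  let ?D = "dd f x"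
  have D: "linear ?D" by (rule linear_frechet_derivative[OF smooth_on_differentiable[OF W(4) xW]])
  have V: "open (chart_dom d)" using orb(1) d by (auto simp: orbifold_def uniformizing_chart_def)
  have pw: "pullback f (\<omega> d) x' = omega_ab \<eta> a b c x'" "pullback f (\<Omega> d) x' = Omega_c \<eta> k c x'" if "x' \<in> W" for x'
    using \<omega> \<Omega> c d sl that unfolding descends_to_def by blast+
  have fo: "form_on (chart_dom d) 2 (\<omega> d)" "form_on (chart_dom d) 3 (\<Omega> d)"
    using \<omega> \<Omega> d by (auto simp: descends_to_def orbifold_form_def)
  obtain z0 z1 z2 where lin: "linear z0" "linear z1" "linear z2"
    and zk: "z0 (\<xi> 3 c x) = 0" "z1 (\<xi> 3 c x) = 0" "z2 (\<xi> 3 c x) = 0"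
    and zs: "\<And>p q r. \<exists>v. z0 v = p \<and> z1 v = q \<and> z2 v = r"
    and zi: "\<And>v. z0 v = 0 \<Longrightarrow> z1 v = 0 \<Longrightarrow> z2 v = 0 \<Longrightarrow> v \<in> span {\<xi> 3 c x}"
    and mf: "model_forms a b k (omega_ab \<eta> a b c x) (Omega_c \<eta> k c x) (eta_eta_bar \<eta> c x)
       (ext_d (omega_ab \<eta> a b c) x) (ext_d (Omega_c \<eta> k c) x) z0 z1 z2"
  proof -
    show thesis
      by (rule local_model[OF S c x, where a = a and b = b and k = k]) (fact that)
  qed
  note e = mf[unfolded model_forms_def, THEN conjunct1]
    mf[unfolded model_forms_def, THEN conjunct2, THEN conjunct1]
    mf[unfolded model_forms_def, THEN conjunct2, THEN conjunct2, THEN conjunct1]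
  note d1 = mf[unfolded model_forms_def, THEN conjunct2, THEN conjunct2, THEN conjunct2, THEN conjunct1, rule_format]
  note d2 = mf[unfolded model_forms_def, THEN conjunct2, THEN conjunct2, THEN conjunct2, THEN conjunct2]
  have kz: "z v = 0" if "linear z" "z (\<xi> 3 c x) = 0" "?D v = 0" for z :: "real^7 \<Rightarrow> complex" and v
  proof -
    have "v \<in> span {\<xi> 3 c x}" using ker that(3) by blast
    then obtain t where "v = t *\<^sub>R \<xi> 3 c x" by (auto simp: span_singleton)
    then show ?thesis by (simp add: linear_cmul[OF that(1)] that(2))
  qed
  obtain z0' where z0: "linear z0'" "\<And>u. z0' (?D u) = z0 u"
    using quotient_functional[OF D surj lin(1)] kz[OF lin(1) zk(1)] by blast
  obtain z1' where z1: "linear z1'" "\<And>u. z1' (?D u) = z1 u"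
    using quotient_functional[OF D surj lin(2)] kz[OF lin(2) zk(2)] by blast
  obtain z2' where z2: "linear z2'" "\<And>u. z2' (?D u) = z2 u"
    using quotient_functional[OF D surj lin(3)] kz[OF lin(3) zk(3)] by blast
  note mm = model_map[of z0' ?D z0 z1' z1 z2' z2, OF z0(2) z1(2) z2(2)]
  \<comment> \<open>The differential is onto, so a form at \<open>y\<close> is determined by its
    values on images of tangent vectors of \<open>S\<close>.\<close>
  have lists: "\<exists>us. vs = map ?D us" for vs
    by (rule exI[of _ "map (inv_into UNIV ?D) vs"]) (simp add: comp_def surj_f_inv_f[OF surj])
  have ext_eq: "\<alpha> = \<beta>" if "\<And>us. \<alpha> (map ?D us) = \<beta> (map ?D us)" for \<alpha> \<beta> :: "(real^6) mform"
  proof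
    fix vs
    obtain us where "vs = map ?D us" using lists by blast
    then show "\<alpha> vs = \<beta> vs" by (simp add: that)
  qed
  show ?thesis
  proof (rule that[OF z0(1) z1(1) z2(1)])
    show "\<exists>v. z0' v = p \<and> z1' v = q \<and> z2' v = r" for p q r
      using zs[of p q r] z0(2) z1(2) z2(2) by metis
    show "v = 0" if "z0' v = 0" "z1' v = 0" "z2' v = 0" for v
    proof -
      obtain u where u: "v = ?D u" using surj by (meson surjD)
      then have "u \<in> span {\<xi> 3 c x}" using that zi z0(2) z1(2) z2(2) by simp
      then show ?thesis using ker u by blast
    qed
    show "\<theta> d y = model_theta z2'" if "descends_to S (\<xi> 3) Z q 2 (eta_eta_bar \<eta>) \<theta>" for \<theta>
    proof -
      have "pullback f (\<theta> d) x = eta_eta_bar \<eta> c x"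
        using that c d sl xW unfolding descends_to_def by blast
      from fun_cong[OF this] show ?thesis by (intro ext_eq) (simp add: mm e pullback_def fx)
    qed
    have m1: "\<omega> d y = model_omega a b z0' z1' z2'"
      using fun_cong[OF pw(1)[OF xW]] by (intro ext_eq) (simp add: mm e pullback_def fx)
    have m2: "\<Omega> d y = model_Omega k z0' z1' z2'"
      using fun_cong[OF pw(2)[OF xW]] by (intro ext_eq) (simp add: mm e pullback_def fx)
    have E1: "ext_d (\<omega> d) y (map ?D us) = ext_d (omega_ab \<eta> a b c) x us" for us
    proof -
      have "ext_d (pullback f (\<omega> d)) x us = ext_d (\<omega> d) (f x) (map ?D us)"
        by (rule ext_d_pullback[OF W(1) xW V W(3,4) fo(1)]) simp
      moreover have "ext_d (pullback f (\<omega> d)) x = ext_d (omega_ab \<eta> a b c) x"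
        by (rule ext_d_cong_open[OF W(1) xW]) (rule pw(1))
      ultimately show ?thesis by (simp add: fx)
    qed
    have E2: "ext_d (\<Omega> d) y (map ?D us) = ext_d (Omega_c \<eta> k c) x us" for us
    proof -
      have "ext_d (pullback f (\<Omega> d)) x us = ext_d (\<Omega> d) (f x) (map ?D us)"
        by (rule ext_d_pullback[OF W(1) xW V W(3,4) fo(2)]) simp
      moreover have "ext_d (pullback f (\<Omega> d)) x = ext_d (Omega_c \<eta> k c) x"
        by (rule ext_d_cong_open[OF W(1) xW]) (rule pw(2))
      ultimately show ?thesis by (simp add: fx)
    qed
    have m3: "ext_d (\<omega> d) y vs = of_real (2 * (a + b\<^sup>2) * Im (model_Omega 1 z0' z1' z2' vs))" for vs
      using lists[of vs] by (auto simp: E1 d1 mm)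
    have m4: "ext_d (\<Omega> d) y = k *\<^sub>f
      (2 *\<^sub>f (one_form z0' \<and>\<^sub>f one_form z1' \<and>\<^sub>f cnj_form (one_form z0') \<and>\<^sub>f cnj_form (one_form z1')) +\<^sub>f
       (- 2 * \<i>) *\<^sub>f (model_alpha3 z0' z1' \<and>\<^sub>f model_theta z2'))"
      by (rule ext_eq) (simp only: mm(4) E2 d2)
    show "model_forms a b k (\<omega> d y) (\<Omega> d y) (model_theta z2') (ext_d (\<omega> d) y) (ext_d (\<Omega> d) y) z0' z1' z2'"
      unfolding model_forms_def using m1 m2 m3 m4 by blast
  qed
qed

section \<open>SU(3)-structures\<close>

text \<open>A real-linear isomorphism of the tangent space with complex 3-space, given by its
  components.\<close>

definition adapted_coframe :: "('v::real_vector \<Rightarrow> complex) \<Rightarrow> ('v \<Rightarrow> complex) \<Rightarrow> ('v \<Rightarrow> complex) \<Rightarrow> bool" where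
  "adapted_coframe z0 z1 z2 \<longleftrightarrow> linear z0 \<and> linear z1 \<and> linear z2 \<and>
     (\<forall>p q r. \<exists>v. z0 v = p \<and> z1 v = q \<and> z2 v = r) \<and>
     (\<forall>v. z0 v = 0 \<and> z1 v = 0 \<and> z2 v = 0 \<longrightarrow> v = 0)"

text \<open>\<open>\<Omega>(J u, v, w) = \<i> \<Omega>(u, v, w)\<close> is extracted from homogeneity of bidegree \<open>(3, 0)\<close> by
  evaluating at the scalars \<open>\<i>\<close>, \<open>1 + \<i>\<close> and \<open>1 - \<i>\<close>.\<close>
lemma type_3_0_rotate:
  assumes alt: "alternating_form 3 \<Omega>" and ty: "type_pq J 3 0 \<Omega>" and JJ: "\<And>u. J (J u) = - u"
  shows "\<Omega> [J u, v, w] = \<i> * \<Omega> [u, v, w]"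
proof -
  have l: "linear (\<lambda>u. \<Omega> [u, v, w])" "linear (\<lambda>v. \<Omega> [u, v, w])" "linear (\<lambda>w. \<Omega> [u, v, w])" for u v w
    using alternating_form_linear[OF alt, of "[]" "[v, w]"] alternating_form_linear[OF alt, of "[u]" "[w]"]
      alternating_form_linear[OF alt, of "[u, v]" "[]"] by simp_all
  note ll = linear_add[OF l(1)] linear_add[OF l(2)] linear_add[OF l(3)]
    linear_diff[OF l(1)] linear_diff[OF l(2)] linear_diff[OF l(3)]
  have h: "\<Omega> [Re z *\<^sub>R u + Im z *\<^sub>R J u, Re z *\<^sub>R v + Im z *\<^sub>R J v, Re z *\<^sub>R w + Im z *\<^sub>R J w] = z ^ 3 * \<Omega> [u, v, w]"
    for z u v w
    using ty[unfolded type_pq_def, rule_format, of "[u, v, w]" z] by simp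
  have cubes: "(1 + \<i>) ^ 3 = - 2 + 2 * \<i>" "(1 - \<i>) ^ 3 = - 2 - 2 * \<i>"
    by (simp_all add: power3_eq_cube complex_eq_iff)
  have s: "\<Omega> [J u, J v, J w] = - \<i> * \<Omega> [u, v, w]" for u v w
    using h[of \<i> u v w] by (simp add: power3_eq_cube)
  have p: "\<Omega> [u + J u, v + J v, w + J w] = (- 2 + 2 * \<i>) * \<Omega> [u, v, w]" for u v w
    using h[of "1 + \<i>" u v w] by (simp only: cubes) simp
  have m: "\<Omega> [u - J u, v - J v, w - J w] = (- 2 - 2 * \<i>) * \<Omega> [u, v, w]" for u v w
    using h[of "1 - \<i>" u v w] by (simp only: cubes) simp
  \<comment> \<open>The difference of the values at \<open>1 + \<i>\<close> and
    \<open>1 - \<i>\<close> isolates the terms with an odd number of \<open>J\<close>.\<close>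
  have e1: "\<Omega> [J u, v, w] + \<Omega> [u, J v, w] + \<Omega> [u, v, J w] = 3 * \<i> * \<Omega> [u, v, w]" for u v w
  proof -
    have "2 * (\<Omega> [J u, v, w] + \<Omega> [u, J v, w] + \<Omega> [u, v, J w]) + 2 * \<Omega> [J u, J v, J w] =
        \<Omega> [u + J u, v + J v, w + J w] - \<Omega> [u - J u, v - J v, w - J w]"
      by (simp only: ll) (simp add: algebra_simps)
    then have "2 * (\<Omega> [J u, v, w] + \<Omega> [u, J v, w] + \<Omega> [u, v, J w]) = 2 * (3 * \<i> * \<Omega> [u, v, w])"
      by (simp only: p m s) (simp add: algebra_simps)
    then show ?thesis by (metis mult_left_cancel zero_neq_numeral)
  qed
  \<comment> \<open>The sum of the two values isolates the terms with an even number of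
    \<open>J\<close>.\<close>
  have e2: "\<Omega> [u, J v, J w] + \<Omega> [J u, v, J w] + \<Omega> [J u, J v, w] = - 3 * \<Omega> [u, v, w]" for u v w
  proof -
    have "2 * (\<Omega> [u, J v, J w] + \<Omega> [J u, v, J w] + \<Omega> [J u, J v, w]) + 2 * \<Omega> [u, v, w] =
        \<Omega> [u + J u, v + J v, w + J w] + \<Omega> [u - J u, v - J v, w - J w]"
      by (simp only: ll) (simp add: algebra_simps)
    then have "2 * (\<Omega> [u, J v, J w] + \<Omega> [J u, v, J w] + \<Omega> [J u, J v, w]) = 2 * (- 3 * \<Omega> [u, v, w])"
      by (simp only: p m) (simp add: algebra_simps add_eq_0_iff)
    then show ?thesis by (metis mult_left_cancel zero_neq_numeral)
  qed
  have n: "\<Omega> [- u, v, w] = - \<Omega> [u, v, w]" for u v w by (rule linear_neg[OF l(1)])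
  \<comment> \<open>\<open>e1\<close> at \<open>J u\<close> evaluates two of the three terms of
    \<open>e2\<close>, because \<open>J\<close> squares to \<open>- 1\<close>.\<close>
  have A: "\<Omega> [u, J v, J w] = - 4 * \<Omega> [u, v, w] - 3 * \<i> * \<Omega> [J u, v, w]" for u v w
  proof -
    have "\<Omega> [u, J v, J w] = (\<Omega> [u, J v, J w] + \<Omega> [J u, v, J w] + \<Omega> [J u, J v, w]) -
        (\<Omega> [J u, v, J w] + \<Omega> [J u, J v, w])" by simp
    also have "\<Omega> [J u, v, J w] + \<Omega> [J u, J v, w] = \<Omega> [u, v, w] + 3 * \<i> * \<Omega> [J u, v, w]"
      using e1[of "J u" v w] by (simp add: JJ n algebra_simps)
    finally show ?thesis unfolding e2 by (simp add: algebra_simps)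
  qed
  \<comment> \<open>\<open>A\<close> at \<open>J u\<close> has \<open>J\<close> in all three slots
    on the left, where the scalar \<open>\<i>\<close> gives the value; the resulting linear equation
    is solved for \<open>\<Omega> [J u, v, w]\<close>.\<close>
  have "- \<i> * \<Omega> [u, v, w] = - 4 * \<Omega> [J u, v, w] + 3 * \<i> * \<Omega> [u, v, w]"
    using A[of "J u" v w] s[of u v w] by (simp add: JJ n)
  then show ?thesis by (simp add: algebra_simps)
qed

context
  fixes z0 z1 z2 :: "'v::euclidean_space \<Rightarrow> complex"
  assumes co: "adapted_coframe z0 z1 z2"
begin

lemma coframe_linear: "linear z0" "linear z1" "linear z2"
  using co by (auto simp: adapted_coframe_def)

lemma coframe_eqI:
  assumes "z0 u = z0 v" "z1 u = z1 v" "z2 u = z2 v" shows "u = v"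
proof -
  have "z0 (u - v) = 0 \<and> z1 (u - v) = 0 \<and> z2 (u - v) = 0"
    using assms coframe_linear by (simp add: linear_diff)
  then have "u - v = 0" using co unfolding adapted_coframe_def by blast
  then show ?thesis by simp
qed

lemma coframe_surj: obtains v where "z0 v = p" "z1 v = q" "z2 v = r"
  using co unfolding adapted_coframe_def by metis

text \<open>Vectors dual to the coframe isolate one component at a time. The case
  \<open>t = \<i>\<close> characterises \<open>J\<close>, and \<open>t = 0\<close> is
  non-degeneracy.\<close>

lemma model_Omega_nondegenerate:
  assumes k: "k \<noteq> 0" and eq: "\<And>p q. model_Omega k z0 z1 z2 [u, p, q] = t * model_Omega k z0 z1 z2 [v, p, q]"
  shows "z0 u = t * z0 v" "z1 u = t * z1 v" "z2 u = t * z2 v"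
proof -
  obtain e0 where e0: "z0 e0 = 1" "z1 e0 = 0" "z2 e0 = 0" by (rule coframe_surj)
  obtain e1 where e1: "z0 e1 = 0" "z1 e1 = 1" "z2 e1 = 0" by (rule coframe_surj)
  obtain e2 where e2: "z0 e2 = 0" "z1 e2 = 0" "z2 e2 = 1" by (rule coframe_surj)
  show "z0 u = t * z0 v" using eq[of e1 e2] k by (simp add: model_Omega_eval e1 e2)
  show "z1 u = t * z1 v" using eq[of e0 e2] k by (simp add: model_Omega_eval e0 e2)
  show "z2 u = t * z2 v" using eq[of e0 e1] k by (simp add: model_Omega_eval e0 e1)
qed

text \<open>The vectors dual to the coframe and their multiples by \<open>\<i>\<close> form a real
  basis, on which the value is computed.\<close>

lemma model_volume_nonzero: "\<exists>vs. model_volume z0 z1 z2 vs \<noteq> 0"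
proof -
  obtain e0 where e0: "z0 e0 = 1" "z1 e0 = 0" "z2 e0 = 0" by (rule coframe_surj)
  obtain e1 where e1: "z0 e1 = 0" "z1 e1 = 1" "z2 e1 = 0" by (rule coframe_surj)
  obtain e2 where e2: "z0 e2 = 0" "z1 e2 = 0" "z2 e2 = 1" by (rule coframe_surj)
  obtain f0 where f0: "z0 f0 = \<i>" "z1 f0 = 0" "z2 f0 = 0" by (rule coframe_surj)
  obtain f1 where f1: "z0 f1 = 0" "z1 f1 = \<i>" "z2 f1 = 0" by (rule coframe_surj)
  obtain f2 where f2: "z0 f2 = 0" "z1 f2 = 0" "z2 f2 = \<i>" by (rule coframe_surj)
  have "model_volume z0 z1 z2 [e0, f0, e1, f1, e2, f2] \<noteq> 0"
    unfolding model_volume_def cnj_form_one_form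
    by (simp add: one_form_wedge_Cons insertion_one_form_wedge insertion_one_form insertion_add insertion_scale
        form_add_def form_scale_def wedge_expand insertion_def e0 e1 e2 f0 f1 f2 del: wedge_power.simps)
      (simp add: complex_eq_iff)
  then show ?thesis by blast
qed

context
  fixes J :: "'v \<Rightarrow> 'v"
  assumes J: "\<And>v. z0 (J v) = \<i> * z0 v" "\<And>v. z1 (J v) = \<i> * z1 v" "\<And>v. z2 (J v) = \<i> * z2 v"
begin

lemma coframe_scale: "z0 (Re t *\<^sub>R v + Im t *\<^sub>R J v) = t * z0 v" "z1 (Re t *\<^sub>R v + Im t *\<^sub>R J v) = t * z1 v"
  "z2 (Re t *\<^sub>R v + Im t *\<^sub>R J v) = t * z2 v"
  using coframe_linear by (simp_all add: linear_add linear_cmul J complex_eq_iff)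

lemma type_model_Omega: "type_pq J 3 0 (model_Omega k z0 z1 z2)"
  by (auto simp: type_pq_def length_Suc_conv numeral_3_eq_3 model_Omega_eval coframe_scale algebra_simps power3_eq_cube)

text \<open>A scalar \<open>t\<close> multiplies each component, and every term pairs a component
  with a conjugated one, which gives \<open>t * cnj t\<close>. The shape of the form is that of
  \<open>W2\<close>.\<close>

lemma type_model_2:
  "type_pq J 1 1 (\<lambda>vs. l * (model_omega a b z0 z1 z2 vs + m * model_theta z2 vs))"
proof -
  have *: "Im (cnj (t * x) * (t * y)) = (cmod t)\<^sup>2 * Im (cnj x * y)" for t x y
    unfolding cmod_power2 by (simp add: power2_eq_square algebra_simps)
  have t: "t * cnj t = of_real ((cmod t)\<^sup>2)" for t by (rule complex_norm_square[symmetric])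
  show ?thesis
    unfolding type_pq_def
  proof (intro allI impI)
    fix t and vs :: "'v list" assume "length vs = 1 + 1"
    then obtain u v where vs: "vs = [u, v]" by (auto simp: length_Suc_conv One_nat_def)
    show "l * (model_omega a b z0 z1 z2 (map (\<lambda>v. Re t *\<^sub>R v + Im t *\<^sub>R J v) vs) +
        m * model_theta z2 (map (\<lambda>v. Re t *\<^sub>R v + Im t *\<^sub>R J v) vs)) =
      t ^ 1 * cnj t ^ 1 * (l * (model_omega a b z0 z1 z2 vs + m * model_theta z2 vs))"
      unfolding vs list.map model_omega_eval model_theta_eval coframe_scale * power_one_right t
      by (simp add: algebra_simps)
  qed
qed

lemma J_square: "J (J v) = - v"
  by (rule coframe_eqI) (use coframe_linear in \<open>simp_all add: J linear_neg mult.assoc[symmetric]\<close>)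

lemma J_linear: "linear J"
  by (rule linearI; rule coframe_eqI)
    (use coframe_linear in \<open>simp_all add: J linear_add linear_cmul algebra_simps\<close>)

lemma model_omega_J: "model_omega a b z0 z1 z2 [J u, J v] = model_omega a b z0 z1 z2 [u, v]"
  by (simp add: model_omega_eval J)

lemma model_omega_metric: "model_omega a b z0 z1 z2 [u, J v] =
    of_real (a * Re (cnj (z0 u) * z0 v) + a * Re (cnj (z1 u) * z1 v) + b\<^sup>2 * Re (cnj (z2 u) * z2 v))"
  by (simp add: model_omega_eval J)

lemma model_omega_pos:
  assumes "a > 0" "b \<noteq> 0" "u \<noteq> 0" shows "Re (model_omega a b z0 z1 z2 [u, J u]) > 0"
proof -
  have "\<not> (z0 u = 0 \<and> z1 u = 0 \<and> z2 u = 0)" using assms(3) co unfolding adapted_coframe_def by blast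
  moreover have r: "Re (cnj x * x) = (cmod x)\<^sup>2" for x
    unfolding cmod_power2 by (simp add: power2_eq_square)
  have "Re (model_omega a b z0 z1 z2 [u, J u]) = a * (cmod (z0 u))\<^sup>2 + a * (cmod (z1 u))\<^sup>2 + b\<^sup>2 * (cmod (z2 u))\<^sup>2"
    unfolding model_omega_metric r Re_complex_of_real ..
  moreover have "a * (cmod (z0 u))\<^sup>2 \<ge> 0" "a * (cmod (z1 u))\<^sup>2 \<ge> 0" "b\<^sup>2 * (cmod (z2 u))\<^sup>2 \<ge> 0"
    "z0 u \<noteq> 0 \<Longrightarrow> a * (cmod (z0 u))\<^sup>2 > 0" "z1 u \<noteq> 0 \<Longrightarrow> a * (cmod (z1 u))\<^sup>2 > 0" "z2 u \<noteq> 0 \<Longrightarrow> b\<^sup>2 * (cmod (z2 u))\<^sup>2 > 0"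
    using assms by simp_all
  ultimately show ?thesis by linarith
qed

end

text \<open>Both sides are multiples of \<open>model_volume\<close>, and
  \<open>- 8 * \<i> * (3 / 4 * \<i>) / 6 = 1\<close>, so the factors to compare are
  \<open>(cmod k)\<^sup>2\<close> and \<open>a\<^sup>2 * b\<^sup>2\<close>.\<close>

lemma model_volume_identity:
  "(\<forall>vs. (model_Omega k z0 z1 z2 \<and>\<^sub>f cnj_form (model_Omega k z0 z1 z2)) vs =
     - 8 * \<i> * (wedge_power (model_omega a b z0 z1 z2) 3 vs / fact 3)) \<longleftrightarrow> (cmod k)\<^sup>2 = a\<^sup>2 * b\<^sup>2"
proof -
  have f: "(fact 3 :: complex) = 6" by (simp add: fact_numeral)
  have r: "- 8 * \<i> * (wedge_power (model_omega a b z0 z1 z2) 3 vs / fact 3) = of_real (a\<^sup>2 * b\<^sup>2) * model_volume z0 z1 z2 vs" for vs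
    unfolding model_omega_cubed f form_scale_def by (simp add: field_simps)
  have l: "(model_Omega k z0 z1 z2 \<and>\<^sub>f cnj_form (model_Omega k z0 z1 z2)) vs = of_real ((cmod k)\<^sup>2) * model_volume z0 z1 z2 vs" for vs
    unfolding model_Omega_cnj form_scale_def ..
  obtain vs where vs: "model_volume z0 z1 z2 vs \<noteq> 0" using model_volume_nonzero by blast
  show ?thesis
    unfolding r l
  proof
    assume "\<forall>vs. of_real ((cmod k)\<^sup>2) * model_volume z0 z1 z2 vs = of_real (a\<^sup>2 * b\<^sup>2) * model_volume z0 z1 z2 vs"
    then have "complex_of_real ((cmod k)\<^sup>2) = of_real (a\<^sup>2 * b\<^sup>2)" using vs by (metis mult_right_cancel)
    then show "(cmod k)\<^sup>2 = a\<^sup>2 * b\<^sup>2" by (metis of_real_eq_iff)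
  qed simp
qed

end

section \<open>Smooth dependence of solutions of linear systems\<close>

lemma smooth_on_det:
  fixes A :: "'v::euclidean_space \<Rightarrow> real^'n^'n"
  assumes U: "open U" and A: "\<And>i j. smooth_on U (\<lambda>x. A x $ i $ j)"
  shows "smooth_on U (\<lambda>x. det (A x))"
  unfolding det_def by (intro smooth_on_sum smooth_on_mult smooth_on_prod smooth_on_const U A)

lemma smooth_on_vec:
  fixes f :: "'v::euclidean_space \<Rightarrow> real^'n"
  assumes U: "open U" and f: "\<And>i. smooth_on U (\<lambda>x. f x $ i)"
  shows "smooth_on U f"
proof -
  have "smooth_on U (\<lambda>x. \<Sum>i\<in>UNIV. (f x $ i) *\<^sub>R (axis i 1 :: real^'n))"
    by (intro smooth_on_sum smooth_on_scaleR smooth_on_const U f)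
  moreover have "(\<Sum>i\<in>UNIV. (f x $ i) *\<^sub>R (axis i 1 :: real^'n)) = f x" for x
    using basis_expansion[of "f x"] by (simp add: scalar_mult_eq_scaleR)
  ultimately show ?thesis by simp
qed

text \<open>Cramer's rule writes the solution as a quotient of determinants, which are polynomial in
  the entries.\<close>

lemma smooth_on_linear_solution:
  fixes A :: "'v::euclidean_space \<Rightarrow> real^'n^'n"
  assumes U: "open U" and A: "\<And>i j. smooth_on U (\<lambda>x. A x $ i $ j)" and b: "\<And>i. smooth_on U (\<lambda>x. b x $ i)"
    and det: "\<And>x. x \<in> U \<Longrightarrow> det (A x) \<noteq> 0" and eq: "\<And>x. x \<in> U \<Longrightarrow> A x *v w x = b x"
  shows "smooth_on U w"
proof (rule smooth_on_cong[OF U])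
  let ?C = "\<lambda>k x. (\<chi> i j. if j = k then b x $ i else A x $ i $ j) :: real^'n^'n"
  have "smooth_on U (\<lambda>x. ?C k x $ i $ j)" for k i j
    using A b by (cases "j = k") simp_all
  then show "smooth_on U (\<lambda>x. \<chi> k. det (?C k x) * inverse (det (A x)))"
    by (intro smooth_on_vec[OF U]) (simp add: smooth_on_mult[OF U] smooth_on_det[OF U] smooth_on_inverse[OF U det] A)
  show "(\<chi> k. det (?C k x) * inverse (det (A x))) = w x" if "x \<in> U" for x
    using cramer[OF det[OF that], of "w x" "b x"] eq[OF that] by (simp add: divide_inverse)
qed

text \<open>The equations \<open>\<beta>(w, e\<^sub>j, e\<^sub>k) = \<i> \<beta>(v, e\<^sub>j, e\<^sub>k)\<close> are overdetermined; their normal equations are a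
  square system with invertible matrix.\<close>
lemma smooth_on_rotation:
  fixes \<beta> :: "(real^'n) dform" and J :: "real^'n \<Rightarrow> real^'n \<Rightarrow> real^'n"
  assumes U: "open U" and \<beta>: "form_on U 3 \<beta>"
    and nd: "\<And>y w. y \<in> U \<Longrightarrow> (\<And>p q. \<beta> y [w, p, q] = 0) \<Longrightarrow> w = 0"
    and J: "\<And>y v p q. y \<in> U \<Longrightarrow> \<beta> y [J y v, p, q] = \<i> * \<beta> y [v, p, q]"
  shows "smooth_on U (\<lambda>y. J y v)"
proof -
  let ?e = "\<lambda>i. axis i 1 :: real^'n"
  define B where "B y l j k = \<beta> y [?e l, ?e j, ?e k]" for y l j k
  \<comment> \<open>The real part of the Gram matrix of the map sending \<open>w\<close> to all
    values \<open>\<beta>(w, e_j, e_k)\<close>; \<open>b\<close> below pairs this map with the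
    right-hand sides.\<close>
  define A where "A y = ((\<chi> l m. \<Sum>j\<in>UNIV. \<Sum>k\<in>UNIV. Re (cnj (B y l j k) * B y m j k)) :: real^'n^'n)" for y
  define b where "b y = ((\<chi> l. \<Sum>j\<in>UNIV. \<Sum>k\<in>UNIV. Re (cnj (B y l j k) * (\<i> * \<beta> y [v, ?e j, ?e k]))) :: real^'n)" for y
  have sm: "smooth_on U (\<lambda>y. \<beta> y vs)" for vs using \<beta> by (simp add: form_on_def)
  have l: "linear (\<lambda>u. \<beta> y [u, p, q])" "linear (\<lambda>p. \<beta> y [u, p, q])" "linear (\<lambda>q. \<beta> y [u, p, q])" if "y \<in> U" for y u p q
    using alternating_form_linear[OF form_on_alternating[OF \<beta> that], of "[]" "[p, q]"]
      alternating_form_linear[OF form_on_alternating[OF \<beta> that], of "[u]" "[q]"]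
      alternating_form_linear[OF form_on_alternating[OF \<beta> that], of "[u, p]" "[]"] by simp_all
  have expand: "f w = (\<Sum>m\<in>UNIV. of_real (w $ m) * f (?e m))" if "linear f" for f :: "real^'n \<Rightarrow> complex" and w
  proof -
    have "f w = f (\<Sum>m\<in>UNIV. (w $ m) *\<^sub>R ?e m)"
      using basis_expansion[of w] by (simp add: scalar_mult_eq_scaleR)
    then show ?thesis by (simp add: linear_sum[OF that] linear_cmul[OF that] scaleR_conv_of_real[where 'a = complex])
  qed
  have Aw: "(A y *v w) $ l = (\<Sum>j\<in>UNIV. \<Sum>k\<in>UNIV. Re (cnj (B y l j k) * \<beta> y [w, ?e j, ?e k]))" if y: "y \<in> U" for y w l
  proof -
    have "(A y *v w) $ l = (\<Sum>m\<in>UNIV. \<Sum>j\<in>UNIV. \<Sum>k\<in>UNIV. Re (cnj (B y l j k) * B y m j k) * w $ m)"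
      by (simp add: matrix_vector_mult_def A_def sum_distrib_right)
    also have "\<dots> = (\<Sum>j\<in>UNIV. \<Sum>m\<in>UNIV. \<Sum>k\<in>UNIV. Re (cnj (B y l j k) * B y m j k) * w $ m)"
      by (rule sum.swap)
    also have "\<dots> = (\<Sum>j\<in>UNIV. \<Sum>k\<in>UNIV. \<Sum>m\<in>UNIV. Re (cnj (B y l j k) * B y m j k) * w $ m)"
      by (intro sum.cong refl sum.swap)
    also have "\<dots> = (\<Sum>j\<in>UNIV. \<Sum>k\<in>UNIV. Re (cnj (B y l j k) * \<beta> y [w, ?e j, ?e k]))"
    proof (intro sum.cong refl)
      fix j k
      have "cnj (B y l j k) * \<beta> y [w, ?e j, ?e k] = (\<Sum>m\<in>UNIV. cnj (B y l j k) * (of_real (w $ m) * B y m j k))"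
        by (simp add: expand[OF l(1)[OF y], of w] B_def sum_distrib_left)
      then show "(\<Sum>m\<in>UNIV. Re (cnj (B y l j k) * B y m j k) * w $ m) = Re (cnj (B y l j k) * \<beta> y [w, ?e j, ?e k])"
        by (simp add: algebra_simps)
    qed
    finally show ?thesis .
  qed
  \<comment> \<open>The product of \<open>w\<close> with \<open>A w\<close> is the sum of the
    squares \<open>|\<beta>(w, e_j, e_k)|\<^sup>2\<close>, so a vector in the kernel has zero
    contraction with \<beta> and vanishes by \<open>nd\<close>.\<close>
  have inj: "w = 0" if y: "y \<in> U" and "A y *v w = 0" for y w
  proof -
    have "0 = (\<Sum>l\<in>UNIV. w $ l * (A y *v w) $ l)" using that by simp
    also have "\<dots> = (\<Sum>l\<in>UNIV. \<Sum>j\<in>UNIV. \<Sum>k\<in>UNIV. w $ l * Re (cnj (B y l j k) * \<beta> y [w, ?e j, ?e k]))"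
      by (simp add: Aw[OF y] sum_distrib_left)
    also have "\<dots> = (\<Sum>j\<in>UNIV. \<Sum>l\<in>UNIV. \<Sum>k\<in>UNIV. w $ l * Re (cnj (B y l j k) * \<beta> y [w, ?e j, ?e k]))"
      by (rule sum.swap)
    also have "\<dots> = (\<Sum>j\<in>UNIV. \<Sum>k\<in>UNIV. \<Sum>l\<in>UNIV. w $ l * Re (cnj (B y l j k) * \<beta> y [w, ?e j, ?e k]))"
      by (intro sum.cong refl sum.swap)
    also have "\<dots> = (\<Sum>j\<in>UNIV. \<Sum>k\<in>UNIV. (cmod (\<beta> y [w, ?e j, ?e k]))\<^sup>2)"
    proof (intro sum.cong refl)
      fix j k
      let ?x = "\<beta> y [w, ?e j, ?e k]"
      have "cnj ?x * ?x = (\<Sum>l\<in>UNIV. of_real (w $ l) * cnj (B y l j k) * ?x)"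
        by (subst (1) expand[OF l(1)[OF y], of w]) (simp add: B_def sum_distrib_right)
      then have "Re (cnj ?x * ?x) = (\<Sum>l\<in>UNIV. w $ l * Re (cnj (B y l j k) * ?x))"
        by (simp add: algebra_simps)
      then show "(\<Sum>l\<in>UNIV. w $ l * Re (cnj (B y l j k) * ?x)) = (cmod ?x)\<^sup>2"
        unfolding cmod_power2 by (simp add: power2_eq_square)
    qed
    finally have "\<beta> y [w, ?e j, ?e k] = 0" for j k
      by (simp add: sum_nonneg_eq_0_iff sum_nonneg)
    then have "\<beta> y [w, p, q] = 0" for p q
      by (simp add: expand[OF l(2)[OF y], where w = p] expand[OF l(3)[OF y], where w = q])
    then show "w = 0" using nd[OF y] by blast
  qed
  show ?thesis
  proof (rule smooth_on_linear_solution[OF U])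
    show "smooth_on U (\<lambda>y. A y $ i $ j)" for i j
      unfolding A_def B_def vec_lambda_beta
      by (intro smooth_on_sum smooth_on_bounded_linear[OF U bounded_linear_Re] smooth_on_mult
          smooth_on_bounded_linear[OF U bounded_linear_cnj] U sm)
    show "smooth_on U (\<lambda>y. b y $ i)" for i
      unfolding b_def B_def vec_lambda_beta
      by (intro smooth_on_sum smooth_on_bounded_linear[OF U bounded_linear_Re] smooth_on_mult smooth_on_const
          smooth_on_bounded_linear[OF U bounded_linear_cnj] U sm)
    show "det (A y) \<noteq> 0" if "y \<in> U" for y
    proof -
      have "inj ((*v) (A y))"
        using inj[OF that] by (simp add: linear_injective_0[OF matrix_vector_mul_linear])
      then show ?thesis
        by (metis invertible_det_nz invertible_left_inverse matrix_left_invertible_injective)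
    qed
    show "A y *v J y v = b y" if "y \<in> U" for y
      by (simp add: vec_eq_iff Aw[OF that] J[OF that] b_def)
  qed
qed

text \<open>The combination has the shape of \<open>W2\<close>, with \<omega> and \<theta> as the
  two forms.\<close>

lemma orbifold_form_lincomb:
  assumes \<alpha>: "orbifold_form Z k \<alpha>" and \<beta>: "orbifold_form Z k \<beta>" and Z: "orbifold Z"
  shows "orbifold_form Z k (\<lambda>d x vs. l * (\<alpha> d x vs + m * \<beta> d x vs))"
  unfolding orbifold_form_def
proof (intro conjI ballI allI impI)
  fix d assume d: "d \<in> orb_atlas Z"
  have U: "open (chart_dom d)" using Z d by (auto simp: orbifold_def uniformizing_chart_def)
  have f: "form_on (chart_dom d) k (\<alpha> d)" "form_on (chart_dom d) k (\<beta> d)"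
    using \<alpha> \<beta> d by (auto simp: orbifold_form_def)
  have alt: "alternating_form k (\<lambda>vs. l * (\<alpha> d x vs + m * \<beta> d x vs))" if "x \<in> chart_dom d" for x
  proof -
    have lin: "linear (\<lambda>v. l * (f v + m * g v))" if "linear f" "linear g" for f g :: "'a \<Rightarrow> complex"
      by (rule linearI) (simp_all add: linear_add[OF that(1)] linear_add[OF that(2)] linear_cmul[OF that(1)]
          linear_cmul[OF that(2)] algebra_simps)
    show ?thesis
      using form_on_alternating[OF f(1) that] form_on_alternating[OF f(2) that]
      unfolding alternating_form_def by (auto intro!: lin)
  qed
  have "smooth_form (chart_dom d) (\<lambda>x. l *\<^sub>f (\<alpha> d x +\<^sub>f m *\<^sub>f \<beta> d x))"
    by (intro smooth_form_scale smooth_form_add U form_on_smooth_form[OF f(1)] form_on_smooth_form[OF f(2)])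
  then have "smooth_form (chart_dom d) (\<lambda>x vs. l * (\<alpha> d x vs + m * \<beta> d x vs))"
    by (simp add: form_scale_def[abs_def] form_add_def[abs_def] smooth_form_def)
  with alt show "form_on (chart_dom d) k (\<lambda>x vs. l * (\<alpha> d x vs + m * \<beta> d x vs))"
    by (intro form_onI)
next
  fix c d W h x assume "c \<in> orb_atlas Z" "d \<in> orb_atlas Z" "transition c d W h" "x \<in> W"
  then have "pullback h (\<alpha> d) x = \<alpha> c x" "pullback h (\<beta> d) x = \<beta> c x"
    using \<alpha> \<beta> by (auto simp: orbifold_form_def)
  then show "pullback h (\<lambda>x vs. l * (\<alpha> d x vs + m * \<beta> d x vs)) x = (\<lambda>vs. l * (\<alpha> c x vs + m * \<beta> c x vs))"
    by (simp add: pullback_def fun_eq_iff)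
qed

lemma zero_form_eq: "zero_form d x = 0\<^sub>f"
  by (simp add: zero_form_def form_zero_def fun_eq_iff)

lemma alternating_form_zero: "alternating_form k 0\<^sub>f"
  by (simp add: alternating_form_def form_zero_def linear_zero)

lemma orbifold_form_zero: "orbifold_form Z k zero_form"
  unfolding orbifold_form_def form_on_def
  by (auto simp: zero_form_def pullback_def fun_eq_iff smooth_on_const alternating_form_def linear_zero)

section \<open>The SU(3)-structure on the quotient and its torsion\<close>

context
  fixes S :: "(real^7, 's) orbifold_data"
    and g :: "(real^7, 's) chart \<Rightarrow> (real^7) metric"
    and \<xi> :: "nat \<Rightarrow> (real^7, 's) chart \<Rightarrow> real^7 \<Rightarrow> real^7"
    and \<eta> :: "nat \<Rightarrow> (real^7, 's) oform"
    and \<Phi> :: "nat \<Rightarrow> (real^7, 's) chart \<Rightarrow> real^7 \<Rightarrow> real^7 \<Rightarrow> real^7"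
    and \<rho> :: "real \<Rightarrow> 's \<Rightarrow> 's"
    and Z :: "(real^6, 'z) orbifold_data" and q :: "'s \<Rightarrow> 'z"
    and a b :: real and c :: complex
    and \<omega> \<Omega> :: "(real^6, 'z) oform"
  assumes S: "three_sasakian_orbifold S g \<xi> \<eta> \<Phi>"
    and Q: "leaf_quotient S (\<xi> 3) \<rho> Z q"
    and \<omega>: "descends_to S (\<xi> 3) Z q 2 (omega_ab \<eta> a b) \<omega>"
    and \<Omega>: "descends_to S (\<xi> 3) Z q 3 (Omega_c \<eta> c) \<Omega>"
begin

lemma adapted_point:
  assumes "d \<in> orb_atlas Z" "y \<in> chart_dom d"
  obtains z0 z1 z2 where "adapted_coframe z0 z1 z2"
    "\<omega> d y = model_omega a b z0 z1 z2" "\<Omega> d y = model_Omega c z0 z1 z2"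
    "\<forall>\<theta>. descends_to S (\<xi> 3) Z q 2 (eta_eta_bar \<eta>) \<theta> \<longrightarrow> \<theta> d y = model_theta z2"
    "model_forms a b c (\<omega> d y) (\<Omega> d y) (model_theta z2) (ext_d (\<omega> d) y) (ext_d (\<Omega> d) y) z0 z1 z2"
proof (rule quotient_local_model[OF S Q \<omega> \<Omega> assms])
  fix z0 z1 z2 :: "real^6 \<Rightarrow> complex"
  assume lin: "linear z0" "linear z1" "linear z2"
    and sur: "\<And>p q r. \<exists>v. z0 v = p \<and> z1 v = q \<and> z2 v = r"
    and inj: "\<And>v. z0 v = 0 \<Longrightarrow> z1 v = 0 \<Longrightarrow> z2 v = 0 \<Longrightarrow> v = 0"
    and mf: "model_forms a b c (\<omega> d y) (\<Omega> d y) (model_theta z2) (ext_d (\<omega> d) y) (ext_d (\<Omega> d) y) z0 z1 z2"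
    and \<theta>: "\<And>\<theta>. descends_to S (\<xi> 3) Z q 2 (eta_eta_bar \<eta>) \<theta> \<Longrightarrow> \<theta> d y = model_theta z2"
  have co: "adapted_coframe z0 z1 z2"
    unfolding adapted_coframe_def using lin sur inj by blast
  have e: "\<omega> d y = model_omega a b z0 z1 z2" "\<Omega> d y = model_Omega c z0 z1 z2"
    using mf unfolding model_forms_def by blast+
  show thesis by (rule that[OF co e _ mf]) (use \<theta> in blast)
qed

lemma orbifold_Z: "orbifold Z"
  using Q by (simp add: leaf_quotient_def)

lemma open_chart_Z: "d \<in> orb_atlas Z \<Longrightarrow> open (chart_dom d)"
  using orbifold_Z by (auto simp: orbifold_def uniformizing_chart_def)

lemma orbifold_forms: "orbifold_form Z 2 \<omega>" "orbifold_form Z 3 \<Omega>"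
  using \<omega> \<Omega> by (auto simp: descends_to_def)

lemma point_Z: obtains d y where "d \<in> orb_atlas Z" "y \<in> chart_dom d"
  using orbifold_Z unfolding orbifold_def by blast

lemma su3_J:
  assumes su3: "su3_structure Z h J \<omega> \<Omega>" and d: "d \<in> orb_atlas Z" and y: "y \<in> chart_dom d"
    and co: "adapted_coframe z0 z1 z2" and e: "\<Omega> d y = model_Omega c z0 z1 z2"
  shows "c \<noteq> 0" "z0 (J d y v) = \<i> * z0 v" "z1 (J d y v) = \<i> * z1 v" "z2 (J d y v) = \<i> * z2 v"
proof -
  have nz: "\<exists>vs. \<Omega> d y vs \<noteq> 0" and ty: "type_pq (J d y) 3 0 (\<Omega> d y)"
    and ac: "almost_complex_on (chart_dom d) (J d)"
    using su3 d y by (auto simp: su3_structure_def orbifold_almost_complex_def)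
  show c: "c \<noteq> 0" using nz by (auto simp: e model_Omega_def form_scale_def)
  have JJ: "J d y (J d y u) = - u" for u using ac y by (simp add: almost_complex_on_def)
  have "form_on (chart_dom d) 3 (\<Omega> d)" using orbifold_forms(2) d by (simp add: orbifold_form_def)
  from type_3_0_rotate[OF form_on_alternating[OF this y] ty JJ]
  have "model_Omega c z0 z1 z2 [J d y v, p, r] = \<i> * model_Omega c z0 z1 z2 [v, p, r]" for p r
    by (simp add: e)
  from model_Omega_nondegenerate[OF co c this]
  show "z0 (J d y v) = \<i> * z0 v" "z1 (J d y v) = \<i> * z1 v" "z2 (J d y v) = \<i> * z2 v" .
qed

text \<open>On a vector with components \<open>1, 0, 0\<close> the metric has the value
  \<open>a\<close>, hence \<open>a > 0\<close>. The volume identity relates \<open>a\<close>,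
  \<open>b\<close> and \<open>c\<close>, and it excludes \<open>b = 0\<close> since
  \<open>c \<noteq> 0\<close>.\<close>

lemma su3_parameters:
  assumes su3: "su3_structure Z h J \<omega> \<Omega>"
  shows "a > 0" "b \<noteq> 0" "c \<noteq> 0" "(cmod c)\<^sup>2 = a\<^sup>2 * b\<^sup>2"
proof -
  obtain d y where d: "d \<in> orb_atlas Z" and y: "y \<in> chart_dom d" by (rule point_Z)
  obtain z0 z1 z2 where co: "adapted_coframe z0 z1 z2"
    and e: "\<omega> d y = model_omega a b z0 z1 z2" "\<Omega> d y = model_Omega c z0 z1 z2"
    by (rule adapted_point[OF d y])
  note J = su3_J[OF su3 d y co e(2)]
  show c: "c \<noteq> 0" by (rule J(1))
  have g: "of_real (h d y u v) = \<omega> d y [u, J d y v]" for u v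
    using su3 d y by (simp add: su3_structure_def)
  obtain v where v: "z0 v = 1" "z1 v = 0" "z2 v = 0" by (rule coframe_surj[OF co])
  have "v \<noteq> 0" using v(1) coframe_linear(1)[OF co] linear_0 by force
  then have "h d y v v > 0"
    using su3 d y by (auto simp: su3_structure_def orbifold_metric_def riemannian_on_def)
  moreover have "complex_of_real (h d y v v) = of_real a"
    by (simp add: g e model_omega_eval J v)
  ultimately show a: "a > 0" by simp
  have "\<forall>vs. (\<Omega> d y \<and>\<^sub>f cnj_form (\<Omega> d y)) vs = - 8 * \<i> * (wedge_power (\<omega> d y) 3 vs / fact 3)"
    using su3 d y by (simp add: su3_structure_def)
  then show v: "(cmod c)\<^sup>2 = a\<^sup>2 * b\<^sup>2"
    unfolding e model_volume_identity[OF co] .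
  show "b \<noteq> 0"
  proof
    assume "b = 0"
    then have "(cmod c)\<^sup>2 = 0" using v by simp
    then show False using c by simp
  qed
qed

text \<open>Coframes at different points are unrelated, so \<open>J\<close> is defined from
  \<Omega>: \<open>J v\<close> is the vector \<open>w\<close> with
  \<open>\<Omega>(w, p, r) = \<i> \<Omega>(v, p, r)\<close> for all \<open>p, r\<close>. A coframe
  at the point shows existence, non-degeneracy shows uniqueness. The metric is then forced to be
  \<open>\<omega>(u, J v)\<close>.\<close>

lemma su3_exists:
  assumes a: "a > 0" and c: "c \<noteq> 0" and b: "b\<^sup>2 = (cmod c)\<^sup>2 / a\<^sup>2"
  shows "defines_su3_structure Z \<omega> \<Omega>"
proof -
  have vol: "(cmod c)\<^sup>2 = a\<^sup>2 * b\<^sup>2" using a b by (simp add: field_simps)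
  have b0: "b \<noteq> 0" using vol c by auto
  define J :: "(real^6, 'z) chart \<Rightarrow> real^6 \<Rightarrow> real^6 \<Rightarrow> real^6"
    where "J d y v = (SOME w. \<forall>p r. \<Omega> d y [w, p, r] = \<i> * \<Omega> d y [v, p, r])" for d y v
  define h where "h d y u v = Re (\<omega> d y [u, J d y v])" for d y u v
  have unique: "w = J d y v" "\<Omega> d y [J d y v, p, r] = \<i> * \<Omega> d y [v, p, r]"
    if d: "d \<in> orb_atlas Z" and y: "y \<in> chart_dom d"
      and w: "\<And>p r. \<Omega> d y [w, p, r] = \<i> * \<Omega> d y [v, p, r]" for d y v w p r
  proof -
    have "\<forall>p r. \<Omega> d y [J d y v, p, r] = \<i> * \<Omega> d y [v, p, r]"
      unfolding J_def by (rule someI[of _ w]) (simp add: w)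
    then have Jv: "\<And>p r. \<Omega> d y [J d y v, p, r] = \<i> * \<Omega> d y [v, p, r]" by blast
    obtain z0 z1 z2 where co: "adapted_coframe z0 z1 z2" and e: "\<Omega> d y = model_Omega c z0 z1 z2"
      by (rule adapted_point[OF d y])
    show "w = J d y v"
      using model_Omega_nondegenerate[OF co c, of w \<i> v] model_Omega_nondegenerate[OF co c, of "J d y v" \<i> v] w Jv
      by (intro coframe_eqI[OF co]) (simp_all add: e)
    show "\<Omega> d y [J d y v, p, r] = \<i> * \<Omega> d y [v, p, r]" by (rule Jv)
  qed
  have J_coframe: "z0 (J d y v) = \<i> * z0 v" "z1 (J d y v) = \<i> * z1 v" "z2 (J d y v) = \<i> * z2 v"
    and J_rot: "\<Omega> d y [J d y v, p, r] = \<i> * \<Omega> d y [v, p, r]"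
    if d: "d \<in> orb_atlas Z" and y: "y \<in> chart_dom d" and co: "adapted_coframe z0 z1 z2"
      and e: "\<Omega> d y = model_Omega c z0 z1 z2" for d y v p r z0 z1 z2
  proof -
    obtain w where w: "z0 w = \<i> * z0 v" "z1 w = \<i> * z1 v" "z2 w = \<i> * z2 v"
      by (rule coframe_surj[OF co])
    have rot: "\<Omega> d y [w, p, r] = \<i> * \<Omega> d y [v, p, r]" for p r
      by (simp add: e model_Omega_eval w algebra_simps)
    note u = unique[OF d y, of w v, OF rot]
    show "z0 (J d y v) = \<i> * z0 v" "z1 (J d y v) = \<i> * z1 v" "z2 (J d y v) = \<i> * z2 v"
      using w u(1) by simp_all
    show "\<Omega> d y [J d y v, p, r] = \<i> * \<Omega> d y [v, p, r]" by (rule u(2))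
  qed
  have nondeg: "w = 0" if d: "d \<in> orb_atlas Z" and y: "y \<in> chart_dom d" and w: "\<And>p r. \<Omega> d y [w, p, r] = 0" for d y w
  proof -
    obtain z0 z1 z2 where co: "adapted_coframe z0 z1 z2" and e: "\<Omega> d y = model_Omega c z0 z1 z2"
      by (rule adapted_point[OF d y])
    have "model_Omega c z0 z1 z2 [w, p, r] = 0 * model_Omega c z0 z1 z2 [w, p, r]" for p r
      using w by (simp add: e)
    from model_Omega_nondegenerate[OF co c this]
    have "z0 w = z0 0" "z1 w = z1 0" "z2 w = z2 0" using coframe_linear[OF co] by (simp_all add: linear_0)
    then show ?thesis by (rule coframe_eqI[OF co])
  qed
  have fo: "form_on (chart_dom d) 2 (\<omega> d)" "form_on (chart_dom d) 3 (\<Omega> d)" if "d \<in> orb_atlas Z" for d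
    using orbifold_forms that by (auto simp: orbifold_form_def)
  have smJ: "smooth_on (chart_dom d) (\<lambda>y. J d y v)" if d: "d \<in> orb_atlas Z" for d v
  proof (rule smooth_on_rotation[OF open_chart_Z[OF d] fo(2)[OF d]])
    show "w = 0" if "y \<in> chart_dom d" "\<And>p r. \<Omega> d y [w, p, r] = 0" for y w
      using nondeg[OF d that] .
    show "\<Omega> d y [J d y v, p, r] = \<i> * \<Omega> d y [v, p, r]" if y: "y \<in> chart_dom d" for y v p r
    proof -
      obtain z0 z1 z2 where co: "adapted_coframe z0 z1 z2" and e: "\<Omega> d y = model_Omega c z0 z1 z2"
        by (rule adapted_point[OF d y])
      show ?thesis by (rule J_rot[OF d y co e])
    qed
  qed
  have acJ: "almost_complex_on (chart_dom d) (J d)" if d: "d \<in> orb_atlas Z" for d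
    unfolding almost_complex_on_def
  proof (intro conjI ballI allI)
    fix y u assume y: "y \<in> chart_dom d"
    obtain z0 z1 z2 where co: "adapted_coframe z0 z1 z2" and e: "\<Omega> d y = model_Omega c z0 z1 z2"
      by (rule adapted_point[OF d y])
    note Jc = J_coframe[OF d y co e]
    show "linear (J d y)" by (rule J_linear[OF co]) (rule Jc)+
    show "J d y (J d y u) = - u" by (rule J_square[OF co]) (rule Jc)+
  qed (rule smJ[OF d])
  have bil: "bilinear (h d y) \<and> (\<forall>u v. h d y u v = h d y v u) \<and> (\<forall>u. u \<noteq> 0 \<longrightarrow> h d y u u > 0) \<and>
      real_form (\<omega> d y) \<and> (\<forall>u v. \<omega> d y [J d y u, J d y v] = \<omega> d y [u, v]) \<and>
      (\<forall>u v. of_real (h d y u v) = \<omega> d y [u, J d y v]) \<and>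
      (\<exists>vs. \<Omega> d y vs \<noteq> 0) \<and> type_pq (J d y) 3 0 (\<Omega> d y) \<and>
      (\<forall>vs. (\<omega> d y \<and>\<^sub>f \<Omega> d y) vs = 0) \<and>
      (\<forall>vs. (\<Omega> d y \<and>\<^sub>f cnj_form (\<Omega> d y)) vs = - 8 * \<i> * (wedge_power (\<omega> d y) 3 vs / fact 3))"
    if d: "d \<in> orb_atlas Z" and y: "y \<in> chart_dom d" for d y
  proof -
    obtain z0 z1 z2 where co: "adapted_coframe z0 z1 z2"
      and e: "\<omega> d y = model_omega a b z0 z1 z2" "\<Omega> d y = model_Omega c z0 z1 z2"
      by (rule adapted_point[OF d y])
    note Jc = J_coframe[OF d y co e(2)]
    note cl = coframe_linear[OF co]
    have m: "model_omega a b z0 z1 z2 [u, J d y v] =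
        of_real (a * Re (cnj (z0 u) * z0 v) + a * Re (cnj (z1 u) * z1 v) + b\<^sup>2 * Re (cnj (z2 u) * z2 v))" for u v
      by (rule model_omega_metric[OF co, where J = "J d y"]) (rule Jc)+
    have h: "h d y u v = a * Re (cnj (z0 u) * z0 v) + a * Re (cnj (z1 u) * z1 v) + b\<^sup>2 * Re (cnj (z2 u) * z2 v)" for u v
      unfolding h_def e m Re_complex_of_real ..
    have 1: "bilinear (h d y)"
      unfolding bilinear_def
      by (auto intro!: linearI simp: h linear_add[OF cl(1)] linear_add[OF cl(2)] linear_add[OF cl(3)]
          linear_cmul[OF cl(1)] linear_cmul[OF cl(2)] linear_cmul[OF cl(3)] algebra_simps)
    have 2: "h d y u v = h d y v u" for u v by (simp add: h algebra_simps)
    have 3: "h d y u u > 0" if "u \<noteq> 0" for u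
      unfolding h_def e by (rule model_omega_pos[OF co, where J = "J d y"]) (rule Jc a b0 that)+
    have 4: "real_form (\<omega> d y)"
      unfolding real_form_def
    proof
      fix vs
      show "\<omega> d y vs \<in> \<real>"
      proof (cases "length vs = 2")
        case True
        then obtain u v where "vs = [u, v]" by (auto simp: length_Suc_conv numeral_2_eq_2)
        then show ?thesis unfolding e by (simp only: model_omega_eval Reals_of_real)
      next
        case False
        then show ?thesis using homogeneous_model_omega[of a b z0 z1 z2] by (simp add: e homogeneous_def)
      qed
    qed
    have 5: "\<omega> d y [J d y u, J d y v] = \<omega> d y [u, v]" for u v
      unfolding e by (rule model_omega_J[OF co, where J = "J d y"]) (rule Jc)+
    have 6: "of_real (h d y u v) = \<omega> d y [u, J d y v]" for u v
      unfolding h_def e m Re_complex_of_real ..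
    have 7: "\<exists>vs. \<Omega> d y vs \<noteq> 0"
    proof (rule ccontr)
      assume "\<not> ?thesis"
      then have "v = 0" for v :: "real^6" using nondeg[OF d y, of v] by blast
      from this[of "axis 1 1"] show False by (simp add: axis_eq_0_iff)
    qed
    have 8: "type_pq (J d y) 3 0 (\<Omega> d y)"
      unfolding e by (rule type_model_Omega[OF co]) (rule Jc)+
    have 9: "(\<omega> d y \<and>\<^sub>f \<Omega> d y) vs = 0" for vs
      unfolding e model_omega_Omega form_zero_def ..
    have 10: "\<forall>vs. (\<Omega> d y \<and>\<^sub>f cnj_form (\<Omega> d y)) vs = - 8 * \<i> * (wedge_power (\<omega> d y) 3 vs / fact 3)"
      unfolding e model_volume_identity[OF co] by (rule vol)
    show ?thesis using 1 2 3 4 5 6 7 8 9 10 by blast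
  qed
  have riem: "riemannian_on (chart_dom d) (h d)" if d: "d \<in> orb_atlas Z" for d
    unfolding riemannian_on_def
  proof (intro conjI ballI)
    fix y assume "y \<in> chart_dom d"
    from bil[OF d this] show "bilinear (h d y)" "\<forall>u v. h d y u v = h d y v u" "\<forall>u. u \<noteq> 0 \<longrightarrow> h d y u u > 0"
      by blast+
  next
    note U = open_chart_Z[OF d]
    have "smooth_on (chart_dom d) (\<lambda>y. h d y u v)" for u v
    proof (rule smooth_on_cong[OF U])
      have "smooth_on (chart_dom d) (\<lambda>y. \<omega> d y [u, p])" for p using fo(1)[OF d] by (simp add: form_on_def)
      \<comment> \<open>The argument \<open>J v\<close> moves with the point, so it is expanded in
        the basis.\<close>
      then show "smooth_on (chart_dom d) (\<lambda>y. Re (\<Sum>p\<in>Basis. (J d y v \<bullet> p) *\<^sub>R \<omega> d y [u, p]))"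
        by (intro smooth_on_bounded_linear[OF U bounded_linear_Re] smooth_on_sum[OF U] smooth_on_scaleR[OF U]
            smooth_on_bounded_linear[OF U bounded_linear_inner_left] smJ[OF d])
      show "Re (\<Sum>p\<in>Basis. (J d y v \<bullet> p) *\<^sub>R \<omega> d y [u, p]) = h d y u v" if y: "y \<in> chart_dom d" for y
        using linear_basis_expansion[OF alternating_form_linear[OF form_on_alternating[OF fo(1)[OF d] y], of "[u]" "[]"], of "J d y v"]
        by (simp add: h_def)
    qed
    then show "\<forall>u v. smooth_on (chart_dom d) (\<lambda>y. h d y u v)" by blast
  qed
  have trans: "J d (f x) (dd f x u) = dd f x (J c' x u)" "h d (f x) (dd f x u) (dd f x v) = h c' x u v"
    if c': "c' \<in> orb_atlas Z" and d: "d \<in> orb_atlas Z" and f: "transition c' d W f" and x: "x \<in> W" for c' d W f x u v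
  proof -
    have W: "W \<subseteq> chart_dom c'" "f ` W \<subseteq> chart_dom d" "smooth_on W f" using f by (auto simp: transition_def)
    have xc: "x \<in> chart_dom c'" and fx: "f x \<in> chart_dom d" using W x by auto
    have pb: "\<omega> d (f x) (map (dd f x) vs) = \<omega> c' x vs" "\<Omega> d (f x) (map (dd f x) vs) = \<Omega> c' x vs" for vs
      using orbifold_forms c' d f x by (auto simp: orbifold_form_def pullback_def fun_eq_iff)
    have D: "linear (dd f x)" by (rule linear_frechet_derivative[OF smooth_on_differentiable[OF W(3) x]])
    \<comment> \<open>A vector killed by the differential has zero contraction with the pulled back
      form, which is the non-degenerate \<Omega> of the source chart.\<close>
    have "inj (dd f x)"
      unfolding linear_injective_0[OF D]
    proof (intro allI impI)
      fix w assume w: "dd f x w = 0"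
      have "\<Omega> c' x [w, p, r] = 0" for p r
        using pb(2)[of "[w, p, r]"] linear_0[OF alternating_form_linear[OF form_on_alternating[OF fo(2)[OF d] fx], of "[]" "[dd f x p, dd f x r]"]]
        by (simp add: w)
      then show "w = 0" by (rule nondeg[OF c' xc])
    qed
    then have surj: "surj (dd f x)" using linear_injective_imp_surjective[OF D] by blast
    obtain z0 z1 z2 where co: "adapted_coframe z0 z1 z2" and e: "\<Omega> c' x = model_Omega c z0 z1 z2"
      by (rule adapted_point[OF c' xc])
    have eqJ: "J d (f x) (dd f x u) = dd f x (J c' x u)" for u
    \<comment> \<open>The image of \<open>J u\<close> satisfies the equation that characterises
      \<open>J\<close> at the image of \<open>u\<close>.\<close>
    proof (rule unique(1)[OF d fx, symmetric])
      fix p r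
      obtain p' r' where "p = dd f x p'" "r = dd f x r'" using surj by (meson surjD)
      then show "\<Omega> d (f x) [dd f x (J c' x u), p, r] = \<i> * \<Omega> d (f x) [dd f x u, p, r]"
        using pb(2)[of "[J c' x u, p', r']"] pb(2)[of "[u, p', r']"] J_rot[OF c' xc co e] by simp
    qed
    show "J d (f x) (dd f x u) = dd f x (J c' x u)" by (rule eqJ)
    show "h d (f x) (dd f x u) (dd f x v) = h c' x u v"
      using pb(1)[of "[u, J c' x v]"] by (simp add: h_def eqJ)
  qed
  have "su3_structure Z h J \<omega> \<Omega>"
    unfolding su3_structure_def orbifold_metric_def orbifold_almost_complex_def
  proof (intro conjI ballI)
    fix d y assume "d \<in> orb_atlas Z" "y \<in> chart_dom d"
    note B = bil[OF this]
    show "real_form (\<omega> d y)" "\<forall>u v. \<omega> d y [J d y u, J d y v] = \<omega> d y [u, v]"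
      "\<forall>u v. of_real (h d y u v) = \<omega> d y [u, J d y v]"
      "\<exists>vs. \<Omega> d y vs \<noteq> 0" "type_pq (J d y) 3 0 (\<Omega> d y)" "\<forall>vs. (\<omega> d y \<and>\<^sub>f \<Omega> d y) vs = 0"
      "\<forall>vs. (\<Omega> d y \<and>\<^sub>f cnj_form (\<Omega> d y)) vs = - 8 * \<i> * (wedge_power (\<omega> d y) 3 vs / fact 3)"
      using B by blast+
  qed (use riem acJ trans orbifold_forms in blast)+
  then show ?thesis unfolding defines_su3_structure_def by blast
qed

text \<open>\<open>d\<omega>\<close> is a multiple of \<open>Im (\<Omega> / c)\<close>, which leaves
  nothing for \<open>W3\<close> and \<open>W4\<close>. A general unit number \<open>e\<close> is
  allowed so that the result applies to \<open>exp (\<i> * \<gamma>)\<close> as well as to the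
  quotient of \<open>c\<close> by \<open>a * b\<close>.\<close>

lemma su3_torsion:
  assumes su3: "su3_structure Z h J \<omega> \<Omega>" and \<theta>: "descends_to S (\<xi> 3) Z q 2 (eta_eta_bar \<eta>) \<theta>"
    and c: "c = of_real (a * b) * e"
    and e: "cmod e = 1"
  shows "torsion_classes Z J \<omega> \<Omega>
      (\<lambda>_ _. 4 * e * of_real (a + b\<^sup>2) / of_real (3 * a * b))
      (\<lambda>d x vs. 4 * e * of_real (2 * b\<^sup>2 - a) / of_real (3 * a * b) *
         (\<omega> d x vs + 3 * \<i> * of_real (b\<^sup>2) / 2 * \<theta> d x vs))
      zero_form zero_form zero_form"
proof -
  note par = su3_parameters[OF su3]
  \<comment> \<open>The common factor of \<open>W1\<close> and \<open>W2\<close>. The value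
    \<open>3 / 4 * a\<^sup>2 * b\<^sup>2 * k = c\<close> makes \<open>model_dOmega\<close> the
    decomposition of \<open>d\<Omega>\<close>, and \<open>cnj k * c = 4 / 3\<close> matches
    \<open>3 / 2 * Im (cnj W1 * \<Omega>)\<close> with the coefficient
    \<open>2 * (a + b\<^sup>2)\<close> of \<open>d\<omega>\<close>.\<close>
  define k where "k = 4 * e / of_real (3 * a * b)"
  have W1: "4 * e * of_real (a + b\<^sup>2) / of_real (3 * a * b) = k * of_real (a + b\<^sup>2)"
    and W2: "4 * e * of_real (2 * b\<^sup>2 - a) / of_real (3 * a * b) = k * of_real (2 * b\<^sup>2 - a)"
    by (simp_all add: k_def)
  have ck: "3 / 4 * of_real (a\<^sup>2 * b\<^sup>2) * k = c"
    using par by (simp add: k_def c field_simps power2_eq_square)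
  have kc: "cnj k * c = of_real (4 / 3)"
  proof -
    have "cnj e * e = 1" using e by (simp add: complex_norm_square[symmetric] mult.commute)
    then have "cnj k * c = 4 / of_real (3 * a * b) * of_real (a * b)" by (simp add: k_def c)
    then show ?thesis using par by simp
  qed
  have of\<theta>: "orbifold_form Z 2 \<theta>" using \<theta> by (simp add: descends_to_def)
  show ?thesis
    unfolding torsion_classes_def W1 W2
  proof (intro conjI ballI allI)
    show "orbifold_function Z (\<lambda>_ _. k * of_real (a + b\<^sup>2))"
      by (simp add: orbifold_function_def smooth_on_const)
    show "orbifold_form Z 2 (\<lambda>d x vs. k * of_real (2 * b\<^sup>2 - a) * (\<omega> d x vs + 3 * \<i> * of_real (b\<^sup>2) / 2 * \<theta> d x vs))"
      by (rule orbifold_form_lincomb[OF orbifold_forms(1) of\<theta> orbifold_Z])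
    show "orbifold_form Z 3 zero_form" "orbifold_form Z 1 zero_form" "orbifold_form Z 1 zero_form"
      by (rule orbifold_form_zero)+
    fix d y assume d: "d \<in> orb_atlas Z" and y: "y \<in> chart_dom d"
    obtain z0 z1 z2 where co: "adapted_coframe z0 z1 z2"
      and e: "\<omega> d y = model_omega a b z0 z1 z2" "\<Omega> d y = model_Omega c z0 z1 z2"
      and th: "\<forall>\<theta>. descends_to S (\<xi> 3) Z q 2 (eta_eta_bar \<eta>) \<theta> \<longrightarrow> \<theta> d y = model_theta z2"
      and mf: "model_forms a b c (\<omega> d y) (\<Omega> d y) (model_theta z2) (ext_d (\<omega> d) y) (ext_d (\<Omega> d) y) z0 z1 z2"
      by (rule adapted_point[OF d y])
    note J = su3_J(2,3,4)[OF su3 d y co e(2)]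
    note t = th[rule_format, OF \<theta>]
    have W2f: "(\<lambda>vs. k * of_real (2 * b\<^sup>2 - a) * (\<omega> d y vs + 3 * \<i> * of_real (b\<^sup>2) / 2 * \<theta> d y vs)) =
        (k * of_real (2 * b\<^sup>2 - a)) *\<^sub>f (model_omega a b z0 z1 z2 +\<^sub>f (3 * \<i> * of_real (b\<^sup>2) / 2) *\<^sub>f model_theta z2)"
      by (simp only: fun_eq_iff form_scale_def form_add_def e t) simp
    show "type_pq (J d y) 1 1 (\<lambda>vs. k * of_real (2 * b\<^sup>2 - a) * (\<omega> d y vs + 3 * \<i> * of_real (b\<^sup>2) / 2 * \<theta> d y vs))"
      unfolding e t by (rule type_model_2[OF co]) (rule J)+
    show "primitive (\<omega> d y) 2 (\<lambda>vs. k * of_real (2 * b\<^sup>2 - a) * (\<omega> d y vs + 3 * \<i> * of_real (b\<^sup>2) / 2 * \<theta> d y vs))"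
    proof -
      \<comment> \<open>Primitivity of a 2-form is tested against the power \<open>4 - 2\<close> of
        \<omega>.\<close>
      have "4 - 2 = (2::nat)" by simp
      then show ?thesis
        unfolding W2f unfolding primitive_def e
        by (simp only: wedge_scale_left model_W2_primitive form_scale_zero) (simp add: form_zero_def)
    qed
    show "real_form (zero_form d y)" "real_form (zero_form d y)"
      by (simp_all add: real_form_def zero_form_def)
    show "primitive (\<omega> d y) 3 (zero_form d y)"
      by (simp only: primitive_def zero_form_eq wedge_zero_left) (simp add: form_zero_def)
    show "\<exists>\<sigma> \<tau>. alternating_form 3 \<sigma> \<and> type_pq (J d y) 2 1 \<sigma> \<and> alternating_form 3 \<tau> \<and> type_pq (J d y) 1 2 \<tau> \<and>
        (\<forall>vs. zero_form d y vs = \<sigma> vs + \<tau> vs)"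
      by (intro exI[of _ "0\<^sub>f"]) (simp add: alternating_form_zero type_pq_def form_zero_def zero_form_def)
    show "type_pq (J d y) 1 0 (zero_form d y)" by (simp add: type_pq_def zero_form_def)
    fix vs
    have O1: "\<Omega> d y vs = c * model_Omega 1 z0 z1 z2 vs" by (simp add: e model_Omega_def form_scale_def)
    have "cnj (k * of_real (a + b\<^sup>2)) * \<Omega> d y vs = (cnj k * c) * of_real (a + b\<^sup>2) * model_Omega 1 z0 z1 z2 vs"
      by (simp add: O1)
    also have "\<dots> = of_real (4 / 3 * (a + b\<^sup>2)) * model_Omega 1 z0 z1 z2 vs"
      by (simp only: kc of_real_mult)
    finally have "Im (cnj (k * of_real (a + b\<^sup>2)) * \<Omega> d y vs) = 4 / 3 * (a + b\<^sup>2) * Im (model_Omega 1 z0 z1 z2 vs)"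
      by (simp only: times_complex.sel Re_complex_of_real Im_complex_of_real)
    moreover have "ext_d (\<omega> d) y vs = of_real (2 * (a + b\<^sup>2) * Im (model_Omega 1 z0 z1 z2 vs))"
      using mf unfolding model_forms_def by blast
    ultimately show "ext_d (\<omega> d) y vs = of_real (3 / 2 * Im (cnj (k * of_real (a + b\<^sup>2)) * \<Omega> d y vs)) +
        (zero_form d y \<and>\<^sub>f \<omega> d y) vs + zero_form d y vs"
      by (simp only: zero_form_eq wedge_zero_left) (simp add: form_zero_def)
    have "ext_d (\<Omega> d) y = c *\<^sub>f
      (2 *\<^sub>f (one_form z0 \<and>\<^sub>f one_form z1 \<and>\<^sub>f cnj_form (one_form z0) \<and>\<^sub>f cnj_form (one_form z1)) +\<^sub>f
       (- 2 * \<i>) *\<^sub>f (model_alpha3 z0 z1 \<and>\<^sub>f model_theta z2))"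
      using mf unfolding model_forms_def by blast
    also have "\<dots> = (k * of_real (a + b\<^sup>2)) *\<^sub>f wedge_power (\<omega> d y) 2 +\<^sub>f
      ((\<lambda>vs. k * of_real (2 * b\<^sup>2 - a) * (\<omega> d y vs + 3 * \<i> * of_real (b\<^sup>2) / 2 * \<theta> d y vs)) \<and>\<^sub>f \<omega> d y)"
      unfolding W2f unfolding e by (rule model_dOmega[of a b k z0 z1 z2, unfolded ck])
    finally show "ext_d (\<Omega> d) y vs = k * of_real (a + b\<^sup>2) * wedge_power (\<omega> d y) 2 vs +
        ((\<lambda>vs. k * of_real (2 * b\<^sup>2 - a) * (\<omega> d y vs + 3 * \<i> * of_real (b\<^sup>2) / 2 * \<theta> d y vs)) \<and>\<^sub>f \<omega> d y) vs +
        (cnj_form (zero_form d y) \<and>\<^sub>f \<Omega> d y) vs"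
      by (simp only: form_add_def form_scale_def zero_form_eq cnj_form_zero wedge_zero_left) (simp add: form_zero_def)
  qed
qed

text \<open>\<open>W2\<close> is the product of a scalar, zero only for
  \<open>a = 2 * b\<^sup>2\<close>, and a form that is tested on the plane where \<open>z0\<close>
  and \<open>z1\<close> vanish; \<open>W1\<close> is non-zero because \<open>a > 0\<close>.\<close>

lemma su3_LT:
  assumes su3: "su3_structure Z h J \<omega> \<Omega>" and \<theta>: "descends_to S (\<xi> 3) Z q 2 (eta_eta_bar \<eta>) \<theta>"
    and ne: "a \<noteq> 2 * b\<^sup>2"
  shows "LT_structure Z J \<omega> \<Omega>"
proof -
  note par = su3_parameters[OF su3]
  \<comment> \<open>The phase of \<open>c\<close> relative to \<open>a * b\<close>; for negative
    \<open>b\<close> the sign is absorbed in \<open>e\<close>.\<close>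
  define e where "e = c / of_real (a * b)"
  have ab: "a * b \<noteq> 0" using par by simp
  have ce: "c = of_real (a * b) * e" using ab by (simp add: e_def)
  have "(cmod c)\<^sup>2 = (a * b)\<^sup>2" using par(4) by (simp add: power_mult_distrib)
  then have "cmod c = \<bar>a * b\<bar>" by (metis abs_norm_cancel power2_eq_iff_nonneg abs_ge_zero power2_abs norm_ge_zero)
  then have e1: "cmod e = 1" using ab by (simp add: e_def norm_divide del: of_real_mult)
  then have e0: "e \<noteq> 0" by auto
  have p: "a + b\<^sup>2 \<noteq> 0" using par(1) by (smt (verit) zero_le_power2)
  obtain d y where d: "d \<in> orb_atlas Z" and y: "y \<in> chart_dom d" by (rule point_Z)
  obtain z0 z1 z2 where co: "adapted_coframe z0 z1 z2"
    and om: "\<omega> d y = model_omega a b z0 z1 z2"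
    and th: "\<forall>\<theta>. descends_to S (\<xi> 3) Z q 2 (eta_eta_bar \<eta>) \<theta> \<longrightarrow> \<theta> d y = model_theta z2"
    by (rule adapted_point[OF d y])
  obtain u where u: "z0 u = 0" "z1 u = 0" "z2 u = 1" by (rule coframe_surj[OF co])
  obtain v where v: "z0 v = 0" "z1 v = 0" "z2 v = \<i>" by (rule coframe_surj[OF co])
  \<comment> \<open>The two summands have the values \<open>b\<^sup>2\<close> and
    \<open>- 3 * b\<^sup>2\<close>.\<close>
  have "\<omega> d y [u, v] + 3 * \<i> * of_real (b\<^sup>2) / 2 * \<theta> d y [u, v] = of_real (- 2 * b\<^sup>2)"
    by (simp add: om th[rule_format, OF \<theta>] model_omega_eval model_theta_eval u v complex_eq_iff)
  also have "\<dots> \<noteq> 0" using par(2) by simp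
  finally have nz: "\<omega> d y [u, v] + 3 * \<i> * of_real (b\<^sup>2) / 2 * \<theta> d y [u, v] \<noteq> 0" .
  have ab': "complex_of_real (3 * a * b) \<noteq> 0" using ab by simp
  have n1: "4 * e * of_real (a + b\<^sup>2) / of_real (3 * a * b) \<noteq> 0"
    using e0 p ab' by (simp only: divide_eq_0_iff mult_eq_0_iff of_real_eq_0_iff) simp
  have "2 * b\<^sup>2 - a \<noteq> 0" using ne by simp
  then have n2: "4 * e * of_real (2 * b\<^sup>2 - a) / of_real (3 * a * b) *
      (\<omega> d y [u, v] + 3 * \<i> * of_real (b\<^sup>2) / 2 * \<theta> d y [u, v]) \<noteq> 0"
    using e0 nz ab' by (simp only: divide_eq_0_iff mult_eq_0_iff of_real_eq_0_iff) simp
  show ?thesis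
    unfolding LT_structure_def
    using su3_torsion[OF su3 \<theta> ce e1] n1 n2 d y by blast
qed

end

theorem theorem2:
  fixes S :: "(real^7, 's) orbifold_data"
    and g :: "(real^7, 's) chart \<Rightarrow> (real^7) metric"
    and \<xi> :: "nat \<Rightarrow> (real^7, 's) chart \<Rightarrow> real^7 \<Rightarrow> real^7"
    and \<eta> :: "nat \<Rightarrow> (real^7, 's) oform"
    and \<Phi> :: "nat \<Rightarrow> (real^7, 's) chart \<Rightarrow> real^7 \<Rightarrow> real^7 \<Rightarrow> real^7"
    and T :: real and \<rho> :: "real \<Rightarrow> 's \<Rightarrow> 's"
    and Z :: "(real^6, 'z) orbifold_data" and q :: "'s \<Rightarrow> 'z"
    and a b :: real and c :: complex
  assumes "three_sasakian_orbifold S g \<xi> \<eta> \<Phi>"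
    and "regular S (\<xi> 3) T \<rho> \<or> quasi_regular S (\<xi> 3) T \<rho>"
    and "leaf_quotient S (\<xi> 3) \<rho> Z q"
  shows "basic_form S (\<xi> 3) 2 (omega_ab \<eta> a b) \<and> basic_form S (\<xi> 3) 3 (Omega_c \<eta> c) \<and>
    (\<forall>\<omega> \<Omega>.
       descends_to S (\<xi> 3) Z q 2 (omega_ab \<eta> a b) \<omega> \<and>
       descends_to S (\<xi> 3) Z q 3 (Omega_c \<eta> c) \<Omega> \<longrightarrow>
       (defines_su3_structure Z \<omega> \<Omega> \<longleftrightarrow> a > 0 \<and> c \<noteq> 0 \<and> b\<^sup>2 = (cmod c)\<^sup>2 / a\<^sup>2) \<and>
       (\<forall>\<theta> h J.
          descends_to S (\<xi> 3) Z q 2 (eta_eta_bar \<eta>) \<theta> \<and> su3_structure Z h J \<omega> \<Omega> \<longrightarrow>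
          (a \<noteq> 2 * b\<^sup>2 \<longrightarrow> LT_structure Z J \<omega> \<Omega>) \<and>
          (\<forall>\<gamma>::real. c = of_real (a * b) * exp (\<i> * of_real \<gamma>) \<longrightarrow>
             torsion_classes Z J \<omega> \<Omega>
               (\<lambda>_ _. 4 * exp (\<i> * of_real \<gamma>) * of_real (a + b\<^sup>2) / of_real (3 * a * b))
               (\<lambda>d x vs. 4 * exp (\<i> * of_real \<gamma>) * of_real (2 * b\<^sup>2 - a) / of_real (3 * a * b) *
                  (\<omega> d x vs + 3 * \<i> * of_real (b\<^sup>2) / 2 * \<theta> d x vs))
               zero_form zero_form zero_form)))"
proof (intro conjI allI impI)
  show "basic_form S (\<xi> 3) 2 (omega_ab \<eta> a b)" "basic_form S (\<xi> 3) 3 (Omega_c \<eta> c)"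
    by (rule basic_invariant_forms[OF assms(1)])+
  fix \<omega> \<Omega> :: "(real^6, 'z) oform"
  assume "descends_to S (\<xi> 3) Z q 2 (omega_ab \<eta> a b) \<omega> \<and> descends_to S (\<xi> 3) Z q 3 (Omega_c \<eta> c) \<Omega>"
  then have d: "descends_to S (\<xi> 3) Z q 2 (omega_ab \<eta> a b) \<omega>" "descends_to S (\<xi> 3) Z q 3 (Omega_c \<eta> c) \<Omega>"
    by blast+
  note ctx = assms(1,3) d
  show "defines_su3_structure Z \<omega> \<Omega> \<longleftrightarrow> a > 0 \<and> c \<noteq> 0 \<and> b\<^sup>2 = (cmod c)\<^sup>2 / a\<^sup>2"
  proof
    assume "defines_su3_structure Z \<omega> \<Omega>"
    then obtain h J where "su3_structure Z h J \<omega> \<Omega>" unfolding defines_su3_structure_def by blast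
    from su3_parameters[OF ctx this]
    show "a > 0 \<and> c \<noteq> 0 \<and> b\<^sup>2 = (cmod c)\<^sup>2 / a\<^sup>2" by simp
  qed (use su3_exists[OF ctx] in blast)
  fix \<theta> h J
  assume "descends_to S (\<xi> 3) Z q 2 (eta_eta_bar \<eta>) \<theta> \<and> su3_structure Z h J \<omega> \<Omega>"
  then have \<theta>: "descends_to S (\<xi> 3) Z q 2 (eta_eta_bar \<eta>) \<theta>" and su3: "su3_structure Z h J \<omega> \<Omega>"
    by blast+
  show "LT_structure Z J \<omega> \<Omega>" if "a \<noteq> 2 * b\<^sup>2"
    by (rule su3_LT[OF ctx su3 \<theta> that])
  show "torsion_classes Z J \<omega> \<Omega>
      (\<lambda>_ _. 4 * exp (\<i> * of_real \<gamma>) * of_real (a + b\<^sup>2) / of_real (3 * a * b))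
      (\<lambda>d x vs. 4 * exp (\<i> * of_real \<gamma>) * of_real (2 * b\<^sup>2 - a) / of_real (3 * a * b) *
         (\<omega> d x vs + 3 * \<i> * of_real (b\<^sup>2) / 2 * \<theta> d x vs))
      zero_form zero_form zero_form"
    if "c = of_real (a * b) * exp (\<i> * of_real \<gamma>)" for \<gamma> :: real
    by (rule su3_torsion[OF ctx su3 \<theta> that]) (rule norm_exp_i_times)
qed

end
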